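(* Let $d>1$ be an integer and let $m,t$ be positive integers such that $t$ divides $m$, and let $\theta:\mathbb{D}^d\to\theta(\mathbb{D}^d)$ be the basic polynomial map associated to the group $G(m,t,d)$. Let $M_1$ and $X_1$ be the maximal ideal spaces of $H^\infty(\theta(\mathbb{D}^d))$ and $L^\infty(\partial\theta(\mathbb{D}^d),\mu)$ respectively, let $\tau_1:X_1\to M_1$ be the restriction map $\tau_1(\varphi)=\varphi|_{H^\infty(\theta(\mathbb{D}^d))}$, and let $\partial\subseteq M_1$ be the Šilov boundary of $H^\infty(\theta(\mathbb{D}^d))$. Then the map $\tau_1:X_1\to M_1$ is continuous and $\partial$ is a proper subset of $\tau_1(X_1)$.
   Context: $\mathbb{D}$ is the open unit disc, $\mathbb{T}$ the unit circle. The map $\theta=(\theta_1,\dots,\theta_d)$ is given by $\theta_j(\boldsymbol z)=E_j(z_1^m,\dots,z_d^m)$ for $1\le j\le d-1$ and $\theta_d(\boldsymbol z)=(z_1\cdots z_d)^{m/t}$, where $E_j$ is the $j$-th elementary symmetric polynomial in $d$ variables. ($G(m,t,d)$ is the group of maps $\boldsymbol z\mapsto(\alpha^{\nu_1}z_{\sigma(1)},\dots,\alpha^{\nu_d}z_{\sigma(d)})$ with $\alpha=e^{2\pi i/m}$, $\sigma\in S_d$ and integers $\nu_1,\dots,\nu_d$ whose sum is divisible by $t$; $\theta(\mathbb{D}^d)$ is a domain in $\mathbb{C}^d$ biholomorphic to $\mathbb{D}^d/G(m,t,d)$.) $H^\infty(\theta(\mathbb{D}^d))$ is the Banach algebra of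 bounded holomorphic functions on $\theta(\mathbb{D}^d)$ with the sup norm. Write $\partial\theta(\mathbb{D}^d)=\theta(\mathbb{T}^d)$, and let $\mu$ be the push-forward under $\theta$ of the normalized Haar measure $\nu$ on $\mathbb{T}^d$. Each $f\in H^\infty(\theta(\mathbb{D}^d))$ has a boundary function $f^*(\boldsymbol q)=\lim_{r\to1^-}f(r^mq_1,r^{2m}q_2,\dots,r^{(d-1)m}q_{d-1},r^{dm/t}q_d)$, defined for $\mu$-almost every $\boldsymbol q\in\partial\theta(\mathbb{D}^d)$, and $f\mapsto f^*$ is an isometric embedding of $H^\infty(\theta(\mathbb{D}^d))$ as a subalgebra of $L^\infty(\partial\theta(\mathbb{D}^d),\mu)$; the restriction defining $\tau_1$ is with respect to this embedding, i.e. $\tau_1(\varphi)(f)=\varphi(f^* )$. The maximal ideal space of a unital commutative Banach algebra is the set of its unital complex homomorphisms with the weak$^*$ topology. A closed boundary for $H^\infty(\theta(\mathbb{D}^d))$ is a closed subset $\mathcal{C}$ of $M_1$ such that $\|f\|_\infty=\sup\{|\varphi(f)|:\varphi\in\mathcal{C}\}$ for all $f\in H^\infty(\theta(\mathbb{D}^d))$; the Šilov boundary $\partial$ is the smallest closed boundary. *)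

theory Defs
  imports "HOL-Analysis.Analysis" "HOL-Algebra.Module"
begin

text \<open>A commutative unital complex algebra is given as a \<open>module\<close> record over the scalars
  \<^typ>\<open>complex\<close>. Its characters are made extensional on the carrier, so that equality of HOL
  functions is equality of characters.\<close>

definition characters :: "(complex, 'v, 'e) module_scheme \<Rightarrow> ('v \<Rightarrow> complex) set" where
  "characters A = {\<phi> \<in> extensional (carrier A).
     \<phi> \<one>\<^bsub>A\<^esub> = 1 \<and>
     (\<forall>x\<in>carrier A. \<forall>y\<in>carrier A. \<phi> (x \<oplus>\<^bsub>A\<^esub> y) = \<phi> x + \<phi> y) \<and>
     (\<forall>x\<in>carrier A. \<forall>y\<in>carrier A. \<phi> (x \<otimes>\<^bsub>A\<^esub> y) = \<phi> x * \<phi> y) \<and>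
     (\<forall>c. \<forall>x\<in>carrier A. \<phi> (c \<odot>\<^bsub>A\<^esub> x) = c * \<phi> x)}"

text \<open>The weak-* topology is the topology of pointwise convergence on the algebra.\<close>

definition maximal_ideal_space :: "(complex, 'v, 'e) module_scheme \<Rightarrow> ('v \<Rightarrow> complex) topology" where
  "maximal_ideal_space A =
     subtopology (product_topology (\<lambda>_. euclidean) (carrier A)) (characters A)"

definition holomorphic_vec_on :: "(complex^'n \<Rightarrow> complex) \<Rightarrow> (complex^'n) set \<Rightarrow> bool" where
  "holomorphic_vec_on f \<Omega> \<longleftrightarrow>
     (\<forall>z\<in>\<Omega>. \<exists>f'. (f has_derivative f') (at z within \<Omega>) \<and> (\<forall>c v. f' (c *s v) = c * f' v))"

text \<open>Functions on \<open>\<Omega>\<close> are taken extensional; otherwise values outside \<open>\<Omega>\<close> would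
  give rise to spurious characters.\<close>

definition Hinf :: "(complex^'n) set \<Rightarrow> (complex, complex^'n \<Rightarrow> complex) module" where
  "Hinf \<Omega> = \<lparr>
     carrier = {f \<in> extensional \<Omega>. holomorphic_vec_on f \<Omega> \<and> bounded (f ` \<Omega>)},
     mult = (\<lambda>f g. \<lambda>z\<in>\<Omega>. f z * g z),
     one = (\<lambda>z\<in>\<Omega>. 1),
     zero = (\<lambda>z\<in>\<Omega>. 0),
     add = (\<lambda>f g. \<lambda>z\<in>\<Omega>. f z + g z),
     smult = (\<lambda>c f. \<lambda>z\<in>\<Omega>. c * f z)\<rparr>"

definition sup_norm_on :: "'a set \<Rightarrow> ('a \<Rightarrow> complex) \<Rightarrow> real" where
  "sup_norm_on \<Omega> f = (SUP z\<in>\<Omega>. norm (f z))"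

definition closed_boundary :: "(complex^'n) set \<Rightarrow> ((complex^'n \<Rightarrow> complex) \<Rightarrow> complex) set \<Rightarrow> bool" where
  "closed_boundary \<Omega> C \<longleftrightarrow>
     closedin (maximal_ideal_space (Hinf \<Omega>)) C \<and>
     (\<forall>f\<in>carrier (Hinf \<Omega>). sup_norm_on \<Omega> f = (SUP \<phi>\<in>C. norm (\<phi> f)))"

definition silov_boundary :: "(complex^'n) set \<Rightarrow> ((complex^'n \<Rightarrow> complex) \<Rightarrow> complex) set" where
  "silov_boundary \<Omega> = (LEAST C. closed_boundary \<Omega> C)"

definition ess_bounded :: "'a measure \<Rightarrow> ('a \<Rightarrow> complex) set" where
  "ess_bounded M = {f \<in> borel_measurable M. \<exists>C. AE x in M. norm (f x) \<le> C}"

definition AE_rel :: "'a measure \<Rightarrow> (('a \<Rightarrow> complex) \<times> ('a \<Rightarrow> complex)) set" where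
  "AE_rel M = {(f, g). f \<in> ess_bounded M \<and> g \<in> ess_bounded M \<and> (AE x in M. f x = g x)}"

definition Linf :: "'a measure \<Rightarrow> (complex, ('a \<Rightarrow> complex) set) module" where
  "Linf M = \<lparr>
     carrier = ess_bounded M // AE_rel M,
     mult = (\<lambda>X Y. {h \<in> ess_bounded M. \<exists>f\<in>X. \<exists>g\<in>Y. AE x in M. h x = f x * g x}),
     one = {h \<in> ess_bounded M. AE x in M. h x = 1},
     zero = {h \<in> ess_bounded M. AE x in M. h x = 0},
     add = (\<lambda>X Y. {h \<in> ess_bounded M. \<exists>f\<in>X. \<exists>g\<in>Y. AE x in M. h x = f x + g x}),
     smult = (\<lambda>c X. {h \<in> ess_bounded M. \<exists>f\<in>X. AE x in M. h x = c * f x})\<rparr>"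

text \<open>In the following, \<open>d = CARD('n)\<close>. The linear order of \<open>'n\<close> numbers the coordinates of
  \<^typ>\<open>complex^'n\<close>: the coordinate \<open>j\<close> is the \<open>coord_no j\<close>-th one, counted from 1 to \<open>d\<close>.\<close>

definition coord_no :: "'n::{finite,linorder} \<Rightarrow> nat" where
  "coord_no j = card {i. i \<le> j}"

definition polydisc :: "(complex^'n) set" where
  "polydisc = {z. \<forall>i. norm (z $ i) < 1}"

definition torus :: "(complex^'n) set" where
  "torus = {z. \<forall>i. norm (z $ i) = 1}"

definition elem_sym :: "nat \<Rightarrow> complex^'n \<Rightarrow> complex" where
  "elem_sym k w = (\<Sum>S | card S = k. \<Prod>i\<in>S. w $ i)"

definition theta :: "nat \<Rightarrow> nat \<Rightarrow> (complex, 'n::{finite,linorder}) vec \<Rightarrow> (complex, 'n) vec" where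
  "theta m t z = (\<chi> j. if coord_no j = CARD('n)
     then (\<Prod>i\<in>UNIV. z $ i) ^ (m div t)
     else elem_sym (coord_no j) (\<chi> i. (z $ i) ^ m))"

text \<open>The normalized Haar measure of the torus is the image of the uniform distribution on the
  unit cube under \<open>x \<mapsto> (exp (2 \<pi> i x\<^sub>j))\<^sub>j\<close>.\<close>

definition haar_torus :: "(complex^'n) measure" where
  "haar_torus = distr (uniform_measure lborel (cbox (0 :: real^'n) 1)) (restrict_space borel torus)
     (\<lambda>x. \<chi> j. cis (2 * pi * x $ j))"

definition boundary_measure :: "nat \<Rightarrow> nat \<Rightarrow> ((complex, 'n::{finite,linorder}) vec) measure" where
  "boundary_measure m t =
     distr haar_torus (restrict_space borel (theta m t ` torus)) (theta m t)"

definition dilate :: "nat \<Rightarrow> nat \<Rightarrow> real \<Rightarrow> (complex, 'n::{finite,linorder}) vec \<Rightarrow> (complex, 'n) vec" where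
  "dilate m t r q = (\<chi> j. of_real r ^
     (if coord_no j = CARD('n) then CARD('n) * (m div t) else coord_no j * m) * q $ j)"

text \<open>The boundary function of \<open>f\<close> as an element of \<open>L\<^sup>\<infinity>\<close>, that is, the class of all
  essentially bounded functions that agree almost everywhere with the radial limit of \<open>f\<close>.\<close>

definition boundary_fun ::
    "nat \<Rightarrow> nat \<Rightarrow> ((complex, 'n::{finite,linorder}) vec \<Rightarrow> complex) \<Rightarrow> ((complex, 'n) vec \<Rightarrow> complex) set" where
  "boundary_fun m t f = {g \<in> ess_bounded (boundary_measure m t).
     AE q in boundary_measure m t. ((\<lambda>r. f (dilate m t r q)) \<longlongrightarrow> g q) (at_left 1)}"

definition tau1 ::
    "nat \<Rightarrow> nat \<Rightarrow> (((complex, 'n::{finite,linorder}) vec \<Rightarrow> complex) set \<Rightarrow> complex) \<Rightarrow>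
     ((complex, 'n) vec \<Rightarrow> complex) \<Rightarrow> complex" where
  "tau1 m t \<phi> = (\<lambda>f\<in>carrier (Hinf (theta m t ` polydisc)). \<phi> (boundary_fun m t f))"

end

theory Submission
  imports Defs "HOL-Complex_Analysis.Complex_Analysis" "HOL-Real_Asymp.Real_Asymp"
    "HOL-Probability.Probability_Measure"
begin

text \<open>The slices \<open>w \<mapsto> f (\<theta> (w z))\<close>, \<open>z\<close> in the torus, are bounded holomorphic functions of one variable, so
  Fatou's theorem provides boundary functions and bounds \<open>f\<close> by them. A closed set of characters of the form
  \<open>\<tau>\<^sub>1(X\<^sub>K)\<close>, where \<open>X\<^sub>K\<close> consists of the characters of \<open>L\<^sup>\<infinity>\<close> that are 1 on the indicator of \<open>K\<close>, is thus a
  closed boundary as soon as \<open>f\<^sup>*\<close> attains its norm on \<open>K\<close>. This happens for every relatively open dense \<open>K\<close> that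
  is invariant under the diagonal circle action: the maximum of \<open>\<bar>f\<bar>\<close> over a dilated torus is almost attained
  on an open set of slices, hence on a slice contained in \<open>K\<close>. By Shilov's intersection theorem the
  Shilov boundary lies in \<open>\<tau>\<^sub>1(X\<^sub>K)\<close>.

  Such a \<open>K\<close> need not have full measure. With \<open>v = \<bar>q\<^sub>1\<bar>\<^sup>2\<close>, which is constant on slices, choose a lower
  semicontinuous function \<open>\<psi>\<close>, a sum of polynomial peaks, that is at least 1 on a dense set
  and at most 1/2 on a set of positive measure, and let \<open>K\<close> be the set where \<open>\<psi> (v) > 3/4\<close>. Since \<open>v\<close> is on the torus a
  rational expression in the coordinates, there is a bounded holomorphic \<open>f\<close> with \<open>\<bar>f\<^sup>*\<bar> = exp (\<psi> (v))\<close> almost everywhere.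
  A character of \<open>L\<^sup>\<infinity>\<close> living on the set where \<open>\<psi> (v) \<le> 1/2\<close> is then separated by \<open>f\<close> from \<open>\<tau>\<^sub>1(X\<^sub>K)\<close>.\<close>

text \<open>In dimension \<open>d = 1\<close> the torus is a single slice, so a non-empty invariant
  set is everything. For \<open>d > 1\<close> every single slice is a null set, and \<open>f\<close>
  is controlled by its boundary values slice by slice; this is why a set of positive measure can be
  disregarded. The obstacle is the choice of \<open>f\<close>. In several variables a bounded
  positive function on the torus need not be the boundary modulus of a bounded holomorphic function,
  and a polynomial \<open>p(v)\<close> is not the real part of a holomorphic function. On a slice,
  however, \<open>p(v)\<close> times a high power \<open>s\<close> of the last coordinate is
  holomorphic, and \<open>- 2 p(v) s / (1 - s)\<close> has real part \<open>p(v)\<close> at almost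
  every boundary point. Inside, that real part is \<open>p(v)\<close> minus \<open>p(v)\<close>
  times a Poisson kernel, hence at most \<open>p(v)\<close> as long as \<open>p(v)\<close> is
  non-negative. So the construction admits increasing sums of non-negative polynomials, which is the
  origin of the semicontinuity and of the shape of the peaks. Further powers of the last coordinate
  are free: they have modulus 1 on the torus and make the series converge inside.\<close>

no_notation fps_nth (infixl \<open>$\<close> 75)

section \<open>Lipschitz functions are differentiable almost everywhere\<close>

text \<open>A monotone Lipschitz function is the integral of the density of its Stieltjes measure, to which
  Lebesgue's differentiation theorem applies.\<close>

lemma emeasure_interval_measure_add:
  fixes F G :: "real \<Rightarrow> real"
  assumes F: "mono F" "continuous_on UNIV F" and G: "mono G" "continuous_on UNIV G"
    and FG: "\<And>x. F x + G x = c * x" and c: "c \<ge> 0" and A: "A \<in> sets borel"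
  shows "emeasure (interval_measure F) (A \<inter> {a<..b}) + emeasure (interval_measure G) (A \<inter> {a<..b})
    = ennreal c * emeasure lborel (A \<inter> {a<..b})"
proof -
  have Ioc: "emeasure (interval_measure H) {u<..v} = (if u \<le> v then ennreal (H v - H u) else 0)"
    if "mono H" "continuous_on UNIV H" for H :: "real \<Rightarrow> real" and u v
    using emeasure_interval_measure_Ioc_eq[of H u v] that
      by (auto simp: mono_def continuous_on_eq_continuous_at continuous_at_imp_continuous_at_within)
  have base: "emeasure (interval_measure F) {u<..v} + emeasure (interval_measure G) {u<..v}
      = ennreal c * emeasure lborel {u<..v}" for u v
  proof (cases "u \<le> v")
    case True
    have nn: "0 \<le> F v - F u" "0 \<le> G v - G u" using F(1) G(1) True by (auto simp: mono_def)
    have "F v - F u + (G v - G u) = c * (v - u)"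
      using FG[of v] FG[of u] by (simp add: algebra_simps)
    then show ?thesis
      using True nn c by (simp add: Ioc F G ennreal_plus[symmetric] ennreal_mult[symmetric] del: ennreal_plus)
  qed (simp add: Ioc F G)
  \<comment> \<open>Everything is cut down to one bounded interval, because the complement step of
    the induction over the sigma-algebra cancels a measure, which has to be finite.\<close>
  let ?I = "{a<..b}"
  let ?Q = "\<lambda>A. emeasure (interval_measure F) (A \<inter> ?I) + emeasure (interval_measure G) (A \<inter> ?I)
      = ennreal c * emeasure lborel (A \<inter> ?I)"
  have gen: "sets (borel :: real measure) = sigma_sets UNIV (range (\<lambda>(a, b). {a <.. b::real}))"
    by (subst borel_sigma_sets_Ioc) simp
  have fin: "emeasure (interval_measure F) (A \<inter> ?I) < \<infinity>" "emeasure (interval_measure G) (A \<inter> ?I) < \<infinity>"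
     "emeasure lborel (A \<inter> ?I) < \<infinity>" for A
  proof -
    have "emeasure (interval_measure F) (A \<inter> ?I) \<le> emeasure (interval_measure F) ?I"
      by (intro emeasure_mono) auto
    also have "\<dots> < \<infinity>" by (simp add: Ioc F)
    finally show "emeasure (interval_measure F) (A \<inter> ?I) < \<infinity>" .
    have "emeasure (interval_measure G) (A \<inter> ?I) \<le> emeasure (interval_measure G) ?I"
      by (intro emeasure_mono) auto
    also have "\<dots> < \<infinity>" by (simp add: Ioc G)
    finally show "emeasure (interval_measure G) (A \<inter> ?I) < \<infinity>" .
    have "emeasure lborel (A \<inter> ?I) \<le> emeasure lborel ?I"
      by (intro emeasure_mono) auto
    also have "\<dots> < \<infinity>" by (cases "a \<le> b") auto
    finally show "emeasure lborel (A \<inter> ?I) < \<infinity>" .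
  qed
  show ?thesis
  proof (rule sigma_sets_induct_disjoint[where P = ?Q and G = "range (\<lambda>(a, b). {a <.. b::real})" and \<Omega> = UNIV])
    show "Int_stable (range (\<lambda>(a, b). {a <.. b::real}))"
      by (auto simp: Int_stable_def)
    show "A \<in> sigma_sets UNIV (range (\<lambda>(a, b). {a <.. b::real}))" using A gen by simp
    show "?Q A" if "A \<in> range (\<lambda>(a, b). {a <.. b::real})" for A
    proof -
      from that obtain p where "A = (case p of (a, b) \<Rightarrow> {a<..b})" by (rule rangeE)
      then obtain u v where "A = {u<..v}" by (simp only: case_prod_beta)
      then have "A \<inter> ?I = {max u a<..min v b}" by auto
      then show ?thesis by (simp only: base)
    qed
    show "?Q (UNIV - B)" if B: "B \<in> sigma_sets UNIV (range (\<lambda>(a, b). {a <.. b::real}))" and Q: "?Q B" for B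
    proof -
      have Bm: "B \<in> sets borel" using B gen by simp
      have eq: "(UNIV - B) \<inter> ?I = ?I - B \<inter> ?I" by auto
      have split: "emeasure M ?I = emeasure M ((UNIV - B) \<inter> ?I) + emeasure M (B \<inter> ?I)"
        if "sets M = sets borel" for M :: "real measure"
      proof -
        have "?I - B \<inter> ?I \<in> sets M" "B \<inter> ?I \<in> sets M"
          unfolding that by (intro sets.Diff sets.Int Bm; simp)+
        then have "emeasure M (?I - B \<inter> ?I) + emeasure M (B \<inter> ?I) = emeasure M ((?I - B \<inter> ?I) \<union> (B \<inter> ?I))"
          by (rule plus_emeasure) auto
        moreover have "(?I - B \<inter> ?I) \<union> (B \<inter> ?I) = ?I" by auto
        ultimately show ?thesis unfolding eq by simp
      qed
      have 1: "emeasure (interval_measure F) ((UNIV - B) \<inter> ?I) + emeasure (interval_measure F) (B \<inter> ?I)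
         + (emeasure (interval_measure G) ((UNIV - B) \<inter> ?I) + emeasure (interval_measure G) (B \<inter> ?I))
        = ennreal c * (emeasure lborel ((UNIV - B) \<inter> ?I) + emeasure lborel (B \<inter> ?I))"
        using base[of a b] split[of "interval_measure F"] split[of "interval_measure G"] split[of lborel] by simp
      have 2: "(x + y) + k = z + k \<Longrightarrow> k < \<infinity> \<Longrightarrow> x + y = z" for x y k z :: ennreal
        by (metis ennreal_add_left_cancel add.commute less_irrefl infinity_ennreal_def)
      have "(emeasure (interval_measure F) ((UNIV - B) \<inter> ?I) + emeasure (interval_measure G) ((UNIV - B) \<inter> ?I))
          + ennreal c * emeasure lborel (B \<inter> ?I)
        = (emeasure (interval_measure F) ((UNIV - B) \<inter> ?I) + emeasure (interval_measure G) ((UNIV - B) \<inter> ?I))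
          + (emeasure (interval_measure F) (B \<inter> ?I) + emeasure (interval_measure G) (B \<inter> ?I))"
        by (simp only: Q)
      also have "\<dots> = ennreal c * (emeasure lborel ((UNIV - B) \<inter> ?I) + emeasure lborel (B \<inter> ?I))"
        unfolding 1[symmetric] by (simp only: add.assoc add.left_commute)
      also have "\<dots> = ennreal c * emeasure lborel ((UNIV - B) \<inter> ?I) + ennreal c * emeasure lborel (B \<inter> ?I)"
        by (rule distrib_left)
      finally show ?thesis
        by (rule 2) (use fin(3)[of B] in \<open>simp add: ennreal_mult_less_top\<close>)
    qed
    show "?Q (\<Union>i. B i)" if "disjoint_family B"
      "range B \<subseteq> sigma_sets UNIV (range (\<lambda>(a, b). {a <.. b::real}))" "\<And>i. ?Q (B i)" for B :: "nat \<Rightarrow> real set"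
    proof -
      have Bm: "B i \<in> sets borel" for i using that(2) gen by auto
      have s: "emeasure M ((\<Union>i. B i) \<inter> ?I) = (\<Sum>i. emeasure M (B i \<inter> ?I))"
        if "sets M = sets borel" for M :: "real measure"
      proof -
        have dis: "disjoint_family (\<lambda>i. B i \<inter> ?I)"
          using \<open>disjoint_family B\<close> by (rule disjoint_family_on_bisimulation) auto
        have "range (\<lambda>i. B i \<inter> ?I) \<subseteq> sets M" using \<open>sets M = sets borel\<close> Bm by auto
        from suminf_emeasure[OF this dis] show ?thesis by simp
      qed
      have "emeasure (interval_measure F) ((\<Union>i. B i) \<inter> ?I) + emeasure (interval_measure G) ((\<Union>i. B i) \<inter> ?I)
          = (\<Sum>i. emeasure (interval_measure F) (B i \<inter> ?I)) + (\<Sum>i. emeasure (interval_measure G) (B i \<inter> ?I))"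
        by (simp only: s sets_interval_measure)
      also have "\<dots> = (\<Sum>i. emeasure (interval_measure F) (B i \<inter> ?I) + emeasure (interval_measure G) (B i \<inter> ?I))"
        by (rule suminf_add) auto
      also have "\<dots> = (\<Sum>i. ennreal c * emeasure lborel (B i \<inter> ?I))"
        by (simp only: that(3))
      also have "\<dots> = ennreal c * (\<Sum>i. emeasure lborel (B i \<inter> ?I))"
        by (rule ennreal_suminf_cmult)
      also have "(\<Sum>i. emeasure lborel (B i \<inter> ?I)) = emeasure lborel ((\<Union>i. B i) \<inter> ?I)"
        by (simp only: s sets_lborel)
      finally show "?Q (\<Union>i. B i)" .
    qed
    show "?Q {}" by simp
  qed auto
qed

text \<open>Besides \<open>F\<close> also \<open>L * x - F x\<close> is monotone, and the two
  Stieltjes measures add up to \<open>L\<close> times Lebesgue measure. On bounded intervals the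
  measure of \<open>F\<close> is thus dominated by Lebesgue measure, and a null set is exhausted by
  bounded pieces.\<close>

lemma Lipschitz_absolutely_continuous:
  fixes F :: "real \<Rightarrow> real"
  assumes F: "mono F" and L: "L-lipschitz_on UNIV F"
  shows "absolutely_continuous lborel (interval_measure F)"
proof -
  have L0: "L \<ge> 0" using L lipschitz_on_nonneg by blast
  have contF: "continuous_on UNIV F" using L by (rule lipschitz_on_continuous_on)
  define G where "G x = L * x - F x" for x
  have monoG: "mono G"
  proof
    fix x y :: real assume "x \<le> y"
    then show "G x \<le> G y"
      using lipschitz_onD[OF L, of x y] by (simp add: G_def dist_real_def algebra_simps)
  qed
  have contG: "continuous_on UNIV G" unfolding G_def by (intro continuous_intros contF)
  have FG: "F x + G x = L * x" for x by (simp add: G_def)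
  note add = emeasure_interval_measure_add[OF F contF monoG contG FG L0]
  show ?thesis unfolding absolutely_continuous_def
  proof
    fix N :: "real set" assume N: "N \<in> null_sets lborel"
    have Nm: "N \<in> sets borel" using N by auto
    have z: "emeasure (interval_measure F) (N \<inter> {- real n<..real n}) = 0" for n
    proof -
      have "emeasure lborel (N \<inter> {- real n<..real n}) = 0"
        by (rule emeasure_eq_0[of N]) (use N in auto)
      with add[OF Nm, of "- real n" "real n"] show ?thesis by simp
    qed
    have "(\<Union>n. N \<inter> {- real n<..real n}) \<in> null_sets (interval_measure F)"
      by (rule null_sets_UN) (use z Nm in \<open>auto simp: null_sets_def\<close>)
    moreover have "(\<Union>n. N \<inter> {- real n<..real n}) = N"
    proof -
      have "\<exists>n. x \<in> {- real n<..real n}" for x :: real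
      proof -
        obtain n where "\<bar>x\<bar> < real n" using reals_Archimedean2 by blast
        then show ?thesis by (intro exI[of _ n]) auto
      qed
      then show ?thesis by blast
    qed
    ultimately show "N \<in> null_sets (interval_measure F)" by simp
  qed
qed

text \<open>The integrand is the Radon-Nikodym derivative of the Stieltjes measure of
  \<open>F\<close>. Absolute continuity lets its integral recover all of \<open>F b - F a\<close>; a
  singular part, as for the Cantor function, would be lost.\<close>

lemma mono_Lipschitz_eq_integral:
  fixes F :: "real \<Rightarrow> real"
  assumes F: "mono F" and L: "L-lipschitz_on UNIV F"
  obtains h where "\<And>a b. a \<le> b \<Longrightarrow> (h has_integral (F b - F a)) {a..b}"
proof -
  let ?N = "interval_measure F"
  have contF: "continuous_on UNIV F" using L by (rule lipschitz_on_continuous_on)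
  have rc: "\<And>x y. x \<le> y \<Longrightarrow> F x \<le> F y" "\<And>a. continuous (at_right a) F"
    using F contF by (auto simp: mono_def continuous_on_eq_continuous_at continuous_at_imp_continuous_at_within)
  note ac = Lipschitz_absolutely_continuous[OF F L]
  have sN: "sets ?N = sets lborel" by simp
  have dens: "density lborel (RN_deriv lborel ?N) = ?N"
    by (rule sigma_finite_measure.density_RN_deriv[OF sigma_finite_lborel ac sN])
  have sig: "sigma_finite_measure ?N" by (rule sigma_finite_interval_measure[OF rc])
  have fin: "AE x in lborel. RN_deriv lborel ?N x \<noteq> \<infinity>"
    by (rule sigma_finite_measure.RN_deriv_finite[OF sigma_finite_lborel sig ac sN])
  define h where "h x = enn2real (RN_deriv lborel ?N x)" for x
  have hm[measurable]: "h \<in> borel_measurable borel" unfolding h_def by measurable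
  have "(h has_integral (F b - F a)) {a..b}" if ab: "a \<le> b" for a b
  proof -
    have "ennreal (F b - F a) = emeasure ?N {a<..b}"
      by (subst emeasure_interval_measure_Ioc_eq[OF rc]) (use ab in auto)
    also have "\<dots> = emeasure (density lborel (RN_deriv lborel ?N)) {a<..b}" by (simp only: dens)
    also have "\<dots> = (\<integral>\<^sup>+x. RN_deriv lborel ?N x * indicator {a<..b} x \<partial>lborel)"
      by (rule emeasure_density) auto
    also have "\<dots> = (\<integral>\<^sup>+x. ennreal (h x * indicator {a<..b} x) \<partial>lborel)"
      by (rule nn_integral_cong_AE, rule AE_mp[OF fin])
        (auto intro!: AE_I2 simp: h_def less_top split: split_indicator)
    finally have "(\<integral>\<^sup>+x. ennreal (h x * indicator {a<..b} x) \<partial>lborel) = ennreal (F b - F a)" ..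
    then have "((\<lambda>x. h x * indicator {a<..b} x) has_integral (F b - F a)) UNIV"
      using rc(1)[OF ab] by (intro nn_integral_has_integral) (auto simp: h_def)
    then have "((\<lambda>x. if x \<in> {a<..b} then h x else 0) has_integral (F b - F a)) UNIV"
      by (rule has_integral_eq[rotated]) (auto simp: indicator_def)
    then have "(h has_integral (F b - F a)) {a<..b}"
      by (simp only: has_integral_restrict_UNIV)
    moreover have "negligible {x \<in> {a<..b} - {a..b}. h x \<noteq> 0}" "negligible {x \<in> {a..b} - {a<..b}. h x \<noteq> 0}"
      by (rule negligible_subset[of "{a}"]; auto)+
    ultimately show ?thesis using has_integral_spike_set_eq[of "{a<..b}" "{a..b}" h] by blast
  qed
  then show ?thesis by (rule that)
qed

text \<open>Adding \<open>L * x\<close> makes \<open>F\<close> monotone. The differentiation theorem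
  for integrals speaks of intervals to the right of a point, so it is applied to \<open>h\<close>
  and to its reflection, one for each one-sided difference quotient.\<close>

theorem Lipschitz_AE_differentiable:
  fixes F :: "real \<Rightarrow> real"
  assumes L: "L-lipschitz_on UNIV F"
  shows "AE x in lborel. \<exists>D. (F has_real_derivative D) (at x)"
proof -
  have L0: "L \<ge> 0" using L lipschitz_on_nonneg by blast
  define H where "H x = F x + L * x" for x
  have monoH: "mono H"
  proof
    fix x y :: real assume "x \<le> y"
    then show "H x \<le> H y"
      using lipschitz_onD[OF L, of x y] by (simp add: H_def dist_real_def algebra_simps)
  qed
  have LH: "(2*L)-lipschitz_on UNIV H"
  proof (rule lipschitz_onI)
    fix x y :: real
    have "\<bar>F x - F y + L * (x - y)\<bar> \<le> \<bar>F x - F y\<bar> + L * \<bar>x - y\<bar>"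
      using abs_triangle_ineq[of "F x - F y" "L * (x - y)"] L0 by (simp add: abs_mult)
    with lipschitz_onD[OF L, of x y] show "dist (H x) (H y) \<le> 2 * L * dist x y"
      by (simp add: H_def dist_real_def algebra_simps)
  qed (use L0 in simp)
  obtain h where h: "\<And>a b. a \<le> b \<Longrightarrow> (h has_integral (H b - H a)) {a..b}"
    using mono_Lipschitz_eq_integral[OF monoH LH] by blast
  have int1: "h integrable_on cbox a b" for a b
    by (cases "a \<le> b") (use h in \<open>auto simp: integrable_on_def cbox_interval\<close>)
  have int2: "(\<lambda>x. h (- x)) integrable_on cbox a b" for a b
    using integrable_reflect[of h "-a" "-b"] int1[of "-b" "-a"] by simp
  obtain N1 where N1: "negligible N1"
    "\<And>x e. x \<notin> N1 \<Longrightarrow> 0 < e \<Longrightarrow> \<exists>d>0. \<forall>k. 0 < k \<and> k < d \<longrightarrow>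
        norm (integral (cbox x (x + k *\<^sub>R One)) h /\<^sub>R k ^ DIM(real) - h x) < e"
    using integrable_ccontinuous_explicit[OF int1] by blast
  obtain N2 where N2: "negligible N2"
    "\<And>x e. x \<notin> N2 \<Longrightarrow> 0 < e \<Longrightarrow> \<exists>d>0. \<forall>k. 0 < k \<and> k < d \<longrightarrow>
        norm (integral (cbox x (x + k *\<^sub>R One)) (\<lambda>x. h (- x)) /\<^sub>R k ^ DIM(real) - h (- x)) < e"
    using integrable_ccontinuous_explicit[OF int2] by blast
  have "negligible (uminus ` N2)"
    by (rule negligible_differentiable_image_negligible) (use N2(1) in \<open>auto intro!: derivative_intros simp: differentiable_on_def\<close>)
  then have neg: "negligible (N1 \<union> uminus ` N2)" using N1(1) by (rule negligible_Un[rotated])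
  have der: "(H has_real_derivative h x) (at x)" if x: "x \<notin> N1 \<union> uminus ` N2" for x
    unfolding has_field_derivative_iff LIM_eq
  proof (intro allI impI)
    fix e :: real assume e: "e > 0"
    have x1: "x \<notin> N1" and x2: "- x \<notin> N2" using x by (auto simp: image_iff)
    obtain d1 where d1: "d1 > 0" "\<And>k. 0 < k \<Longrightarrow> k < d1 \<Longrightarrow>
        \<bar>(H (x + k) - H x) / k - h x\<bar> < e"
    proof -
      obtain d where d: "d > 0" "\<And>k. 0 < k \<Longrightarrow> k < d \<Longrightarrow>
        norm (integral (cbox x (x + k *\<^sub>R One)) h /\<^sub>R k ^ DIM(real) - h x) < e"
        using N1(2)[OF x1 e] by blast
      have "integral (cbox x (x + k *\<^sub>R One)) h = H (x + k) - H x" if "0 < k" for k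
        using h[of x "x + k"] that by (simp add: cbox_interval integral_unique)
      with d show ?thesis by (intro that[of d]) (auto simp: divide_inverse mult.commute)
    qed
    obtain d2 where d2: "d2 > 0" "\<And>k. 0 < k \<Longrightarrow> k < d2 \<Longrightarrow>
        \<bar>(H x - H (x - k)) / k - h x\<bar> < e"
    proof -
      obtain d where d: "d > 0" "\<And>k. 0 < k \<Longrightarrow> k < d \<Longrightarrow>
        norm (integral (cbox (-x) (-x + k *\<^sub>R One)) (\<lambda>x. h (- x)) /\<^sub>R k ^ DIM(real) - h x) < e"
        using N2(2)[OF x2 e] by auto
      have "integral (cbox (-x) (-x + k *\<^sub>R One)) (\<lambda>x. h (- x)) = H x - H (x - k)" if "0 < k" for k
        using h[of "x - k" "x"] that Henstock_Kurzweil_Integration.integral_reflect_real[of x "x - k" h]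
        by (simp add: cbox_interval integral_unique)
      with d show ?thesis by (intro that[of d]) (auto simp: divide_inverse mult.commute)
    qed
    show "\<exists>s>0. \<forall>y. y \<noteq> x \<and> norm (y - x) < s \<longrightarrow> norm ((H y - H x) / (y - x) - h x) < e"
    proof (intro exI[of _ "min d1 d2"] conjI allI impI)
      fix y assume y: "y \<noteq> x \<and> norm (y - x) < min d1 d2"
      show "norm ((H y - H x) / (y - x) - h x) < e"
      proof (cases "y > x")
        case True
        with y d1(2)[of "y - x"] show ?thesis by auto
      next
        case False
        have "(H y - H x) / (y - x) = (H x - H y) / (x - y)"
          using minus_divide_divide[of "H x - H y" "x - y"] by simp
        with False y d2(2)[of "x - y"] show ?thesis by auto
      qed
    qed (use d1 d2 in auto)
  qed
  have "AE x in lebesgue. x \<notin> N1 \<union> uminus ` N2"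
    using neg by (subst (asm) negligible_iff_null_sets) (rule AE_not_in)
  then have "AE x in lborel. x \<notin> N1 \<union> uminus ` N2" by (simp only: AE_completion_iff)
  then show ?thesis
  proof eventually_elim
    case (elim x)
    have "((\<lambda>x. H x - L * x) has_real_derivative (h x - L)) (at x)"
      using der[OF elim] by (auto intro!: derivative_eq_intros)
    then show ?case by (auto simp: H_def)
  qed
qed

section \<open>Radial limits of bounded holomorphic functions\<close>

text \<open>A primitive of the function is Lipschitz, and the radial limit exists wherever its
  boundary values are differentiable: after subtraction of the linear part one has to bound a derivative by
  boundary values that are \<open>o(\<bar>u - 1\<bar>)\<close>. The part of the Cauchy kernel reflected at the circle integrates to 0, and subtracting
  it gains a factor \<open>(1 - r) / \<bar>u - r\<bar>\<close>.\<close>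

lemma has_contour_integral_circlepath_0_iff:
  "(f has_contour_integral i) (circlepath 0 r) \<longleftrightarrow>
   ((\<lambda>x. f (of_real r * cis (2 * pi * x)) * (2 * of_real pi * \<i> * of_real r * cis (2 * pi * x))) has_integral i) {0..1}"
  unfolding has_contour_integral_def
  by (intro has_integral_cong)
    (simp add: vector_derivative_circlepath01, simp add: circlepath cis_conv_exp mult_ac)

text \<open>On the circle \<open>1 - r * u\<close> is \<open>u\<close> times the conjugate of
  \<open>u - r\<close>. So the integral is Cauchy's formula for \<open>1 / (1 - r * u)\<close> at
  the point \<open>r\<close>.\<close>

lemma Poisson_kernel_has_integral:
  fixes r :: real
  assumes r: "0 \<le> r" "r < 1"
  shows "((\<lambda>x. 1 / (norm (cis (2 * pi * x) - of_real r))\<^sup>2) has_integral 1 / (1 - r\<^sup>2)) {0..1}"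
proof -
  have nz: "1 - of_real r * u \<noteq> 0" if "u \<in> cball 0 1" for u :: complex
  proof
    assume "1 - of_real r * u = 0"
    then have "norm (of_real r * u) = 1" by (metis eq_iff_diff_eq_0 norm_one)
    moreover have "r * norm u \<le> r * 1" using that r by (intro mult_left_mono) auto
    ultimately show False using r by (simp add: norm_mult)
  qed
  have "((\<lambda>u. (1 / (1 - of_real r * u)) / (u - of_real r)) has_contour_integral
      (2 * of_real pi * \<i> * (1 / (1 - of_real r * of_real r)))) (circlepath 0 1)"
    using r nz by (intro Cauchy_integral_circlepath) (auto intro!: continuous_intros holomorphic_intros)
  then have "((\<lambda>x. (1 / (1 - of_real r * cis (2 * pi * x))) / (cis (2 * pi * x) - of_real r)
      * (2 * of_real pi * \<i> * cis (2 * pi * x))) has_integral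
      (2 * of_real pi * \<i> * (1 / (1 - of_real r * of_real r)))) {0..1}"
    by (simp add: has_contour_integral_circlepath_0_iff)
  then have "((\<lambda>x. (1 / (2 * of_real pi * \<i>)) * ((1 / (1 - of_real r * cis (2 * pi * x))) / (cis (2 * pi * x) - of_real r)
      * (2 * of_real pi * \<i> * cis (2 * pi * x)))) has_integral
      (1 / (2 * of_real pi * \<i>)) * (2 * of_real pi * \<i> * (1 / (1 - of_real r * of_real r)))) {0..1}"
    by (rule has_integral_mult_right)
  also have "(1 / (2 * of_real pi * \<i>)) * (2 * of_real pi * \<i> * (1 / (1 - of_real r * of_real r)))
     = (of_real (1 / (1 - r\<^sup>2)) :: complex)"
    by (simp add: power2_eq_square)
  also have "(\<lambda>x. (1 / (2 * of_real pi * \<i>)) * ((1 / (1 - of_real r * cis (2 * pi * x))) / (cis (2 * pi * x) - of_real r)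
      * (2 * of_real pi * \<i> * cis (2 * pi * x)))) =
      (\<lambda>x. complex_of_real (1 / (norm (cis (2 * pi * x) - of_real r))\<^sup>2))"
  proof
    fix x
    define u where "u = cis (2 * pi * x)"
    have u1: "u * cnj u = 1" "u \<noteq> 0" by (auto simp: u_def cis_cnj cis_mult)
    have eq: "1 - of_real r * u = u * cnj (u - of_real r)"
      using u1 by (simp add: algebra_simps)
    have ne: "u - of_real r \<noteq> 0" using r by (auto simp: u_def)
        (metis abs_of_nonneg less_irrefl norm_cis norm_of_real)
    have "(1 / (2 * of_real pi * \<i>)) * ((1 / (1 - of_real r * u)) / (u - of_real r) * (2 * of_real pi * \<i> * u))
      = u / ((1 - of_real r * u) * (u - of_real r))" by simp
    also have "\<dots> = u / (u * ((u - of_real r) * cnj (u - of_real r)))" unfolding eq by (simp only: mult_ac)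
    also have "\<dots> = 1 / ((u - of_real r) * cnj (u - of_real r))" using u1 by simp
    also have "\<dots> = of_real (1 / (norm (u - of_real r))\<^sup>2)"
      by (simp only: complex_norm_square[symmetric]) simp
    finally show "(1 / (2 * of_real pi * \<i>)) * ((1 / (1 - of_real r * cis (2 * pi * x))) / (cis (2 * pi * x) - of_real r)
      * (2 * of_real pi * \<i> * cis (2 * pi * x))) = complex_of_real (1 / (norm (cis (2 * pi * x) - of_real r))\<^sup>2)"
      unfolding u_def .
  qed
  finally have "((\<lambda>x. complex_of_real (1 / (norm (cis (2 * pi * x) - of_real r))\<^sup>2)) has_integral of_real (1 / (1 - r\<^sup>2))) {0..1}" .
  from has_integral_linear[OF this bounded_linear_Re] show ?thesis by (simp only: o_def Re_complex_of_real)
qed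

text \<open>\<open>1 / r\<close> is the mirror image of \<open>r\<close> in the circle, where
  \<open>|u - 1 / r| = |u - r| / r\<close>. The numerator of the difference contains the small
  factor \<open>1 / r - r\<close>; the constant 4 bounds \<open>(1 + r)^2\<close>.\<close>

lemma reflected_Cauchy_kernel_bound:
  fixes u :: complex and r :: real
  assumes u: "norm u = 1" and r: "0 < r" "r < 1"
  shows "norm (1 / (u - of_real r)\<^sup>2 - 1 / (u - of_real (1 / r))\<^sup>2) \<le> 4 * (1 - r) / norm (u - of_real r) ^ 3"
proof -
  define w where "w = u - of_real r"
  define w' where "w' = u - of_real (1 / r)"
  define n where "n = norm w"
  have uu: "u * cnj u = 1" using u by (metis complex_norm_square of_real_1 one_power2)
  have n: "n > 0" using u r by (auto simp: n_def w_def)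
  have w'n: "norm w' = n / r"
  proof -
    have "of_real r * w' = - (u * cnj w)"
      using r uu by (simp add: w_def w'_def algebra_simps)
    then have "norm (of_real r * w') = norm (u * cnj w)" by (simp only: norm_minus_cancel)
    then have "r * norm w' = n" using r u by (simp add: n_def norm_mult)
    then show ?thesis using r by (simp add: field_simps)
  qed
  then have nz: "w \<noteq> 0" "w' \<noteq> 0" using n r by (auto simp: n_def)
  have "1 / w\<^sup>2 - 1 / w'\<^sup>2 = (w' - w) * (w' + w) / (w\<^sup>2 * w'\<^sup>2)"
    using nz by (simp add: field_simps power2_eq_square)
  then have "norm (1 / w\<^sup>2 - 1 / w'\<^sup>2) = norm (w' - w) * norm (w' + w) / (n\<^sup>2 * (n / r)\<^sup>2)"
    by (simp add: norm_mult norm_divide norm_power w'n n_def)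
  also have "norm (w' - w) = 1 / r - r"
  proof -
    have "w' - w = of_real (r - 1 / r)" by (simp add: w_def w'_def)
    then have "norm (w' - w) = \<bar>r - 1 / r\<bar>" by (metis norm_of_real)
    moreover have "r < 1 / r" using r by (simp add: field_simps) (smt (verit) mult_le_cancel_left1)
    ultimately show ?thesis by simp
  qed
  also have "(1 / r - r) * norm (w' + w) / (n\<^sup>2 * (n / r)\<^sup>2)
      \<le> (1 / r - r) * (n / r + n) / (n\<^sup>2 * (n / r)\<^sup>2)"
  proof (intro divide_right_mono mult_left_mono)
    show "norm (w' + w) \<le> n / r + n" using norm_triangle_ineq[of w' w] by (simp add: w'n n_def)
    show "0 \<le> 1 / r - r" using r by (simp add: field_simps) (smt (verit) mult_le_cancel_left1)
  qed simp
  also have "\<dots> = (1 - r) * (1 + r)\<^sup>2 / n ^ 3"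
    using n r by (simp add: field_simps power2_eq_square power3_eq_cube)
  also have "\<dots> \<le> (1 - r) * 2\<^sup>2 / n ^ 3"
    using n r by (intro divide_right_mono mult_left_mono power_mono) auto
  finally show ?thesis by (simp add: w_def w'_def n_def mult.commute)
qed

text \<open>Since \<open>|u - 1| <= 2 |u - r|\<close> on the circle, the linear part of the bound
  meets the kernel as \<open>1 - r\<close> times \<open>1 / |u - r|^2\<close>, whose integral stays
  bounded. The cubic part cancels the third power in the denominator and leaves a multiple of
  \<open>1 - r\<close>.\<close>

lemma deriv_bound_reflected_kernel:
  fixes k :: "complex \<Rightarrow> complex" and r \<eta> C :: real
  assumes cont: "continuous_on (cball 0 1) k" and hol: "k holomorphic_on ball 0 1"
    and r: "0 < r" "r < 1" and \<eta>: "\<eta> \<ge> 0" and C: "C \<ge> 0"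
    and k: "\<And>u. norm u = 1 \<Longrightarrow> norm (k u) \<le> \<eta> * norm (u - 1) + C * norm (u - 1) ^ 3"
  shows "norm (deriv k (of_real r)) \<le> 8 * \<eta> + 32 * C * (1 - r)"
proof -
  let ?K = "\<lambda>u. 1 / (u - of_real r)\<^sup>2 - 1 / (u - of_real (1 / r))\<^sup>2"
  have rb: "of_real r \<in> ball (0::complex) 1" using r by simp
  note CD = Cauchy_derivative_integral_circlepath[OF cont hol rb]
  have "deriv k (of_real r) = (1 / (2 * of_real pi * \<i>) *
      contour_integral(circlepath 0 1) (\<lambda>u. k u/(u - of_real r)^2))"
    by (rule DERIV_imp_deriv) (rule CD(2))
  then have "contour_integral(circlepath 0 1) (\<lambda>u. k u/(u - of_real r)^2) = 2 * of_real pi * \<i> * deriv k (of_real r)"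
    by simp
  with CD(1) have 1: "((\<lambda>u. k u/(u - of_real r)^2) has_contour_integral 2 * of_real pi * \<i> * deriv k (of_real r)) (circlepath 0 1)"
    by (metis has_contour_integral_integral)
  have nz: "u - of_real (1 / r) \<noteq> 0" if "u \<in> cball 0 1" for u :: complex
  proof
    assume "u - of_real (1 / r) = 0"
    then have "norm u = \<bar>1 / r\<bar>" by (metis eq_iff_diff_eq_0 norm_of_real)
    moreover have "1 / r > 1" using r by simp
    ultimately show False using that r by simp
  qed
  have 2: "((\<lambda>u. k u/(u - of_real (1 / r))^2) has_contour_integral 0) (circlepath 0 1)"
  proof (rule Cauchy_theorem_convex[where S = "cball 0 1" and K = "{}"])
    show "continuous_on (cball 0 1) (\<lambda>u. k u/(u - of_real (1 / r))^2)"
      using nz by (intro continuous_intros cont) auto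
    have "(\<lambda>u. k u/(u - of_real (1 / r))^2) holomorphic_on ball 0 1"
      using nz by (intro holomorphic_intros hol) auto
    then show "(\<lambda>u. k u/(u - of_real (1 / r))^2) field_differentiable at x" if "x \<in> interior (cball 0 1) - {}" for x
      using that by (auto simp: holomorphic_on_open field_differentiable_def)
  qed auto
  have "((\<lambda>u. k u/(u - of_real r)^2 - k u/(u - of_real (1 / r))^2) has_contour_integral
      (2 * of_real pi * \<i> * deriv k (of_real r) - 0)) (circlepath 0 1)"
    by (rule has_contour_integral_diff[OF 1 2])
  then have int: "((\<lambda>x. (k (cis (2 * pi * x)) / (cis (2 * pi * x) - of_real r)\<^sup>2 - k (cis (2 * pi * x)) / (cis (2 * pi * x) - of_real (1/r))\<^sup>2)
       * (2 * of_real pi * \<i> * cis (2 * pi * x))) has_integral 2 * of_real pi * \<i> * deriv k (of_real r)) {0..1}"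
    by (simp add: has_contour_integral_circlepath_0_iff)
  have bd: "((\<lambda>x. 2 * pi * (8 * \<eta> * (1 - r) * (1 / (norm (cis (2 * pi * x) - of_real r))\<^sup>2) + 32 * C * (1 - r)))
     has_integral 2 * pi * (8 * \<eta> * (1 - r) * (1 / (1 - r\<^sup>2)) + 32 * C * (1 - r))) {0..1}"
  proof -
    have P: "((\<lambda>x. 1 / (norm (cis (2 * pi * x) - of_real r))\<^sup>2) has_integral 1 / (1 - r\<^sup>2)) {0..1}"
      using r by (intro Poisson_kernel_has_integral) auto
    have "((\<lambda>x. 32 * C * (1 - r)) has_integral 32 * C * (1 - r)) {0..1::real}"
      using has_integral_const_real[of "32 * C * (1 - r)" 0 1] by simp
    from has_integral_mult_right[OF has_integral_add[OF has_integral_mult_right[OF P] this]] show ?thesis .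
  qed
  have pw: "norm ((k u / (u - of_real r)\<^sup>2 - k u / (u - of_real (1/r))\<^sup>2) * (2 * of_real pi * \<i> * u))
      \<le> 2 * pi * (8 * \<eta> * (1 - r) * (1 / (norm (u - of_real r))\<^sup>2) + 32 * C * (1 - r))"
    if u: "norm u = 1" for u
  proof -
    define n where "n = norm (u - of_real r)"
    have n: "n > 0" using u r by (auto simp: n_def)
    have "1 - r \<le> n" using norm_triangle_ineq2[of u "of_real r"] u r by (simp add: n_def)
    moreover have "norm (u - 1) \<le> n + (1 - r)"
      using norm_triangle_ineq[of "u - of_real r" "of_real r - 1"] r
      by (simp add: n_def) (metis abs_of_neg diff_less_0_iff_less minus_diff_eq norm_of_real of_real_1 of_real_diff)
    ultimately have un: "norm (u - 1) \<le> 2 * n" by simp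
    have "norm (k u) \<le> \<eta> * (2 * n) + C * (2 * n) ^ 3"
      by (rule order_trans[OF k[OF u]]) (intro add_mono mult_left_mono power_mono un \<eta> C norm_ge_zero)
    then have "norm (k u) * norm (?K u) \<le> (\<eta> * (2 * n) + C * (2 * n) ^ 3) * (4 * (1 - r) / n ^ 3)"
      using reflected_Cauchy_kernel_bound[OF u r] n \<eta> C by (intro mult_mono) (auto simp: n_def)
    also have "\<dots> = 8 * \<eta> * (1 - r) * (1 / n\<^sup>2) + 32 * C * (1 - r)"
      using n by (simp add: field_simps power2_eq_square power3_eq_cube)
    finally have "norm (k u) * norm (?K u) \<le> 8 * \<eta> * (1 - r) * (1 / n\<^sup>2) + 32 * C * (1 - r)" .
    moreover have "k u / (u - of_real r)\<^sup>2 - k u / (u - of_real (1/r))\<^sup>2 = k u * ?K u"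
      by (simp add: right_diff_distrib)
    ultimately show ?thesis using u by (simp add: norm_mult n_def)
  qed
  have "norm (2 * of_real pi * \<i> * deriv k (of_real r)) \<le> 2 * pi * (8 * \<eta> * (1 - r) * (1 / (1 - r\<^sup>2)) + 32 * C * (1 - r))"
    using integral_norm_bound_integral[OF has_integral_integrable[OF int] has_integral_integrable[OF bd] pw]
    by (simp only: integral_unique[OF int] integral_unique[OF bd] norm_cis)
  then have "norm (deriv k (of_real r)) \<le> 8 * \<eta> * ((1 - r) / (1 - r\<^sup>2)) + 32 * C * (1 - r)"
    by (simp add: norm_mult)
  also have "8 * \<eta> * ((1 - r) / (1 - r\<^sup>2)) \<le> 8 * \<eta> * 1"
  proof (intro mult_left_mono)
    have "1 - r\<^sup>2 = (1 - r) * (1 + r)" by (simp add: power2_eq_square algebra_simps)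
    then show "(1 - r) / (1 - r\<^sup>2) \<le> 1" using r by simp
  qed (use \<eta> in simp)
  finally show ?thesis by simp
qed

text \<open>The hypothesis \<open>small\<close> is \<open>k u = o(|u - 1|)\<close> near 1, in a form
  that holds on the whole circle: away from 1 the cubic term takes over. Its coefficient may depend
  on \<open>\<eta>\<close>, since in the end it is multiplied by \<open>1 - r\<close>.\<close>

lemma radial_deriv_tendsto_0:
  fixes k :: "complex \<Rightarrow> complex"
  assumes cont: "continuous_on (cball 0 1) k" and hol: "k holomorphic_on ball 0 1"
    and small: "\<And>\<eta>. \<eta> > 0 \<Longrightarrow> \<exists>C\<ge>0. \<forall>u. norm u = 1 \<longrightarrow> norm (k u) \<le> \<eta> * norm (u - 1) + C * norm (u - 1) ^ 3"
  shows "((\<lambda>r. deriv k (of_real r)) \<longlongrightarrow> 0) (at_left (1::real))"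
  unfolding tendsto_iff
proof (intro allI impI)
  fix e :: real assume e: "e > 0"
  then obtain C where C: "C \<ge> 0" "\<And>u. norm u = 1 \<Longrightarrow> norm (k u) \<le> (e/16) * norm (u - 1) + C * norm (u - 1) ^ 3"
    using small[of "e/16"] by auto
  have "((\<lambda>r. 32 * C * (1 - r)) \<longlongrightarrow> 32 * C * (1 - 1)) (at_left (1::real))"
    by (intro tendsto_intros)
  then have "eventually (\<lambda>r. 32 * C * (1 - r) < e/2) (at_left 1)"
    by (rule order_tendstoD(2)) (use e in simp)
  moreover have "eventually (\<lambda>r::real. r \<in> {0<..<1}) (at_left 1)"
    by (rule eventually_at_left_real) simp
  ultimately show "eventually (\<lambda>r. dist (deriv k (of_real r)) 0 < e) (at_left 1)"
  proof eventually_elim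
    case (elim r)
    have "norm (deriv k (of_real r)) \<le> 8 * (e/16) + 32 * C * (1 - r)"
      using elim e C by (intro deriv_bound_reflected_kernel cont hol) auto
    then show ?case using elim by simp
  qed
qed

lemma norm_cis_diff_le: "norm (cis a - cis b) \<le> \<bar>a - b\<bar>"
proof -
  have "norm (cis a - cis b) \<le> 1 * norm (a - b)"
  proof (rule differentiable_bound[where S = UNIV and f' = "\<lambda>x h. h *\<^sub>R (\<i> * cis x)"])
    show "(cis has_derivative (\<lambda>h. h *\<^sub>R (\<i> * cis x))) (at x within UNIV)" for x
      using has_derivative_cis[of "\<lambda>x. x" "\<lambda>h. h"] by simp
    show "onorm (\<lambda>h. h *\<^sub>R (\<i> * cis x)) \<le> 1" for x
      by (intro onorm_le) (simp add: norm_mult)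
  qed auto
  then show ?thesis by simp
qed

lemma Lipschitz_AE_vector_differentiable:
  fixes f :: "real \<Rightarrow> complex"
  assumes L: "L-lipschitz_on UNIV f"
  shows "AE t in lborel. \<exists>D. (f has_vector_derivative D) (at t)"
proof -
  have L0: "L \<ge> 0" using L lipschitz_on_nonneg by blast
  have d: "norm (f x - f y) \<le> L * dist x y" for x y
    using lipschitz_onD[OF L, of x y] by (simp add: dist_norm)
  have "L-lipschitz_on UNIV (\<lambda>t. Re (f t))"
    by (rule lipschitz_onI[OF _ L0])
      (metis (no_types) d abs_Re_le_cmod dist_real_def minus_complex.simps(1) order_trans)
  moreover have "L-lipschitz_on UNIV (\<lambda>t. Im (f t))"
    by (rule lipschitz_onI[OF _ L0])
      (metis (no_types) d abs_Im_le_cmod dist_real_def minus_complex.simps(2) order_trans)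
  ultimately have "AE t in lborel. \<exists>D. ((\<lambda>t. Re (f t)) has_real_derivative D) (at t)"
    "AE t in lborel. \<exists>D. ((\<lambda>t. Im (f t)) has_real_derivative D) (at t)"
    by (auto intro: Lipschitz_AE_differentiable)
  then show ?thesis
  proof eventually_elim
    case (elim t)
    then obtain a b where "((\<lambda>t. Re (f t)) has_real_derivative a) (at t)" "((\<lambda>t. Im (f t)) has_real_derivative b) (at t)"
      by blast
    then have "(f has_vector_derivative Complex a b) (at t)"
      by (simp add: has_vector_derivative_complex_iff)
    then show ?case ..
  qed
qed

theorem Fatou_radial_limit:
  fixes g :: "complex \<Rightarrow> complex"
  assumes hol: "g holomorphic_on ball 0 1" and B: "\<And>z. z \<in> ball 0 1 \<Longrightarrow> norm (g z) \<le> B"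
  shows "AE t in lborel. \<exists>l. ((\<lambda>r. g (of_real r * cis (2 * pi * t))) \<longlongrightarrow> l) (at_left (1::real))"
proof -
  have B0: "B \<ge> 0" using B[of 0] norm_ge_zero order_trans by (metis centre_in_ball zero_less_one)
  obtain G where G: "\<And>x. x \<in> ball 0 1 \<Longrightarrow> (G has_field_derivative g x) (at x)"
    using holomorphic_convex_primitive'[OF _ _ hol] by (metis at_within_open convex_ball open_ball)
  have "B-lipschitz_on (ball 0 1) G"
  proof (rule lipschitz_onI)
    show "dist (G x) (G y) \<le> B * dist x y" if "x \<in> ball 0 1" "y \<in> ball 0 1" for x y
      using field_differentiable_bound[of "ball 0 1" G g B x y] G B that
      by (auto simp: dist_norm intro: has_field_derivative_at_within)
  qed (rule B0)
  from lipschitz_extend_closure[OF this] obtain H where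
    H: "B-lipschitz_on (cball 0 1) H" "\<And>x. x \<in> ball 0 1 \<Longrightarrow> H x = G x" by auto
  have derH: "(H has_field_derivative g x) (at x)" if "x \<in> ball 0 1" for x
    using has_field_derivative_transform_within_open[OF G[OF that] open_ball that] H(2) by metis
  have contH: "continuous_on (cball 0 1) H" using H(1) by (rule lipschitz_on_continuous_on)
  define \<gamma> where "\<gamma> t = H (cis (2 * pi * t))" for t
  have "(B * (2 * pi))-lipschitz_on UNIV \<gamma>"
  proof (rule lipschitz_onI)
    fix x y
    have "dist (\<gamma> x) (\<gamma> y) \<le> B * dist (cis (2 * pi * x)) (cis (2 * pi * y))"
      unfolding \<gamma>_def by (rule lipschitz_onD[OF H(1)]) auto
    also have "\<dots> \<le> B * \<bar>2 * pi * x - 2 * pi * y\<bar>"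
      unfolding dist_norm by (intro mult_left_mono norm_cis_diff_le B0)
    also have "\<bar>2 * pi * x - 2 * pi * y\<bar> = 2 * pi * \<bar>x - y\<bar>"
      by (simp add: abs_mult flip: right_diff_distrib)
    finally show "dist (\<gamma> x) (\<gamma> y) \<le> B * (2 * pi) * dist x y" by (simp add: dist_real_def)
  qed (use B0 in simp)
  then have "AE t in lborel. \<exists>D. (\<gamma> has_vector_derivative D) (at t)"
    by (rule Lipschitz_AE_vector_differentiable)
  then show ?thesis
  proof eventually_elim
    case (elim t)
    then obtain D where D: "(\<gamma> has_vector_derivative D) (at t)" by blast
    define e where "e = cis (2 * pi * t)"
    \<comment> \<open>\<open>D\<close> is a derivative in the angular parameter. Division by the
      derivative of \<open>cis (2 * pi * s)\<close> at 0 turns it into a derivative of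
      \<open>H (e * u)\<close> in \<open>u\<close> at 1, taken along the circle.\<close>
    define c where "c = D / (2 * of_real pi * \<i>)"
    define k where "k u = H (e * u) - H e - c * (u - 1)" for u
    have ne: "norm e = 1" by (simp add: e_def)
    have contk: "continuous_on (cball 0 1) k"
      unfolding k_def using ne
      by (intro continuous_intros continuous_on_compose2[OF contH]) (auto simp: norm_mult)
    have derk: "(k has_field_derivative (g (e * u) * e - c)) (at u)" if u: "u \<in> ball 0 1" for u
    proof -
      have eu: "e * u \<in> ball 0 1" using u ne by (simp add: norm_mult)
      have "((\<lambda>u. H (e * u)) has_field_derivative (g (e * u) * e)) (at u)"
        by (rule DERIV_chain2[where f = H and g = "\<lambda>u. e * u", OF derH[OF eu]]) (auto intro!: derivative_eq_intros)
      then show ?thesis unfolding k_def by (auto intro!: derivative_eq_intros)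
    qed
    have holk: "k holomorphic_on ball 0 1"
      unfolding holomorphic_on_open[OF open_ball] using derk by blast
    define \<phi> where "\<phi> s = \<gamma> (t + s) - \<gamma> t - c * (cis (2 * pi * s) - 1)" for s
    have d1: "((\<lambda>s. \<gamma> (t + s)) has_vector_derivative D) (at 0)"
    proof -
      have "(\<gamma> \<circ> (\<lambda>s. t + s) has_vector_derivative 1 *\<^sub>R D) (at 0)"
        by (rule vector_diff_chain_at) (use D in \<open>auto intro!: derivative_eq_intros\<close>)
      then show ?thesis by (simp add: o_def)
    qed
    have d2: "((\<lambda>s. cis (2 * pi * s)) has_vector_derivative (2 * of_real pi * \<i>)) (at 0)"
    proof -
      have "((\<lambda>s. cis (2 * pi * s)) has_derivative (\<lambda>h. (2 * pi * h) *\<^sub>R (\<i> * cis (2 * pi * 0)))) (at 0)"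
        by (rule has_derivative_cis) (auto intro!: derivative_eq_intros)
      then show ?thesis by (simp add: has_vector_derivative_def scaleR_conv_of_real mult_ac)
    qed
    have "(\<phi> has_vector_derivative (D - 0 - c * (2 * of_real pi * \<i> - 0))) (at 0)"
      unfolding \<phi>_def by (intro has_vector_derivative_diff d1 d2 has_vector_derivative_const has_vector_derivative_mult_right)
    then have d\<phi>: "(\<phi> has_derivative (\<lambda>_. 0)) (at 0)"
      by (simp add: c_def has_vector_derivative_def)
    \<comment> \<open>The parameter of a point \<open>u\<close> of the circle. Its differentiability
      at 1 converts \<open>o(|s|)\<close> in the parameter into \<open>o(|u - 1|)\<close>.\<close>
    define s where "s u = Im (Ln u) / (2 * pi)" for u
    have "(Ln has_field_derivative inverse 1) (at 1)" by (intro has_field_derivative_Ln) simp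
    moreover have "(*) (inverse (1::complex)) = (\<lambda>h. h)" by auto
    ultimately have "(Ln has_derivative (\<lambda>h. h)) (at 1)" by (simp only: has_field_derivative_def)
    then have ds: "(s has_derivative (\<lambda>h. Im h / (2 * pi))) (at 1)"
      unfolding s_def by (auto intro!: derivative_eq_intros)
    have s1: "s 1 = 0" by (simp add: s_def)
    have "((\<lambda>u. \<phi> (s u)) has_derivative (\<lambda>h. 0)) (at 1)"
      using has_derivative_compose[OF ds, of \<phi> "\<lambda>_. 0"] d\<phi> s1 by simp
    then have alt: "\<exists>d>0. \<forall>u. norm (u - 1) < d \<longrightarrow> norm (\<phi> (s u)) \<le> \<eta> * norm (u - 1)" if "\<eta> > 0" for \<eta>
      using that by (auto simp: has_derivative_at_alt s1 \<phi>_def)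
    have \<phi>k: "\<phi> (s u) = k u" if "norm u = 1" for u
    proof -
      have u0: "u \<noteq> 0" using that by auto
      have "cis (2 * pi * s u) = u"
        using that exp_Ln[OF u0] exp_eq_polar[of "Ln u"] by (simp add: s_def Re_Ln u0)
      moreover have "\<gamma> (t + s u) = H (e * cis (2 * pi * s u))"
        by (simp add: \<gamma>_def e_def cis_mult distrib_left)
      ultimately show ?thesis by (simp add: \<phi>_def k_def \<gamma>_def e_def)
    qed
    have "compact (k ` cball 0 1)" by (intro compact_continuous_image contk) simp
    then obtain K where K: "K > 0" "\<And>u. u \<in> cball 0 1 \<Longrightarrow> norm (k u) \<le> K"
      unfolding atomize_conj atomize_all atomize_imp
      using compact_imp_bounded[of "k ` cball 0 1"] by (auto simp: bounded_pos)
    have "\<exists>C\<ge>0. \<forall>u. norm u = 1 \<longrightarrow> norm (k u) \<le> \<eta> * norm (u - 1) + C * norm (u - 1) ^ 3" if \<eta>: "\<eta> > 0" for \<eta>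
    proof -
      obtain d where d: "d > 0" "\<And>u. norm (u - 1) < d \<Longrightarrow> norm (\<phi> (s u)) \<le> \<eta> * norm (u - 1)"
        using alt[OF \<eta>] by blast
      show ?thesis
      \<comment> \<open>Where \<open>|u - 1| >= d\<close>, the global bound \<open>K\<close> of
        \<open>k\<close> is at most \<open>K / d ^ 3 * |u - 1| ^ 3\<close>.\<close>
      proof (intro exI[of _ "K / d ^ 3"] conjI allI impI)
        fix u :: complex assume u: "norm u = 1"
        show "norm (k u) \<le> \<eta> * norm (u - 1) + K / d ^ 3 * norm (u - 1) ^ 3"
        proof (cases "norm (u - 1) < d")
          case True
          then have "norm (k u) \<le> \<eta> * norm (u - 1)" using d(2) \<phi>k[OF u] by metis
          also have "\<dots> \<le> \<eta> * norm (u - 1) + K / d ^ 3 * norm (u - 1) ^ 3" using K d by simp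
          finally show ?thesis .
        next
          case False
          have "norm (k u) \<le> K / d ^ 3 * d ^ 3" using K(2)[of u] u d by simp
          also have "\<dots> \<le> K / d ^ 3 * norm (u - 1) ^ 3"
            using False d K by (intro mult_left_mono power_mono) auto
          also have "\<dots> \<le> \<eta> * norm (u - 1) + K / d ^ 3 * norm (u - 1) ^ 3" using \<eta> by simp
          finally show ?thesis .
        qed
      qed (use K d in simp)
    qed
    then have "((\<lambda>r. deriv k (of_real r)) \<longlongrightarrow> 0) (at_left (1::real))"
      by (rule radial_deriv_tendsto_0[OF contk holk])
    then have "((\<lambda>r. (deriv k (of_real r) + c) / e) \<longlongrightarrow> (0 + c) / e) (at_left (1::real))"
      using ne by (intro tendsto_intros) auto
    moreover have "eventually (\<lambda>r::real. r \<in> {0<..<1}) (at_left 1)"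
      by (rule eventually_at_left_real) simp
    then have "eventually (\<lambda>r. (deriv k (of_real r) + c) / e = g (of_real r * e)) (at_left (1::real))"
    proof eventually_elim
      case (elim r)
      then have "deriv k (of_real r) = g (e * of_real r) * e - c"
        by (intro DERIV_imp_deriv derk) auto
      then show ?case using ne by (auto simp: mult.commute)
    qed
    ultimately have "((\<lambda>r. g (of_real r * e)) \<longlongrightarrow> (0 + c) / e) (at_left (1::real))"
      by (rule Lim_transform_eventually)
    then show ?case unfolding e_def by blast
  qed
qed

text \<open>Cauchy's formula on the circles of radius \<open>r n\<close>, followed by dominated
  convergence. The Cauchy denominator is bounded below by \<open>r n - norm a\<close>. At
  \<open>a = 0\<close> nothing is lost, and this sharp case later gives the lower bound for boundary
  moduli.\<close>

lemma radial_limit_estimate: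
  fixes g :: "complex \<Rightarrow> complex" and h :: "real \<Rightarrow> complex"
  assumes hol: "g holomorphic_on ball 0 1" and B: "\<And>z. z \<in> ball 0 1 \<Longrightarrow> norm (g z) \<le> B"
    and lim: "AE t in lborel. ((\<lambda>r. g (of_real r * cis (2 * pi * t))) \<longlongrightarrow> h t) (at_left (1::real))"
    and hm[measurable]: "h \<in> borel_measurable borel" and a: "a \<in> ball 0 1"
  shows "norm (g a) * (1 - norm a) \<le> (\<integral>t. indicator {0..1} t * norm (h t) \<partial>lborel)"
proof -
  define r where "r n = 1 - 1 / (real n + 2)" for n
  have r: "0 < r n" "r n < 1" for n by (auto simp: r_def field_simps)
  have r_lim: "r \<longlonglongrightarrow> 1" unfolding r_def by real_asymp
  have r_left: "filterlim r (at_left 1) sequentially"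
    unfolding filterlim_at using r r_lim by (auto intro!: always_eventually) (metis less_irrefl)
  have contg: "continuous_on (ball 0 1) g" using hol by (rule holomorphic_on_imp_continuous_on)
  define s where "s n t = indicator {0..1} t * norm (g (of_real (r n) * cis (2 * pi * t)))" for n t
  have c1: "continuous_on UNIV (\<lambda>t. norm (g (of_real (r n) * cis (2 * pi * t))))" for n
    using r[of n] by (intro continuous_intros continuous_on_compose2[OF contg]) (auto simp: norm_mult)
  have sm[measurable]: "s n \<in> borel_measurable borel" for n
    unfolding s_def using borel_measurable_continuous_onI[OF c1] by measurable
  have int: "norm (g a) * (r n - norm a) \<le> (\<integral>t. s n t \<partial>lborel)" if n: "norm a < r n" for n
  proof -
    have "((\<lambda>u. g u / (u - a)) has_contour_integral (2 * of_real pi * \<i> * g a)) (circlepath 0 (r n))"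
      using r[of n] n by (intro Cauchy_integral_circlepath continuous_on_subset[OF contg] holomorphic_on_subset[OF hol]) auto
    then have I1: "((\<lambda>x. g (of_real (r n) * cis (2 * pi * x)) / (of_real (r n) * cis (2 * pi * x) - a)
       * (2 * of_real pi * \<i> * of_real (r n) * cis (2 * pi * x))) has_integral 2 * of_real pi * \<i> * g a) {0..1}"
      by (simp only: has_contour_integral_circlepath_0_iff)
    have I2: "(\<lambda>x. 2 * pi / (r n - norm a) * norm (g (of_real (r n) * cis (2 * pi * x)))) integrable_on {0..1}"
      by (intro integrable_continuous_interval continuous_intros continuous_on_subset[OF c1]) auto
    have "norm (2 * of_real pi * \<i> * g a) \<le> integral {0..1} (\<lambda>x. 2 * pi / (r n - norm a) * norm (g (of_real (r n) * cis (2 * pi * x))))"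
      unfolding integral_unique[OF I1, symmetric]
    proof (rule integral_norm_bound_integral[OF has_integral_integrable[OF I1] I2])
      fix x :: real
      let ?u = "of_real (r n) * cis (2 * pi * x)"
      have nu: "norm ?u = r n" using r[of n] by (simp add: norm_mult)
      have "r n - norm a \<le> norm (?u - a)" using norm_triangle_ineq2[of ?u a] nu by simp
      then have "norm (g ?u) * (2 * pi * r n) / norm (?u - a) \<le> norm (g ?u) * (2 * pi * r n) / (r n - norm a)"
        using n r[of n] \<open>r n - norm a \<le> norm (?u - a)\<close> by (intro divide_left_mono mult_pos_pos) auto
      also have "\<dots> \<le> norm (g ?u) * (2 * pi * 1) / (r n - norm a)"
        using n r[of n] by (intro divide_right_mono mult_left_mono) auto
      finally show "norm (g ?u / (?u - a) * (2 * of_real pi * \<i> * of_real (r n) * cis (2 * pi * x)))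
          \<le> 2 * pi / (r n - norm a) * norm (g ?u)"
        using r[of n] by (simp add: norm_mult norm_divide mult_ac)
    qed
    also have "\<dots> = 2 * pi / (r n - norm a) * integral {0..1} (\<lambda>x. norm (g (of_real (r n) * cis (2 * pi * x))))"
      by simp
    also have "integral {0..1} (\<lambda>x. norm (g (of_real (r n) * cis (2 * pi * x)))) = (\<integral>t. s n t \<partial>lborel)"
    proof -
      have "set_integrable lborel {0..1} (\<lambda>x. norm (g (of_real (r n) * cis (2 * pi * x))))"
        by (rule borel_integrable_atLeastAtMost') (rule continuous_on_subset[OF c1], simp)
      from set_borel_integral_eq_integral(2)[OF this] show ?thesis
        by (simp add: set_lebesgue_integral_def s_def[abs_def])
    qed
    finally have "2 * pi * norm (g a) \<le> 2 * pi * ((\<integral>t. s n t \<partial>lborel) / (r n - norm a))"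
      by (simp add: norm_mult)
    then have "norm (g a) \<le> (\<integral>t. s n t \<partial>lborel) / (r n - norm a)"
      by (simp only: mult_le_cancel_left_pos pi_gt_zero mult_pos_pos zero_less_numeral)
    then show ?thesis using n by (simp add: field_simps)
  qed
  have "(\<lambda>n. \<integral>t. s n t \<partial>lborel) \<longlonglongrightarrow> (\<integral>t. indicator {0..1} t * norm (h t) \<partial>lborel)"
  proof (rule integral_dominated_convergence[where w = "\<lambda>t. indicator {0..1} t * B"])
    show "integrable lborel (\<lambda>t. indicator {0..1::real} t * B)"
      by (intro integrable_mult_left integrable_real_indicator) auto
    show "AE t in lborel. (\<lambda>n. s n t) \<longlonglongrightarrow> indicator {0..1} t * norm (h t)"
      using lim
    proof eventually_elim
      case (elim t)
      have "(\<lambda>n. g (of_real (r n) * cis (2 * pi * t))) \<longlonglongrightarrow> h t"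
        by (rule filterlim_compose[OF elim r_left])
      then show ?case unfolding s_def by (intro tendsto_intros)
    qed
    have "norm (s n t) \<le> indicator {0..1} t * B" for n t
      using B[of "of_real (r n) * cis (2 * pi * t)"] r[of n]
      by (auto simp: s_def norm_mult indicator_def)
    then show "AE t in lborel. norm (s n t) \<le> indicator {0..1} t * B" for n by simp
  qed (simp_all add: sm)
  moreover have "(\<lambda>n. norm (g a) * (r n - norm a)) \<longlonglongrightarrow> norm (g a) * (1 - norm a)"
    by (intro tendsto_intros r_lim)
  moreover have "eventually (\<lambda>n. norm a < r n) sequentially"
    using order_tendstoD(1)[OF r_lim, of "norm a"] a by simp
  then have "eventually (\<lambda>n. norm (g a) * (r n - norm a) \<le> (\<integral>t. s n t \<partial>lborel)) sequentially"
    by eventually_elim (rule int)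
  ultimately show ?thesis by (intro tendsto_le[of sequentially]) auto
qed

lemma radial_limit_norm_bound:
  fixes g :: "complex \<Rightarrow> complex" and h :: "real \<Rightarrow> complex"
  assumes hol: "g holomorphic_on ball 0 1" and B: "\<And>z. z \<in> ball 0 1 \<Longrightarrow> norm (g z) \<le> B"
    and lim: "AE t in lborel. ((\<lambda>r. g (of_real r * cis (2 * pi * t))) \<longlongrightarrow> h t) (at_left (1::real))"
    and hm[measurable]: "h \<in> borel_measurable borel" and a: "a \<in> ball 0 1"
    and c: "AE t in lborel. norm (h t) \<le> c"
  shows "norm (g a) \<le> c"
proof (rule ccontr)
  assume "\<not> norm (g a) \<le> c"
  then have ga: "c < norm (g a)" by simp
  have c0: "c \<ge> 0"
  proof (rule ccontr)
    assume "\<not> c \<ge> 0"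
    then have neg: "\<not> norm z \<le> c" for z :: complex using norm_ge_zero[of z] by linarith
    have "AE t in (lborel :: real measure). False"
      using c by eventually_elim (use neg in blast)
    then show False by (subst (asm) AE_iff_measurable[OF _ refl]) auto
  qed
  \<comment> \<open>The constant \<open>1 / (1 - norm a)\<close> of the Cauchy estimate disappears on passing to powers.\<close>
  have pow: "norm (g a) ^ N * (1 - norm a) \<le> c ^ N" for N
  proof -
    have "norm ((g a) ^ N) * (1 - norm a) \<le> (\<integral>t. indicator {0..1} t * norm ((h t) ^ N) \<partial>lborel)"
    proof (rule radial_limit_estimate[OF _ _ _ _ a, of "\<lambda>z. g z ^ N" "B ^ N"])
      show "AE t in lborel. ((\<lambda>r. g (of_real r * cis (2 * pi * t)) ^ N) \<longlongrightarrow> h t ^ N) (at_left (1::real))"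
        using lim by eventually_elim (rule tendsto_power)
    qed (auto intro!: holomorphic_intros hol power_mono B simp: norm_power)
    also have "\<dots> \<le> (\<integral>t. indicator {0..1::real} t * c ^ N \<partial>lborel)"
    proof (rule integral_mono_AE')
      show "integrable lborel (\<lambda>t. indicator {0..1::real} t * c ^ N)"
        by (intro integrable_mult_left integrable_real_indicator) auto
      show "AE t in lborel. indicator {0..1} t * norm (h t ^ N) \<le> indicator {0..1::real} t * c ^ N"
        using c by eventually_elim (auto simp: norm_power intro!: mult_left_mono power_mono)
      show "AE t in lborel. 0 \<le> indicator {0..1::real} t * c ^ N" using c0 by simp
    qed
    also have "\<dots> = c ^ N" by simp
    finally show ?thesis by (simp add: norm_power)
  qed
  define q where "q = c / norm (g a)"
  have gp: "norm (g a) > 0" using c0 ga by linarith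
  have q: "0 \<le> q" "q < 1" using c0 ga gp by (simp_all only: q_def divide_less_eq_1_pos) simp
  have "1 - norm a \<le> q ^ N" for N
    using pow[of N] gp by (simp add: q_def power_divide pos_le_divide_eq mult.commute del: zero_less_norm_iff)
  moreover have "(\<lambda>N. q ^ N) \<longlonglongrightarrow> 0" using q by (intro LIMSEQ_realpow_zero)
  ultimately have "1 - norm a \<le> 0" by (intro tendsto_lowerbound[of "\<lambda>N. q ^ N" 0 sequentially]) auto
  then show False using a by simp
qed

section \<open>The Shilov boundary of an algebra of continuous functions\<close>

lemma compactin_attains_sup:
  fixes u :: "'a \<Rightarrow> real"
  assumes "compactin X K" "continuous_map X euclideanreal u" "K \<noteq> {}"
  shows "\<exists>y\<in>K. \<forall>x\<in>K. u x \<le> u y"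
proof -
  have "compact (u ` K)" using image_compactin[OF assms(1,2)] by simp
  with assms(3) obtain s where "s \<in> u ` K" "\<forall>t \<in> u ` K. t \<le> s"
    using compact_attains_sup[of "u ` K"] by auto
  then show ?thesis by auto
qed

lemma continuous_map_complex_mult:
  fixes f g :: "'a \<Rightarrow> complex"
  assumes f: "continuous_map X euclidean f" and g: "continuous_map X euclidean g"
  shows "continuous_map X euclidean (\<lambda>x. f x * g x)"
proof -
  have "continuous_map X (prod_topology euclidean euclidean) (\<lambda>x. (f x, g x))"
    using f g by (intro continuous_map_pairedI)
  then have 1: "continuous_map X euclidean (\<lambda>x. (f x, g x))" by simp
  have 2: "continuous_map euclidean euclidean (\<lambda>p :: complex \<times> complex. fst p * snd p)"
    by (auto intro!: continuous_intros)
  from continuous_map_compose[OF 1 2] show ?thesis by (simp add: o_def)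
qed

text \<open>Maxima are attained on \<open>E\<close> instead of being approached. For non-empty
  closed subsets of a compact space this is the same, and no convention about the supremum of the
  empty set enters.\<close>

definition norm_boundary :: "'a topology \<Rightarrow> ('a \<Rightarrow> complex) set \<Rightarrow> 'a set \<Rightarrow> bool" where
  "norm_boundary X A E \<longleftrightarrow>
     closedin X E \<and> (\<forall>f\<in>A. \<exists>y\<in>E. \<forall>x\<in>topspace X. norm (f x) \<le> norm (f y))"

text \<open>In an algebra with constants a condition \<open>|g - c| < e\<close> has this form with
  \<open>f = (g - c) / e\<close>, so centre and radius are absorbed into the functions.\<close>

definition small_nbhd :: "'a topology \<Rightarrow> ('a \<Rightarrow> complex) set \<Rightarrow> 'a set" where
  "small_nbhd X F = {x \<in> topspace X. \<forall>f\<in>F. norm (f x) < 1}"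

lemma openin_small_nbhd:
  assumes "finite F" "\<And>f. f \<in> F \<Longrightarrow> continuous_map X euclidean f"
  shows "openin X (small_nbhd X F)"
  using assms
proof (induction F rule: finite_induct)
  case (insert f F)
  have "openin X {x \<in> topspace X. f x \<in> ball 0 1}"
    using insert.prems by (intro openin_continuous_map_preimage[where Y = euclidean]) auto
  then have "openin X ({x \<in> topspace X. f x \<in> ball 0 1} \<inter> small_nbhd X F)"
    using insert by (intro openin_Int) auto
  also have "{x \<in> topspace X. f x \<in> ball 0 1} \<inter> small_nbhd X F = small_nbhd X (insert f F)"
    by (auto simp: small_nbhd_def)
  finally show ?case .
qed (simp add: small_nbhd_def)

locale function_algebra =
  fixes X :: "'a topology" and A :: "('a \<Rightarrow> complex) set"
  assumes compact_space: "compact_space X"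
    and continuous: "\<And>f. f \<in> A \<Longrightarrow> continuous_map X euclidean f"
    and one: "\<exists>h\<in>A. \<forall>x\<in>topspace X. h x = 1"
    and mult: "\<And>f g. f \<in> A \<Longrightarrow> g \<in> A \<Longrightarrow> \<exists>h\<in>A. \<forall>x\<in>topspace X. h x = f x * g x"
    and nbhd: "\<And>U x. openin X U \<Longrightarrow> x \<in> U \<Longrightarrow>
      \<exists>F. finite F \<and> F \<subseteq> A \<and> x \<in> small_nbhd X F \<and> small_nbhd X F \<subseteq> U"
begin

lemma power_mult: "f \<in> A \<Longrightarrow> g \<in> A \<Longrightarrow> \<exists>h\<in>A. \<forall>x\<in>topspace X. h x = g x ^ N * f x"
proof (induction N)
  case (Suc N)
  then obtain h where h: "h \<in> A" "\<forall>x\<in>topspace X. h x = g x ^ N * f x" by blast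
  obtain k where k: "k \<in> A" "\<forall>x\<in>topspace X. k x = g x * h x" using mult[OF Suc.prems(2) h(1)] by blast
  show ?case by (rule bexI[OF _ k(1)]) (use h(2) k(2) in simp)
qed auto

lemma attains_sup:
  assumes "closedin X K" "K \<noteq> {}" "f \<in> A"
  shows "\<exists>y\<in>K. \<forall>x\<in>K. norm (f x) \<le> norm (f y)"
proof -
  show ?thesis
    by (rule compactin_attains_sup[OF closedin_compact_space[OF compact_space assms(1)]
      continuous_map_norm[OF continuous[OF assms(3)]] assms(2)])
qed

text \<open>A function \<open>g\<close> attaining its norm on \<open>E\<close> only inside the neighbourhood is multiplied by a generator
  \<open>f\<close> of the neighbourhood. On \<open>E\<close> the product with a high power of \<open>g\<close> is smaller than at a point of \<open>E0\<close>.\<close>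

lemma norm_boundary_Diff:
  assumes F: "finite F" "F \<subseteq> A" and E0: "norm_boundary X A E0" "E0 \<inter> small_nbhd X F = {}"
    and E: "norm_boundary X A E"
  shows "norm_boundary X A (E - small_nbhd X F)"
proof (rule ccontr)
  let ?V = "small_nbhd X F"
  assume neg: "\<not> norm_boundary X A (E - ?V)"
  have clE: "closedin X E" and EX: "E \<subseteq> topspace X"
    using E closedin_subset by (auto simp: norm_boundary_def)
  have "openin X ?V" using F continuous by (intro openin_small_nbhd) auto
  with clE have cl: "closedin X (E - ?V)" by (rule closedin_diff)
  \<comment> \<open>Failure on \<open>E - ?V\<close> yields a function whose maximum modulus
    \<open>m\<close> over the space is attained on \<open>E\<close> but not on
    \<open>E - ?V\<close>. If this difference is empty, the constant 1 serves.\<close>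
  obtain g m y0 where g: "g \<in> A" "m > 0" "y0 \<in> E" "norm (g y0) = m"
      "\<And>x. x \<in> topspace X \<Longrightarrow> norm (g x) \<le> m" "\<And>y. y \<in> E - ?V \<Longrightarrow> norm (g y) < m"
  proof (cases "E - ?V = {}")
    case True
    obtain h where h: "h \<in> A" "\<forall>x\<in>topspace X. h x = 1" using one by blast
    obtain y where "y \<in> E" using E h(1) by (auto simp: norm_boundary_def)
    then show ?thesis using that[of h 1 y] h EX True by auto
  next
    case False
    from neg cl obtain g where g: "g \<in> A" "\<And>y. y \<in> E - ?V \<Longrightarrow> \<exists>x\<in>topspace X. norm (g y) < norm (g x)"
      unfolding norm_boundary_def by (metis not_le)
    obtain y where y: "y \<in> E" "\<forall>x\<in>topspace X. norm (g x) \<le> norm (g y)"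
      using E g(1) by (auto simp: norm_boundary_def)
    have lt: "norm (g z) < norm (g y)" if "z \<in> E - ?V" for z
      using g(2)[OF that] y(2) by fastforce
    moreover have "norm (g y) > 0" using False lt norm_ge_zero by (metis all_not_in_conv le_less_trans)
    ultimately show ?thesis using that[of g "norm (g y)" y] g(1) y by auto
  qed
  obtain c where c: "0 \<le> c" "c < m" "\<And>y. y \<in> E - ?V \<Longrightarrow> norm (g y) \<le> c"
  proof (cases "E - ?V = {}")
    case True
    show ?thesis by (rule that[of 0]) (use g True in auto)
  next
    case False
    obtain z where "z \<in> E - ?V" "\<And>y. y \<in> E - ?V \<Longrightarrow> norm (g y) \<le> norm (g z)"
      using attains_sup[OF cl False g(1)] by blast
    then show ?thesis using that[of "norm (g z)"] g(6) by auto
  qed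
  \<comment> \<open>The gap between \<open>c\<close> and \<open>m\<close> lets one exponent
    \<open>N\<close> outweigh, on \<open>E - ?V\<close>, the bounds of all the finitely many
    generators. It has to serve them all, as the generator \<open>f\<close> is picked only
    afterwards.\<close>
  define q where "q = c / m"
  have q: "0 \<le> q" "q < 1" using c g(2) by (auto simp: q_def)
  have "\<forall>f\<in>F. \<exists>C. \<forall>x\<in>E. norm (f x) \<le> C"
  proof
    fix f assume "f \<in> F"
    then have fA: "f \<in> A" using F by auto
    have "E \<noteq> {}" using g(3) by auto
    from attains_sup[OF clE this fA] show "\<exists>C. \<forall>x\<in>E. norm (f x) \<le> C" by blast
  qed
  then have "\<exists>C. \<forall>f\<in>F. \<forall>x\<in>E. norm (f x) \<le> C f" by (rule bchoice)
  then obtain C where "\<forall>f\<in>F. \<forall>x\<in>E. norm (f x) \<le> C f" ..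
  then have C: "\<And>f x. f \<in> F \<Longrightarrow> x \<in> E \<Longrightarrow> norm (f x) \<le> C f" by blast
  have "\<forall>f\<in>F. eventually (\<lambda>N. q ^ N * C f < 1) sequentially"
  proof
    fix f
    have "(\<lambda>N. q ^ N * C f) \<longlonglongrightarrow> 0 * C f" using q by (intro tendsto_intros LIMSEQ_realpow_zero)
    then show "eventually (\<lambda>N. q ^ N * C f < 1) sequentially" by (rule order_tendstoD(2)) simp
  qed
  then have "eventually (\<lambda>N. \<forall>f\<in>F. q ^ N * C f < 1) sequentially"
    using F(1) by (simp add: eventually_ball_finite)
  then obtain N where N: "\<And>f. f \<in> F \<Longrightarrow> q ^ N * C f < 1"
    using eventually_happens sequentially_bot by blast
  obtain y1 where y1: "y1 \<in> E0" "\<And>x. x \<in> topspace X \<Longrightarrow> norm (g x) \<le> norm (g y1)"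
    using E0(1) g(1) by (auto simp: norm_boundary_def)
  have y1X: "y1 \<in> topspace X" using y1(1) E0(1) closedin_subset by (auto simp: norm_boundary_def)
  have gy1: "m \<le> norm (g y1)" using y1(2)[of y0] g(3,4) EX by auto
  have "y1 \<notin> ?V" using y1(1) E0(2) by blast
  then obtain f where f: "f \<in> F" "norm (f y1) \<ge> 1" using y1X by (auto simp: small_nbhd_def not_less)
  obtain h where h: "h \<in> A" "\<And>x. x \<in> topspace X \<Longrightarrow> h x = g x ^ N * f x"
    using power_mult[of f g N] f F g(1) by blast
  obtain y2 where y2: "y2 \<in> E" "\<And>x. x \<in> topspace X \<Longrightarrow> norm (h x) \<le> norm (h y2)"
    using E h(1) by (auto simp: norm_boundary_def)
  have y2X: "y2 \<in> topspace X" using y2 EX by auto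
  have "m ^ N * 1 \<le> norm (g y1) ^ N * norm (f y1)"
    using gy1 g(2) f(2) by (intro mult_mono power_mono) auto
  then have "m ^ N \<le> norm (h y2)"
    using y2(2)[OF y1X] h(2)[OF y1X] by (simp add: norm_mult norm_power)
  moreover have "norm (h y2) < m ^ N"
  proof (cases "y2 \<in> ?V")
    case True
    then have "norm (f y2) < 1" using f(1) by (auto simp: small_nbhd_def)
    have "norm (g y2) ^ N \<le> m ^ N" using g(5)[OF y2X] by (intro power_mono) auto
    then have "norm (g y2) ^ N * norm (f y2) \<le> m ^ N * norm (f y2)" by (intro mult_right_mono) auto
    also have "\<dots> < m ^ N * 1" using \<open>norm (f y2) < 1\<close> g(2) by (intro mult_strict_left_mono) auto
    finally have "norm (g y2) ^ N * norm (f y2) < m ^ N * 1" .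
    then show ?thesis by (simp add: h(2)[OF y2X] norm_mult norm_power)
  next
    case False
    have "norm (g y2) ^ N * norm (f y2) \<le> c ^ N * C f"
      using c(3)[of y2] False y2(1) C[OF f(1) y2(1)] c(1) by (intro mult_mono power_mono) auto
    also have "\<dots> = m ^ N * (q ^ N * C f)" using g(2) by (simp add: q_def power_divide)
    also have "\<dots> < m ^ N * 1" using N[OF f(1)] g(2) by (intro mult_strict_left_mono) auto
    finally show ?thesis by (simp add: h(2)[OF y2X] norm_mult norm_power)
  qed
  ultimately show False by simp
qed

text \<open>Suppose that \<open>f\<close> does not attain its maximum on the intersection. The
  compact set \<open>L\<close> of its maximum points is then covered by finitely many small
  neighbourhoods, each disjoint from some boundary. By \<open>norm_boundary_Diff\<close> they can be
  cut out of \<open>E1\<close> one after the other, and a boundary without points of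
  \<open>L\<close> remains, which is absurd.\<close>

theorem norm_boundary_Inter:
  assumes ex: "norm_boundary X A E1"
  shows "norm_boundary X A (\<Inter>{E. norm_boundary X A E})"
proof -
  let ?S = "\<Inter>{E. norm_boundary X A E}"
  have cl: "closedin X ?S"
    using ex by (intro closedin_Inter) (auto simp: norm_boundary_def)
  have "\<exists>y\<in>?S. \<forall>x\<in>topspace X. norm (f x) \<le> norm (f y)" if f: "f \<in> A" for f
  proof (rule ccontr)
    assume neg: "\<not> ?thesis"
    obtain y0 where y0: "y0 \<in> E1" "\<And>x. x \<in> topspace X \<Longrightarrow> norm (f x) \<le> norm (f y0)"
      using ex f by (auto simp: norm_boundary_def)
    define L where "L = {x \<in> topspace X. norm (f x) \<in> {norm (f y0)..}}"
    have "closedin X L" unfolding L_def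
      by (rule closedin_continuous_map_preimage[OF continuous_map_norm[OF continuous[OF f]]]) auto
    then have Lc: "compactin X L" by (rule closedin_compact_space[OF compact_space])
    have "\<exists>F. finite F \<and> F \<subseteq> A \<and> x \<in> small_nbhd X F \<and> (\<exists>E. norm_boundary X A E \<and> E \<inter> small_nbhd X F = {})"
      if x: "x \<in> L" for x
    proof -
      have "x \<notin> ?S"
      proof
        assume "x \<in> ?S"
        with neg obtain z where "z \<in> topspace X" "\<not> norm (f z) \<le> norm (f x)" by blast
        with x y0(2)[of z] show False by (auto simp: L_def)
      qed
      then obtain E where E: "norm_boundary X A E" "x \<notin> E" by blast
      have "openin X (topspace X - E)" using E by (auto simp: norm_boundary_def)
      moreover have "x \<in> topspace X - E" using x E(2) by (auto simp: L_def)
      ultimately obtain F where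
        "finite F" "F \<subseteq> A" "x \<in> small_nbhd X F" "small_nbhd X F \<subseteq> topspace X - E"
        using nbhd by metis
      then show ?thesis using E(1) by blast
    qed
    then obtain F where F: "\<And>x. x \<in> L \<Longrightarrow> finite (F x) \<and> F x \<subseteq> A \<and> x \<in> small_nbhd X (F x)
        \<and> (\<exists>E. norm_boundary X A E \<and> E \<inter> small_nbhd X (F x) = {})" by metis
    have "\<exists>\<F>. finite \<F> \<and> \<F> \<subseteq> (\<lambda>x. small_nbhd X (F x)) ` L \<and> L \<subseteq> \<Union>\<F>"
      using F by (intro compactinD[OF Lc]) (auto intro!: openin_small_nbhd continuous)
    then obtain T where T: "finite T" "T \<subseteq> L" "L \<subseteq> (\<Union>x\<in>T. small_nbhd X (F x))"
      by (metis finite_subset_image)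
    have "norm_boundary X A (E1 - (\<Union>x\<in>T. small_nbhd X (F x)))"
      using T(1,2)
    proof (induction T rule: finite_induct)
      case (insert x T)
      have "norm_boundary X A ((E1 - (\<Union>x\<in>T. small_nbhd X (F x))) - small_nbhd X (F x))"
        using F[of x] insert.IH insert.prems norm_boundary_Diff[of "F x"] by (metis insert_subset)
      moreover have "E1 - (\<Union>x\<in>T. small_nbhd X (F x)) - small_nbhd X (F x) = E1 - (\<Union>x\<in>insert x T. small_nbhd X (F x))"
        by auto
      ultimately show ?case by simp
    qed (use ex in simp)
    then obtain y where y: "y \<in> E1 - (\<Union>x\<in>T. small_nbhd X (F x))"
        "\<And>x. x \<in> topspace X \<Longrightarrow> norm (f x) \<le> norm (f y)"
      using f by (auto simp: norm_boundary_def)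
    have "E1 \<subseteq> topspace X" using ex closedin_subset by (auto simp: norm_boundary_def)
    then have "y \<in> L" using y y0 by (auto simp: L_def)
    then show False using y(1) T(3) by blast
  qed
  with cl show ?thesis by (auto simp: norm_boundary_def)
qed

end

section \<open>Maximal ideal spaces\<close>

lemma topspace_maximal_ideal_space: "topspace (maximal_ideal_space A) = characters A"
  by (auto simp: maximal_ideal_space_def characters_def PiE_UNIV_domain extensional_def PiE_def)

lemma Hausdorff_maximal_ideal_space: "Hausdorff_space (maximal_ideal_space A)"
  unfolding maximal_ideal_space_def
  by (intro Hausdorff_space_subtopology) (simp add: Hausdorff_space_product_topology)

lemma continuous_map_evaluation:
  "x \<in> carrier A \<Longrightarrow> continuous_map (maximal_ideal_space A) euclidean (\<lambda>\<phi>. \<phi> x)"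
  unfolding maximal_ideal_space_def
  by (intro continuous_map_from_subtopology continuous_map_product_projection)

text \<open>The assumption \<open>bounded\<close> takes the place of a norm: it confines the
  characters to a product of closed discs, compact by Tychonoff's theorem.\<close>

locale bounded_characters =
  fixes A :: "(complex, 'v, 'e) module_scheme"
  assumes one_closed: "\<one>\<^bsub>A\<^esub> \<in> carrier A"
    and add_closed: "\<And>x y. x \<in> carrier A \<Longrightarrow> y \<in> carrier A \<Longrightarrow> x \<oplus>\<^bsub>A\<^esub> y \<in> carrier A"
    and mult_closed: "\<And>x y. x \<in> carrier A \<Longrightarrow> y \<in> carrier A \<Longrightarrow> x \<otimes>\<^bsub>A\<^esub> y \<in> carrier A"
    and smult_closed: "\<And>c x. x \<in> carrier A \<Longrightarrow> c \<odot>\<^bsub>A\<^esub> x \<in> carrier A"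
    and bounded: "\<And>x. x \<in> carrier A \<Longrightarrow> \<exists>B. \<forall>\<phi>\<in>characters A. norm (\<phi> x) \<le> B"
begin

lemma compact_maximal_ideal_space: "compact_space (maximal_ideal_space A)"
proof -
  let ?P = "product_topology (\<lambda>_. euclidean :: complex topology) (carrier A)"
  have top: "topspace ?P = extensional (carrier A)"
    by (auto simp: PiE_def)
  note proj = continuous_map_product_projection[of _ "carrier A" "\<lambda>_. euclidean :: complex topology"]
  have cl: "closedin ?P {\<phi> \<in> topspace ?P. f \<phi> = g \<phi>}"
    if "continuous_map ?P euclidean f" "continuous_map ?P euclidean g" for f g :: "_ \<Rightarrow> complex"
    by (rule closedin_continuous_maps_eq[OF _ that]) simp
  have eq: "characters A = {\<phi> \<in> topspace ?P. \<phi> \<one>\<^bsub>A\<^esub> = 1} \<inter>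
      \<Inter>(insert (topspace ?P) ((\<lambda>(x, y). {\<phi> \<in> topspace ?P. \<phi> (x \<oplus>\<^bsub>A\<^esub> y) = \<phi> x + \<phi> y}) ` (carrier A \<times> carrier A))) \<inter>
      \<Inter>(insert (topspace ?P) ((\<lambda>(x, y). {\<phi> \<in> topspace ?P. \<phi> (x \<otimes>\<^bsub>A\<^esub> y) = \<phi> x * \<phi> y}) ` (carrier A \<times> carrier A))) \<inter>
      \<Inter>(insert (topspace ?P) ((\<lambda>(c, x). {\<phi> \<in> topspace ?P. \<phi> (c \<odot>\<^bsub>A\<^esub> x) = c * \<phi> x}) ` (UNIV \<times> carrier A)))"
    unfolding top characters_def by auto
  have 1: "closedin ?P (characters A)"
    unfolding eq
    by (intro closedin_Int closedin_Inter)
      (auto intro!: cl proj continuous_map_add continuous_map_complex_mult one_closed add_closed mult_closed smult_closed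
        simp del: topspace_product_topology)
  obtain B where B: "\<And>x \<phi>. x \<in> carrier A \<Longrightarrow> \<phi> \<in> characters A \<Longrightarrow> norm (\<phi> x) \<le> B x"
    using bounded by metis
  have "compactin ?P (PiE (carrier A) (\<lambda>x. cball 0 (B x)))"
    by (subst compactin_PiE) auto
  moreover have "characters A \<subseteq> PiE (carrier A) (\<lambda>x. cball 0 (B x))"
    using B by (auto simp: PiE_def Pi_def characters_def)
  ultimately have "compactin ?P (characters A)" using 1 by (rule closed_compactin)
  then show ?thesis unfolding maximal_ideal_space_def by (rule compact_space_subtopology)
qed

text \<open>A basic weak-* condition \<open>|\<psi> x - \<phi> x| < e\<close> is
  \<open>|\<psi> a| < 1\<close> for the element \<open>a = (x - \<phi> x) / e\<close> of the
  algebra, by linearity of the character \<open>\<psi>\<close>.\<close>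

lemma small_nbhd_characters:
  assumes U: "openin (maximal_ideal_space A) U" and \<phi>: "\<phi> \<in> U"
  shows "\<exists>F. finite F \<and> F \<subseteq> (\<lambda>x \<psi>. \<psi> x) ` carrier A \<and> \<phi> \<in> small_nbhd (maximal_ideal_space A) F
    \<and> small_nbhd (maximal_ideal_space A) F \<subseteq> U"
proof -
  let ?P = "product_topology (\<lambda>_. euclidean :: complex topology) (carrier A)"
  obtain T where T: "openin ?P T" "U = T \<inter> characters A"
    using U by (auto simp: maximal_ideal_space_def openin_subtopology)
  have \<phi>c: "\<phi> \<in> characters A" and "\<phi> \<in> T" using T \<phi> by auto
  from bspec[OF T(1)[unfolded openin_product_topology_alt] \<open>\<phi> \<in> T\<close>] have
    "\<exists>W. finite {x \<in> carrier A. W x \<noteq> topspace euclidean} \<and> (\<forall>x\<in>carrier A. openin euclidean (W x)) \<and>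
      \<phi> \<in> PiE (carrier A) W \<and> PiE (carrier A) W \<subseteq> T" .
  then obtain W where W0: "finite {x \<in> carrier A. W x \<noteq> topspace euclidean} \<and> (\<forall>x\<in>carrier A. openin euclidean (W x)) \<and>
      \<phi> \<in> PiE (carrier A) W \<and> PiE (carrier A) W \<subseteq> T" ..
  then have W: "finite {x \<in> carrier A. W x \<noteq> UNIV}" "\<And>x. x \<in> carrier A \<Longrightarrow> open (W x)"
      "\<phi> \<in> PiE (carrier A) W" "PiE (carrier A) W \<subseteq> T"
    by simp_all
  let ?J = "{x \<in> carrier A. W x \<noteq> UNIV}"
  have "\<exists>e>0. ball (\<phi> x) e \<subseteq> W x" if "x \<in> ?J" for x
  proof -
    have "\<phi> x \<in> W x" using W(3) that by (auto simp: PiE_def)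
    then show ?thesis using W(2)[of x] that by (auto elim: openE)
  qed
  then obtain e where e: "\<And>x. x \<in> ?J \<Longrightarrow> e x > 0 \<and> ball (\<phi> x) (e x) \<subseteq> W x" by metis
  define a where "a x = of_real (1 / e x) \<odot>\<^bsub>A\<^esub> (x \<oplus>\<^bsub>A\<^esub> (- \<phi> x) \<odot>\<^bsub>A\<^esub> \<one>\<^bsub>A\<^esub>)" for x
  have a: "a x \<in> carrier A" if "x \<in> carrier A" for x
    unfolding a_def by (intro smult_closed add_closed one_closed that)
  have av: "\<psi> (a x) = of_real (1 / e x) * (\<psi> x - \<phi> x)" if "x \<in> carrier A" "\<psi> \<in> characters A" for x \<psi>
    using that one_closed add_closed smult_closed by (simp add: a_def characters_def)
  let ?F = "(\<lambda>x \<psi>. \<psi> x) ` a ` ?J"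
  show ?thesis
  proof (intro exI[of _ ?F] conjI)
    show "\<phi> \<in> small_nbhd (maximal_ideal_space A) ?F"
      using \<phi>c by (auto simp: small_nbhd_def topspace_maximal_ideal_space av)
    show "small_nbhd (maximal_ideal_space A) ?F \<subseteq> U"
    proof
      fix \<psi> assume "\<psi> \<in> small_nbhd (maximal_ideal_space A) ?F"
      then have \<psi>: "\<psi> \<in> characters A" "\<And>x. x \<in> ?J \<Longrightarrow> norm (\<psi> (a x)) < 1"
        by (auto simp: small_nbhd_def topspace_maximal_ideal_space)
      have "\<psi> x \<in> W x" if x: "x \<in> carrier A" for x
      proof (cases "W x = UNIV")
        case False
        then have J: "x \<in> ?J" using x by simp
        have "norm (\<psi> x - \<phi> x) < e x"
          using \<psi>(2)[OF J] e[OF J] unfolding av[OF x \<psi>(1)] by (simp add: norm_mult norm_divide divide_less_eq)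
        then show ?thesis using e[OF J] by (auto simp: dist_norm norm_minus_commute subset_iff)
      qed auto
      then have "\<psi> \<in> PiE (carrier A) W" using \<psi>(1) by (auto simp: PiE_def characters_def)
      then show "\<psi> \<in> U" using W(4) T(2) \<psi>(1) by auto
    qed
  qed (use W(1) a in auto)
qed

lemma function_algebra_Gelfand:
  "function_algebra (maximal_ideal_space A) ((\<lambda>x \<psi>. \<psi> x) ` carrier A)"
proof
  show "\<exists>h\<in>(\<lambda>x \<psi>. \<psi> x) ` carrier A. \<forall>\<phi>\<in>topspace (maximal_ideal_space A). h \<phi> = 1"
    using one_closed by (auto simp: topspace_maximal_ideal_space characters_def)
  show "\<exists>h\<in>(\<lambda>x \<psi>. \<psi> x) ` carrier A. \<forall>\<phi>\<in>topspace (maximal_ideal_space A). h \<phi> = f \<phi> * g \<phi>"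
    if "f \<in> (\<lambda>x \<psi>. \<psi> x) ` carrier A" "g \<in> (\<lambda>x \<psi>. \<psi> x) ` carrier A" for f g
  proof -
    from that obtain x y where "x \<in> carrier A" "y \<in> carrier A" "f = (\<lambda>\<psi>. \<psi> x)" "g = (\<lambda>\<psi>. \<psi> y)" by auto
    then show ?thesis using mult_closed[of x y]
      by (intro bexI[of _ "\<lambda>\<psi>. \<psi> (x \<otimes>\<^bsub>A\<^esub> y)"]) (auto simp: topspace_maximal_ideal_space characters_def)
  qed
  show "continuous_map (maximal_ideal_space A) euclidean f" if "f \<in> (\<lambda>x \<psi>. \<psi> x) ` carrier A" for f
    using that continuous_map_evaluation by auto
qed (rule compact_maximal_ideal_space, rule small_nbhd_characters)

end

section \<open>Characters of \<open>L\<^sup>\<infinity>\<close>\<close>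

definition Linf_class :: "'a measure \<Rightarrow> ('a \<Rightarrow> complex) \<Rightarrow> ('a \<Rightarrow> complex) set" where
  "Linf_class M h = {g \<in> ess_bounded M. AE x in M. g x = h x}"

lemma ess_bounded_measurable: "h \<in> ess_bounded M \<Longrightarrow> h \<in> borel_measurable M"
  by (simp add: ess_bounded_def)

lemma ess_boundedI: "h \<in> borel_measurable M \<Longrightarrow> (AE x in M. norm (h x) \<le> C) \<Longrightarrow> h \<in> ess_bounded M"
  by (auto simp: ess_bounded_def)

lemma ess_bounded_const: "(\<lambda>_. c) \<in> ess_bounded M"
  by (rule ess_boundedI[of _ _ "norm c"]) auto

lemma ess_bounded_add:
  assumes "h \<in> ess_bounded M" "k \<in> ess_bounded M" shows "(\<lambda>x. h x + k x) \<in> ess_bounded M"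
proof -
  from assms obtain B C where "AE x in M. norm (h x) \<le> B" "AE x in M. norm (k x) \<le> C"
    by (auto simp: ess_bounded_def)
  then have "AE x in M. norm (h x + k x) \<le> B + C"
    by eventually_elim (rule norm_triangle_mono)
  then show ?thesis using assms by (intro ess_boundedI) (auto simp: ess_bounded_def)
qed

lemma ess_bounded_mult:
  assumes "h \<in> ess_bounded M" "k \<in> ess_bounded M" shows "(\<lambda>x. h x * k x) \<in> ess_bounded M"
proof -
  from assms obtain B C where "AE x in M. norm (h x) \<le> B" "AE x in M. norm (k x) \<le> C"
    by (auto simp: ess_bounded_def)
  then have "AE x in M. norm (h x * k x) \<le> B * C"
    by eventually_elim (auto simp: norm_mult intro!: mult_mono intro: order_trans[OF norm_ge_zero])
  then show ?thesis using assms by (intro ess_boundedI) (auto simp: ess_bounded_def)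
qed

lemma Linf_class_self: "h \<in> ess_bounded M \<Longrightarrow> h \<in> Linf_class M h"
  by (simp add: Linf_class_def)

lemma Linf_class_cong:
  "(AE x in M. h x = k x) \<Longrightarrow> Linf_class M h = Linf_class M k"
  by (auto simp: Linf_class_def elim: AE_mp)

lemma carrier_Linf: "carrier (Linf M) = Linf_class M ` ess_bounded M"
proof -
  have "AE_rel M `` {h} = Linf_class M h" if "h \<in> ess_bounded M" for h
    using that by (auto simp: AE_rel_def Linf_class_def elim: AE_mp)
  then show ?thesis by (auto simp: Linf_def quotient_def)
qed

lemma Linf_class_in_carrier: "h \<in> ess_bounded M \<Longrightarrow> Linf_class M h \<in> carrier (Linf M)"
  by (auto simp: carrier_Linf)

lemma Linf_one: "\<one>\<^bsub>Linf M\<^esub> = Linf_class M (\<lambda>_. 1)"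
  by (simp add: Linf_def Linf_class_def)

lemma Linf_add:
  assumes "h \<in> ess_bounded M" "k \<in> ess_bounded M"
  shows "Linf_class M h \<oplus>\<^bsub>Linf M\<^esub> Linf_class M k = Linf_class M (\<lambda>x. h x + k x)"
proof -
  have "AE x in M. f x = h x + k x"
    if g: "g1 \<in> Linf_class M h" "g2 \<in> Linf_class M k" "AE x in M. f x = g1 x + g2 x" for f g1 g2
  proof -
    from g(1,2) have "AE x in M. g1 x = h x" "AE x in M. g2 x = k x" by (simp_all add: Linf_class_def)
    with g(3) show ?thesis by eventually_elim simp
  qed
  moreover have "Linf_class M h \<oplus>\<^bsub>Linf M\<^esub> Linf_class M k =
      {f \<in> ess_bounded M. \<exists>g1\<in>Linf_class M h. \<exists>g2\<in>Linf_class M k. AE x in M. f x = g1 x + g2 x}"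
    by (simp add: Linf_def)
  ultimately show ?thesis
    using assms[THEN Linf_class_self] unfolding Linf_class_def[of M "\<lambda>x. h x + k x"] by blast
qed

lemma Linf_mult:
  assumes "h \<in> ess_bounded M" "k \<in> ess_bounded M"
  shows "Linf_class M h \<otimes>\<^bsub>Linf M\<^esub> Linf_class M k = Linf_class M (\<lambda>x. h x * k x)"
proof -
  have "AE x in M. f x = h x * k x"
    if g: "g1 \<in> Linf_class M h" "g2 \<in> Linf_class M k" "AE x in M. f x = g1 x * g2 x" for f g1 g2
  proof -
    from g(1,2) have "AE x in M. g1 x = h x" "AE x in M. g2 x = k x" by (simp_all add: Linf_class_def)
    with g(3) show ?thesis by eventually_elim simp
  qed
  moreover have "Linf_class M h \<otimes>\<^bsub>Linf M\<^esub> Linf_class M k =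
      {f \<in> ess_bounded M. \<exists>g1\<in>Linf_class M h. \<exists>g2\<in>Linf_class M k. AE x in M. f x = g1 x * g2 x}"
    by (simp add: Linf_def)
  ultimately show ?thesis
    using assms[THEN Linf_class_self] unfolding Linf_class_def[of M "\<lambda>x. h x * k x"] by blast
qed

lemma Linf_smult:
  assumes "h \<in> ess_bounded M"
  shows "c \<odot>\<^bsub>Linf M\<^esub> Linf_class M h = Linf_class M (\<lambda>x. c * h x)"
proof -
  have "AE x in M. f x = c * h x"
    if g: "g1 \<in> Linf_class M h" "AE x in M. f x = c * g1 x" for f g1
  proof -
    from g(1) have "AE x in M. g1 x = h x" by (simp add: Linf_class_def)
    with g(2) show ?thesis by eventually_elim simp
  qed
  moreover have "c \<odot>\<^bsub>Linf M\<^esub> Linf_class M h = {f \<in> ess_bounded M. \<exists>g1\<in>Linf_class M h. AE x in M. f x = c * g1 x}"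
    by (simp add: Linf_def)
  ultimately show ?thesis
    using Linf_class_self[OF assms] unfolding Linf_class_def[of M "\<lambda>x. c * h x"] by blast
qed

lemma Linf_character_simps:
  assumes "\<phi> \<in> characters (Linf M)"
  shows "\<phi> (Linf_class M (\<lambda>_. 1)) = 1"
    and "h \<in> ess_bounded M \<Longrightarrow> k \<in> ess_bounded M \<Longrightarrow>
      \<phi> (Linf_class M (\<lambda>x. h x + k x)) = \<phi> (Linf_class M h) + \<phi> (Linf_class M k)"
    and "h \<in> ess_bounded M \<Longrightarrow> k \<in> ess_bounded M \<Longrightarrow>
      \<phi> (Linf_class M (\<lambda>x. h x * k x)) = \<phi> (Linf_class M h) * \<phi> (Linf_class M k)"
    and "h \<in> ess_bounded M \<Longrightarrow> \<phi> (Linf_class M (\<lambda>x. c * h x)) = c * \<phi> (Linf_class M h)"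
  using assms by (auto simp: characters_def carrier_Linf Linf_one Linf_smult Linf_mult[symmetric] Linf_add[symmetric]
      simp flip: Linf_smult)

text \<open>The character is a cluster point of evaluations at points of \<open>E\<close>, along the
  filter of almost everywhere statements on \<open>E\<close>. Evaluations of chosen representatives
  lie in a compact product of discs, so a cluster point exists. A closed condition that holds for
  the evaluations at almost all points of \<open>E\<close> is inherited by it; this gives the
  algebraic laws as well as the membership in \<open>S\<close>.\<close>

theorem Linf_character_exists:
  fixes M :: "'a measure"
  assumes E: "E \<in> sets M" "emeasure M E \<noteq> 0"
  obtains \<phi> where "\<phi> \<in> characters (Linf M)"
    "\<And>h S. h \<in> ess_bounded M \<Longrightarrow> closed S \<Longrightarrow> (AE x in M. x \<in> E \<longrightarrow> h x \<in> S) \<Longrightarrow> \<phi> (Linf_class M h) \<in> S"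
proof -
  define rep :: "('a \<Rightarrow> complex) set \<Rightarrow> 'a \<Rightarrow> complex" where "rep X = (SOME h. h \<in> X)" for X
  have rep: "rep (Linf_class M h) \<in> Linf_class M h" if "h \<in> ess_bounded M" for h
    unfolding rep_def by (rule someI[where P = "\<lambda>g. g \<in> Linf_class M h", OF Linf_class_self[OF that]])
  define B where "B X = (SOME C. AE x in M. norm (rep X x) \<le> C)" for X
  have B: "AE x in M. norm (rep (Linf_class M h) x) \<le> B (Linf_class M h)" if "h \<in> ess_bounded M" for h
  proof -
    have "rep (Linf_class M h) \<in> ess_bounded M" using rep[OF that] by (simp add: Linf_class_def)
    then have "\<exists>C. AE x in M. norm (rep (Linf_class M h) x) \<le> C" by (simp add: ess_bounded_def)
    then show ?thesis unfolding B_def by (rule someI_ex)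
  qed
  \<comment> \<open>Truncation at an essential bound puts every value into a disc that depends only
    on the class; on a null set the value becomes 0.\<close>
  define ev where "ev x X = (if norm (rep X x) \<le> B X then rep X x else 0)" for x X
  have ev: "AE x in M. ev x (Linf_class M h) = h x" if "h \<in> ess_bounded M" for h
  proof -
    have "AE x in M. rep (Linf_class M h) x = h x" using rep[OF that] by (simp add: Linf_class_def)
    with B[OF that] show ?thesis by eventually_elim (simp add: ev_def)
  qed
  \<comment> \<open>The maximum with 0 keeps the default value 0 in the disc even if
    \<open>B X\<close> is negative, which nothing excludes for sets \<open>X\<close> that are not
    classes.\<close>
  define K where "K = PiE UNIV (\<lambda>X. cball (0::complex) (max 0 (B X)))"
  have "compactin (product_topology (\<lambda>_. euclidean) UNIV) K"
    unfolding K_def by (subst compactin_PiE) auto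
  then have K: "compact K" by (simp add: euclidean_product_topology)
  define F where "F = filtermap ev (inf (ae_filter M) (principal E))"
  have F: "eventually P F \<longleftrightarrow> (AE x in M. x \<in> E \<longrightarrow> P (ev x))" for P
    by (simp add: F_def eventually_filtermap eventually_inf_principal)
  have evK: "ev x \<in> K" for x
    by (auto simp: K_def ev_def PiE_iff)
  have "F \<noteq> bot"
  proof
    assume "F = bot"
    then have "AE x in M. x \<notin> E" using F[of "\<lambda>_. False"] by simp
    then show False using E AE_iff_measurable[of E M "\<lambda>x. x \<notin> E"] sets.sets_into_space[OF E(1)] by auto
  qed
  moreover have "eventually (\<lambda>f. f \<in> K) F" using evK by (simp add: F)
  ultimately obtain p where p: "p \<in> K" "inf (nhds p) F \<noteq> bot" using K unfolding compact_filter by blast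
  have key: "p \<in> T" if T: "closed T" "eventually (\<lambda>f. f \<in> T) F" for T
  proof (rule ccontr)
    assume "p \<notin> T"
    then have "eventually (\<lambda>f. f \<in> - T) (nhds p)" using T(1) by (intro eventually_nhds_in_open) auto
    then have "eventually (\<lambda>f. f \<in> - T \<and> f \<in> T) (inf (nhds p) F)"
      using T(2) unfolding eventually_inf by blast
    then show False using p(2) by (simp add: trivial_limit_def)
  qed
  have co: "continuous_on UNIV (\<lambda>f :: ('a \<Rightarrow> complex) set \<Rightarrow> complex. f X)" for X
    by (rule continuous_on_product_coordinates)
  have pS: "p (Linf_class M h) \<in> S" if "h \<in> ess_bounded M" "closed S" "AE x in M. x \<in> E \<longrightarrow> h x \<in> S" for h S
  proof -
    have "closed ((\<lambda>f :: ('a \<Rightarrow> complex) set \<Rightarrow> complex. f (Linf_class M h)) -` S)"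
      by (rule closed_vimage[OF that(2) co])
    moreover have "AE x in M. x \<in> E \<longrightarrow> ev x \<in> (\<lambda>f. f (Linf_class M h)) -` S"
      using that(3) ev[OF that(1)] by eventually_elim auto
    then have "eventually (\<lambda>f. f \<in> (\<lambda>f. f (Linf_class M h)) -` S) F" by (simp only: F)
    ultimately show ?thesis using key by blast
  qed
  have padd: "p (Linf_class M (\<lambda>x. h x + k x)) = p (Linf_class M h) + p (Linf_class M k)"
    if "h \<in> ess_bounded M" "k \<in> ess_bounded M" for h k
  proof -
    have "closed {f :: ('a \<Rightarrow> complex) set \<Rightarrow> complex. f (Linf_class M (\<lambda>x. h x + k x)) = f (Linf_class M h) + f (Linf_class M k)}"
      by (intro closed_Collect_eq continuous_intros co)
    moreover have "AE x in M. x \<in> E \<longrightarrow> ev x (Linf_class M (\<lambda>x. h x + k x)) = ev x (Linf_class M h) + ev x (Linf_class M k)"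
      using ev[OF that(1)] ev[OF that(2)] ev[OF ess_bounded_add[OF that]] by eventually_elim auto
    ultimately show ?thesis using key[of "{f. f (Linf_class M (\<lambda>x. h x + k x)) = f (Linf_class M h) + f (Linf_class M k)}"]
      by (simp add: F)
  qed
  have pmult: "p (Linf_class M (\<lambda>x. h x * k x)) = p (Linf_class M h) * p (Linf_class M k)"
    if "h \<in> ess_bounded M" "k \<in> ess_bounded M" for h k
  proof -
    have "closed {f :: ('a \<Rightarrow> complex) set \<Rightarrow> complex. f (Linf_class M (\<lambda>x. h x * k x)) = f (Linf_class M h) * f (Linf_class M k)}"
      by (intro closed_Collect_eq continuous_intros co)
    moreover have "AE x in M. x \<in> E \<longrightarrow> ev x (Linf_class M (\<lambda>x. h x * k x)) = ev x (Linf_class M h) * ev x (Linf_class M k)"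
      using ev[OF that(1)] ev[OF that(2)] ev[OF ess_bounded_mult[OF that]] by eventually_elim auto
    ultimately show ?thesis using key[of "{f. f (Linf_class M (\<lambda>x. h x * k x)) = f (Linf_class M h) * f (Linf_class M k)}"]
      by (simp add: F)
  qed
  have pone: "p (Linf_class M (\<lambda>_. c)) = c" for c
    using pS[of "\<lambda>_. c" "{c}"] ess_bounded_const by auto
  define \<phi> where "\<phi> = restrict p (carrier (Linf M))"
  have \<phi>: "\<phi> (Linf_class M h) = p (Linf_class M h)" if "h \<in> ess_bounded M" for h
    using Linf_class_in_carrier[OF that] by (simp add: \<phi>_def)
  have "\<phi> \<in> characters (Linf M)"
    unfolding characters_def
    using padd pmult pone pmult[OF ess_bounded_const] ess_bounded_mult[OF ess_bounded_const]
    by (auto simp: carrier_Linf Linf_one Linf_add Linf_mult Linf_smult \<phi> ess_bounded_const ess_bounded_add ess_bounded_mult)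
      (simp add: \<phi>_def carrier_Linf)
  then show ?thesis using pS \<phi> by (intro that[of \<phi>]) auto
qed

text \<open>On \<open>A\<close> the function \<open>h - l\<close> is invertible:
  \<open>(h - l) * y\<close> is the indicator of \<open>A\<close> for a bounded \<open>y\<close>. A
  character with value 1 at this indicator cannot annihilate \<open>h - l\<close>.\<close>

lemma Linf_character_neq:
  assumes \<phi>: "\<phi> \<in> characters (Linf M)" and A: "A \<in> sets M" "\<phi> (Linf_class M (indicator A)) = 1"
    and h: "h \<in> ess_bounded M" and d: "\<delta> > 0" "AE x in M. x \<in> A \<longrightarrow> \<delta> \<le> norm (h x - l)"
  shows "\<phi> (Linf_class M h) \<noteq> l"
proof
  assume eq: "\<phi> (Linf_class M h) = l"
  note [measurable] = A(1) ess_bounded_measurable[OF h]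
  note simps = Linf_character_simps[OF \<phi>]
  define y where "y x = indicator A x / (h x - l)" for x
  have y: "y \<in> ess_bounded M"
  proof (rule ess_boundedI)
    show "y \<in> borel_measurable M" unfolding y_def by measurable
    show "AE x in M. norm (y x) \<le> 1 / \<delta>"
      using d(2) by eventually_elim (use d(1) in \<open>auto simp: y_def norm_divide indicator_def frac_le\<close>)
  qed
  have hl: "(\<lambda>x. h x + (- l) * 1) \<in> ess_bounded M"
    by (intro ess_bounded_add h) (rule ess_bounded_const)
  have "AE x in M. (h x + (- l) * 1) * y x = indicator A x"
    using d(2) by eventually_elim (use d(1) in \<open>auto simp: y_def indicator_def\<close>)
  then have "\<phi> (Linf_class M (\<lambda>x. (h x + (- l) * 1) * y x)) = 1"
    using A(2) Linf_class_cong by metis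
  moreover have "\<phi> (Linf_class M (\<lambda>x. h x + (- l) * 1)) = l + (- l) * 1"
    using simps(1) simps(2)[OF h, of "\<lambda>_. (- l) * 1"] simps(4)[of "\<lambda>_. 1" "- l"] ess_bounded_const eq by metis
  ultimately show False using simps(3)[OF hl y] by simp
qed

lemma Linf_character_le:
  assumes \<phi>: "\<phi> \<in> characters (Linf M)" and A: "A \<in> sets M" "\<phi> (Linf_class M (indicator A)) = 1"
    and h: "h \<in> ess_bounded M" and c: "AE x in M. x \<in> A \<longrightarrow> norm (h x) \<le> c"
  shows "norm (\<phi> (Linf_class M h)) \<le> c"
proof (rule ccontr)
  let ?l = "\<phi> (Linf_class M h)"
  assume "\<not> ?thesis"
  then have d: "norm ?l - c > 0" by simp
  have "AE x in M. x \<in> A \<longrightarrow> norm ?l - c \<le> norm (h x - ?l)"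
    using c by eventually_elim (use norm_triangle_ineq3 norm_minus_commute in \<open>smt (verit)\<close>)
  then show False using Linf_character_neq[OF \<phi> A h d] by blast
qed

lemma Linf_character_ge:
  assumes \<phi>: "\<phi> \<in> characters (Linf M)" and A: "A \<in> sets M" "\<phi> (Linf_class M (indicator A)) = 1"
    and h: "h \<in> ess_bounded M" and c: "AE x in M. x \<in> A \<longrightarrow> c \<le> norm (h x)"
  shows "c \<le> norm (\<phi> (Linf_class M h))"
proof (rule ccontr)
  let ?l = "\<phi> (Linf_class M h)"
  assume "\<not> ?thesis"
  then have d: "c - norm ?l > 0" by simp
  have "AE x in M. x \<in> A \<longrightarrow> c - norm ?l \<le> norm (h x - ?l)"
    using c by eventually_elim (use norm_triangle_ineq2 in \<open>smt (verit)\<close>)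
  then show False using Linf_character_neq[OF \<phi> A h d] by blast
qed

lemma bounded_characters_Linf: "bounded_characters (Linf M)"
proof
  show "\<exists>B. \<forall>\<phi>\<in>characters (Linf M). norm (\<phi> X) \<le> B" if "X \<in> carrier (Linf M)" for X
  proof -
    from that obtain h where h: "h \<in> ess_bounded M" "X = Linf_class M h" by (auto simp: carrier_Linf)
    then obtain C where C: "AE x in M. norm (h x) \<le> C" by (auto simp: ess_bounded_def)
    have "norm (\<phi> X) \<le> C" if \<phi>: "\<phi> \<in> characters (Linf M)" for \<phi>
      unfolding h(2)
    proof (rule Linf_character_le[OF \<phi> sets.top _ h(1)])
      have "Linf_class M (indicator (space M)) = Linf_class M (\<lambda>_. 1)"
        by (rule Linf_class_cong) (auto intro!: AE_I2)
      then show "\<phi> (Linf_class M (indicator (space M))) = 1"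
        using Linf_character_simps(1)[OF \<phi>] by simp
    qed (use C in auto)
    then show ?thesis by blast
  qed
qed (auto simp: carrier_Linf Linf_one Linf_add Linf_mult Linf_smult
    intro!: imageI ess_bounded_const ess_bounded_add ess_bounded_mult[OF ess_bounded_const] ess_bounded_mult)

section \<open>Almost everywhere statements on the torus\<close>

lemma AE_lborel_translate:
  fixes P :: "'a::euclidean_space \<Rightarrow> bool"
  assumes [measurable]: "Measurable.pred borel P"
  shows "(AE x in lborel. P (c + x)) \<longleftrightarrow> (AE x in lborel. P x)"
proof -
  have "(AE x in distr lborel borel ((+) c). P x) \<longleftrightarrow> (AE x in lborel. P (c + x))"
    by (rule AE_distr_iff) measurable
  then show ?thesis by (simp only: lborel_distr_plus)
qed

text \<open>Fubini's theorem without a change of coordinates: the base point runs through the whole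
  space, and for each fixed \<open>t\<close> the translation by \<open>t *\<^sub>R v\<close>
  preserves null sets.\<close>

lemma AE_lborel_iff_AE_lines:
  fixes P :: "'a::euclidean_space \<Rightarrow> bool" and v :: 'a
  assumes P[measurable]: "Measurable.pred borel P"
  shows "(AE x in lborel. P x) \<longleftrightarrow> (AE x in lborel. AE t in (lborel :: real measure). P (x + t *\<^sub>R v))"
proof -
  have ps: "pair_sigma_finite (lborel :: 'a measure) (lborel :: real measure)"
    by (intro pair_sigma_finite.intro sigma_finite_lborel)
  have "(AE x in lborel. AE t in (lborel :: real measure). P (x + t *\<^sub>R v)) \<longleftrightarrow>
      (AE t in (lborel :: real measure). AE x in lborel. P (x + t *\<^sub>R v))"
    by (rule pair_sigma_finite.AE_commute[OF ps]) measurable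
  also have "\<dots> \<longleftrightarrow> (AE t in (lborel :: real measure). AE x in lborel. P x)"
  proof -
    have "(AE x in lborel. P (x + t *\<^sub>R v)) \<longleftrightarrow> (AE x in lborel. P x)" for t
      using AE_lborel_translate[OF P, of "t *\<^sub>R v"] by (simp add: add.commute)
    then show ?thesis by simp
  qed
  also have "\<dots> \<longleftrightarrow> (AE x in lborel. P x)"
    by (cases "AE x in lborel. P x") (auto simp: AE_iff_measurable[OF _ refl])
  finally show ?thesis ..
qed

definition torus_point :: "real^'n \<Rightarrow> complex^'n" where
  "torus_point x = (\<chi> j. cis (2 * pi * x $ j))"

lemma torus_point_nth [simp]: "torus_point x $ j = cis (2 * pi * x $ j)"
  by (simp add: torus_point_def)

lemma torus_point_in_torus [simp]: "torus_point x \<in> torus"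
  by (simp add: torus_def)

lemma torus_point_line: "torus_point (x + s *\<^sub>R 1) = cis (2 * pi * s) *s torus_point x"
  by (simp add: vec_eq_iff cis_mult distrib_left add.commute)

lemma continuous_torus_point: "continuous_on S torus_point"
  unfolding torus_point_def by (intro continuous_intros)

lemma torus_point_surj: "z \<in> torus \<Longrightarrow> \<exists>x. z = torus_point x"
proof -
  assume z: "z \<in> torus"
  have "\<exists>s. z $ j = cis (2 * pi * s)" for j
  proof -
    have 1: "norm (z $ j) = 1" using z by (simp add: torus_def)
    then have "z $ j \<noteq> 0" by auto
    then have "z $ j = cis (Arg (z $ j))" using cis_Arg[of "z $ j"] 1 by (simp add: sgn_div_norm)
    then show ?thesis by (intro exI[of _ "Arg (z $ j) / (2 * pi)"]) simp
  qed
  then obtain s where "\<And>j. z $ j = cis (2 * pi * s j)" by metis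
  then show ?thesis by (intro exI[of _ "\<chi> j. s j"]) (simp add: vec_eq_iff)
qed

lemma measurable_torus_point:
  "torus_point \<in> measurable borel (restrict_space borel torus)"
  by (intro measurable_restrict_space2 borel_measurable_continuous_onI continuous_torus_point) auto

lemma emeasure_unit_cube: "emeasure lborel (cbox (0 :: real^'n) 1) = 1"
proof -
  have "(1 :: real^'n) \<bullet> b = 1" if "b \<in> Basis" for b
    using that by (auto simp: Basis_vec_def inner_axis)
  then show ?thesis by (subst emeasure_lborel_cbox) auto
qed

lemma haar_torus_eq:
  "haar_torus = distr (uniform_measure lborel (cbox (0 :: real^'n) 1)) (restrict_space borel torus) torus_point"
  unfolding haar_torus_def torus_point_def ..

text \<open>Countably many integer translates of the cube cover the space. Statements on the torus
  thereby become statements about Lebesgue measure on the full space, where translation invariance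
  along the diagonal is available.\<close>

lemma AE_unit_cube_periodic:
  fixes P :: "complex^'n \<Rightarrow> bool"
  assumes P[measurable]: "Measurable.pred borel (\<lambda>x. P (torus_point x))"
    and AE: "AE x in lborel. x \<in> cbox 0 1 \<longrightarrow> P (torus_point x)"
  shows "AE x in lborel. P (torus_point x)"
proof -
  define c :: "int^'n \<Rightarrow> real^'n" where "c k = (\<chi> i. of_int (k $ i))" for k
  have per: "torus_point (- c k + x) = torus_point x" for k x
  proof -
    have "cis (2 * pi * (- of_int a + b)) = cis (2 * pi * b)" for a :: int and b :: real
      using cis_mult[of "2 * pi * (- of_int a)" "2 * pi * b"] cis_multiple_2pi[of "- of_int a"]
      by (simp add: distrib_left right_diff_distrib)
    then show ?thesis by (simp add: vec_eq_iff c_def)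
  qed
  have m: "Measurable.pred borel (\<lambda>x. x \<in> cbox 0 1 \<longrightarrow> P (torus_point x))" by measurable
  have "AE x in lborel. - c k + x \<in> cbox 0 1 \<longrightarrow> P (torus_point x)" for k
    using AE_lborel_translate[OF m, of "- c k"] AE by (simp only: per)
  then have "AE x in lborel. \<forall>k. - c k + x \<in> cbox 0 1 \<longrightarrow> P (torus_point x)"
    by (subst AE_all_countable) blast
  then show ?thesis
  proof eventually_elim
    case (elim x)
    have "- c (\<chi> i. \<lfloor>x $ i\<rfloor>) + x \<in> cbox 0 1"
      unfolding mem_box_cart c_def by (auto simp: algebra_simps) linarith+
    then show ?case using elim by blast
  qed
qed

lemma AE_haar_torus:
  fixes P :: "complex^'n \<Rightarrow> bool"
  assumes P: "{z \<in> torus. P z} \<in> sets (restrict_space borel torus)"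
  shows "(AE z in haar_torus. P z) \<longleftrightarrow> (AE x in lborel. P (torus_point x))"
proof -
  have "torus_point -` {z \<in> torus. P z} \<inter> space borel \<in> sets borel"
    by (rule measurable_sets[OF measurable_torus_point P])
  then have m: "Measurable.pred borel (\<lambda>x. P (torus_point x))"
    by (simp add: pred_def vimage_def)
  have "(AE z in haar_torus. P z) \<longleftrightarrow> (AE x in uniform_measure lborel (cbox 0 1). P (torus_point x))"
    unfolding haar_torus_eq
  proof (rule AE_distr_iff)
    show "torus_point \<in> measurable (uniform_measure lborel (cbox 0 1)) (restrict_space borel torus)"
      using measurable_torus_point by (simp cong: measurable_cong_sets)
  qed (use P in \<open>simp add: space_restrict_space\<close>)
  also have "\<dots> \<longleftrightarrow> (AE x in lborel. x \<in> cbox 0 1 \<longrightarrow> P (torus_point x))"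
    by (rule AE_uniform_measure) (simp_all add: emeasure_unit_cube)
  also have "\<dots> \<longleftrightarrow> (AE x in lborel. P (torus_point x))"
  proof
    assume "AE x in lborel. P (torus_point x)"
    then show "AE x in lborel. x \<in> cbox 0 1 \<longrightarrow> P (torus_point x)" by eventually_elim simp
  qed (rule AE_unit_cube_periodic[OF m])
  finally show ?thesis .
qed

section \<open>The map \<open>\<theta>\<close>\<close>

lemma coord_no_bij: "bij_betw coord_no (UNIV :: 'n::{finite,linorder} set) {1..CARD('n)}"
proof -
  have inj: "inj (coord_no :: 'n \<Rightarrow> nat)"
  proof (rule linorder_injI)
    fix i j :: 'n assume "i < j"
    have "{k. k \<le> i} \<subset> {k. k \<le> j}"
    proof (rule psubsetI)
      show "{k. k \<le> i} \<subseteq> {k. k \<le> j}" using \<open>i < j\<close> by auto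
      have "j \<in> {k. k \<le> j} - {k. k \<le> i}" using \<open>i < j\<close> by auto
      then show "{k. k \<le> i} \<noteq> {k. k \<le> j}" by blast
    qed
    then have "coord_no i < coord_no j" unfolding coord_no_def by (intro psubset_card_mono) auto
    then show "coord_no i \<noteq> coord_no j" by simp
  qed
  moreover have sub: "range (coord_no :: 'n \<Rightarrow> nat) \<subseteq> {1..CARD('n)}"
    by (auto simp: coord_no_def Suc_le_eq card_gt_0_iff intro!: card_mono)
  moreover have "card (range (coord_no :: 'n \<Rightarrow> nat)) = CARD('n)"
    using inj by (rule card_image)
  then have "range (coord_no :: 'n \<Rightarrow> nat) = {1..CARD('n)}"
    using sub by (intro card_subset_eq) auto
  ultimately show ?thesis by (simp add: bij_betw_def)
qed

lemma coord_no_surj: "1 \<le> k \<Longrightarrow> k \<le> CARD('n) \<Longrightarrow> \<exists>j::'n::{finite,linorder}. coord_no j = k"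
proof -
  assume "1 \<le> k" "k \<le> CARD('n)"
  then have "k \<in> range (coord_no :: 'n \<Rightarrow> nat)"
    using coord_no_bij[where ?'n = 'n] by (simp add: bij_betw_def)
  then show ?thesis by auto
qed

lemma elem_sym_scale:
  "elem_sym k (\<chi> i. (c * w $ i) ^ m) = c ^ (k * m) * elem_sym k (\<chi> i. (w $ i) ^ m)"
proof -
  have "(\<Prod>i\<in>S. (c * w $ i) ^ m) = c ^ (k * m) * (\<Prod>i\<in>S. (w $ i) ^ m)" if "card S = k" for S
    using that by (simp add: power_mult_distrib prod.distrib mult.commute[of k] power_mult)
  then show ?thesis unfolding elem_sym_def sum_distrib_left by (intro sum.cong) auto
qed

lemma theta_scale:
  fixes z :: "complex^'n::{finite,linorder}"
  shows "theta m t (c *s z) $ j =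
    c ^ (if coord_no j = CARD('n) then CARD('n) * (m div t) else coord_no j * m) * theta m t z $ j"
proof (cases "coord_no j = CARD('n)")
  case True
  then show ?thesis by (simp add: theta_def prod.distrib power_mult_distrib power_mult)
next
  case False
  then show ?thesis by (simp add: theta_def elem_sym_scale)
qed

text \<open>The weights in \<open>dilate\<close> are those of the coordinates of \<theta>. Boundary
  functions are therefore radial limits along the slices.\<close>

lemma theta_dilate: "theta m t (of_real r *s z) = dilate m t r (theta m t z)"
  by (simp add: vec_eq_iff theta_scale dilate_def)

lemma continuous_theta:
  fixes S :: "(complex^'n::{finite,linorder}) set"
  shows "continuous_on S (theta m t)"
proof -
  have "continuous_on S (\<lambda>z. theta m t z $ j)" for j
    unfolding theta_def elem_sym_def
    by (cases "coord_no j = CARD('n)") (auto intro!: continuous_intros)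
  then have "continuous_on S (\<lambda>z. \<chi> j. theta m t z $ j)" by (rule continuous_on_vec_lambda)
  then show ?thesis by simp
qed

lemma holomorphic_theta:
  fixes \<gamma> :: "complex \<Rightarrow> complex^'n::{finite,linorder}"
  assumes "\<And>i. (\<lambda>w. \<gamma> w $ i) holomorphic_on U"
  shows "(\<lambda>w. theta m t (\<gamma> w) $ j) holomorphic_on U"
  unfolding theta_def elem_sym_def
  by (cases "coord_no j = CARD('n)") (use assms in \<open>auto intro!: holomorphic_intros\<close>)

lemma space_boundary_measure: "space (boundary_measure m t) = theta m t ` torus"
  by (simp add: boundary_measure_def space_restrict_space)

lemma sets_boundary_measure:
  "sets (boundary_measure m t) = sets (restrict_space borel (theta m t ` torus))"
  by (simp add: boundary_measure_def)

lemma measurable_theta: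
  "theta m t \<in> measurable haar_torus (restrict_space borel (theta m t ` torus))"
proof -
  have "theta m t \<in> measurable (restrict_space borel torus) (restrict_space borel (theta m t ` torus))"
    by (intro measurable_restrict_space2 borel_measurable_continuous_on_restrict continuous_theta)
      (auto simp: space_restrict_space)
  then show ?thesis by (simp add: haar_torus_def cong: measurable_cong_sets)
qed

lemma sets_haar_torus: "sets haar_torus = sets (restrict_space borel torus)"
  and space_haar_torus: "space haar_torus = torus"
  by (simp_all add: haar_torus_def space_restrict_space)

lemma AE_boundary_measure:
  assumes Q: "{q \<in> theta m t ` torus. Q q} \<in> sets (restrict_space borel (theta m t ` torus))"
  shows "(AE q in boundary_measure m t. Q q) \<longleftrightarrow> (AE x in lborel. Q (theta m t (torus_point x)))"
proof -
  have "(AE q in boundary_measure m t. Q q) \<longleftrightarrow> (AE z in haar_torus. Q (theta m t z))"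
    unfolding boundary_measure_def using Q
    by (intro AE_distr_iff measurable_theta) (simp add: space_restrict_space)
  also have "\<dots> \<longleftrightarrow> (AE x in lborel. Q (theta m t (torus_point x)))"
  proof (rule AE_haar_torus)
    have "theta m t -` {q \<in> theta m t ` torus. Q q} \<inter> space haar_torus \<in> sets haar_torus"
      by (rule measurable_sets[OF measurable_theta Q])
    also have "theta m t -` {q \<in> theta m t ` torus. Q q} \<inter> space haar_torus = {z \<in> torus. Q (theta m t z)}"
      by (auto simp: space_haar_torus)
    finally show "{z \<in> torus. Q (theta m t z)} \<in> sets (restrict_space borel torus)"
      by (simp add: sets_haar_torus)
  qed
  finally show ?thesis .
qed

lemma prob_space_boundary_measure: "prob_space (boundary_measure m t)"
proof -
  have "prob_space (uniform_measure lborel (cbox (0 :: real^'n) 1))"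
    by (intro prob_space_uniform_measure) (simp_all add: emeasure_unit_cube)
  then have "prob_space (haar_torus :: (complex^'n) measure)"
    unfolding haar_torus_eq by (rule prob_space.prob_space_distr) (use measurable_torus_point in \<open>simp cong: measurable_cong_sets\<close>)
  then show ?thesis
    unfolding boundary_measure_def by (rule prob_space.prob_space_distr) (rule measurable_theta)
qed

section \<open>Holomorphic functions of several variables\<close>

lemma holomorphic_vec_on_subset:
  "holomorphic_vec_on f S \<Longrightarrow> T \<subseteq> S \<Longrightarrow> holomorphic_vec_on f T"
  unfolding holomorphic_vec_on_def using has_derivative_subset by blast

lemma holomorphic_vec_on_cong:
  assumes "holomorphic_vec_on f S" "\<And>z. z \<in> S \<Longrightarrow> f z = g z"
  shows "holomorphic_vec_on g S"
  unfolding holomorphic_vec_on_def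
proof
  fix z assume z: "z \<in> S"
  then obtain f' where f': "(f has_derivative f') (at z within S)" "\<forall>c v. f' (c *s v) = c * f' v"
    using assms(1) by (auto simp: holomorphic_vec_on_def)
  have "(g has_derivative f') (at z within S)"
    using has_derivative_transform[OF z _ f'(1)] assms(2) by metis
  with f'(2) show "\<exists>f'. (g has_derivative f') (at z within S) \<and> (\<forall>c v. f' (c *s v) = c * f' v)" by blast
qed

lemma holomorphic_vec_on_imp_continuous_on: "holomorphic_vec_on f S \<Longrightarrow> continuous_on S f"
  unfolding holomorphic_vec_on_def continuous_on_eq_continuous_within
  using has_derivative_continuous by blast

lemma holomorphic_vec_on_const: "holomorphic_vec_on (\<lambda>_. c) S"
  unfolding holomorphic_vec_on_def by (auto intro!: exI[of _ "\<lambda>_. 0"])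

lemma holomorphic_vec_on_nth: "holomorphic_vec_on (\<lambda>z. z $ i) S"
  unfolding holomorphic_vec_on_def
  by (intro ballI exI[of _ "\<lambda>v. v $ i"])
    (auto intro!: bounded_linear_imp_has_derivative bounded_linear_vec_nth)

lemma holomorphic_vec_on_add:
  assumes "holomorphic_vec_on f S" "holomorphic_vec_on g S"
  shows "holomorphic_vec_on (\<lambda>z. f z + g z) S"
  unfolding holomorphic_vec_on_def
proof
  fix z assume z: "z \<in> S"
  then obtain f' g' where "(f has_derivative f') (at z within S)" "\<forall>c v. f' (c *s v) = c * f' v"
    "(g has_derivative g') (at z within S)" "\<forall>c v. g' (c *s v) = c * g' v"
    using assms unfolding holomorphic_vec_on_def by meson
  then show "\<exists>f'. ((\<lambda>z. f z + g z) has_derivative f') (at z within S) \<and> (\<forall>c v. f' (c *s v) = c * f' v)"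
    by (intro exI[of _ "\<lambda>v. f' v + g' v"]) (auto intro!: has_derivative_add simp: distrib_left)
qed

lemma holomorphic_vec_on_mult:
  assumes "holomorphic_vec_on f S" "holomorphic_vec_on g S"
  shows "holomorphic_vec_on (\<lambda>z. f z * g z) S"
  unfolding holomorphic_vec_on_def
proof
  fix z assume z: "z \<in> S"
  then obtain f' g' where "(f has_derivative f') (at z within S)" "\<forall>c v. f' (c *s v) = c * f' v"
    "(g has_derivative g') (at z within S)" "\<forall>c v. g' (c *s v) = c * g' v"
    using assms unfolding holomorphic_vec_on_def by meson
  then show "\<exists>f'. ((\<lambda>z. f z * g z) has_derivative f') (at z within S) \<and> (\<forall>c v. f' (c *s v) = c * f' v)"
    by (intro exI[of _ "\<lambda>v. f z * g' v + f' v * g z"]) (auto intro!: has_derivative_mult simp: algebra_simps)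
qed

lemma holomorphic_vec_on_compose:
  assumes f: "holomorphic_vec_on f S" and g: "\<And>z. z \<in> S \<Longrightarrow> g field_differentiable at (f z)"
  shows "holomorphic_vec_on (\<lambda>z. g (f z)) S"
  unfolding holomorphic_vec_on_def
proof
  fix z assume z: "z \<in> S"
  then obtain f' where f': "(f has_derivative f') (at z within S)" "\<forall>c v. f' (c *s v) = c * f' v"
    using f unfolding holomorphic_vec_on_def by meson
  obtain D where "(g has_field_derivative D) (at (f z))"
    using g[OF z] by (auto simp: field_differentiable_def)
  then have "((\<lambda>z. g (f z)) has_derivative (\<lambda>v. D * f' v)) (at z within S)"
    using has_derivative_compose[OF f'(1)] by (simp add: has_field_derivative_def)
  with f'(2) show "\<exists>f'. ((\<lambda>z. g (f z)) has_derivative f') (at z within S) \<and> (\<forall>c v. f' (c *s v) = c * f' v)"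
    by (intro exI[of _ "\<lambda>v. D * f' v"]) simp
qed

lemma holomorphic_vec_on_minus: "holomorphic_vec_on f S \<Longrightarrow> holomorphic_vec_on (\<lambda>z. - f z) S"
  using holomorphic_vec_on_mult[OF holomorphic_vec_on_const[of "-1"]] by fastforce

lemma holomorphic_vec_on_diff:
  "holomorphic_vec_on f S \<Longrightarrow> holomorphic_vec_on g S \<Longrightarrow> holomorphic_vec_on (\<lambda>z. f z - g z) S"
  using holomorphic_vec_on_add[OF _ holomorphic_vec_on_minus] by fastforce

lemma holomorphic_vec_on_power: "holomorphic_vec_on f S \<Longrightarrow> holomorphic_vec_on (\<lambda>z. f z ^ n) S"
  by (induction n) (auto intro: holomorphic_vec_on_const holomorphic_vec_on_mult)

lemma holomorphic_vec_on_inverse: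
  "holomorphic_vec_on f S \<Longrightarrow> (\<And>z. z \<in> S \<Longrightarrow> f z \<noteq> 0) \<Longrightarrow> holomorphic_vec_on (\<lambda>z. inverse (f z)) S"
  by (rule holomorphic_vec_on_compose[where g = inverse])
    (auto simp: field_differentiable_def intro!: derivative_eq_intros)

lemma holomorphic_vec_on_divide:
  "holomorphic_vec_on f S \<Longrightarrow> holomorphic_vec_on g S \<Longrightarrow> (\<And>z. z \<in> S \<Longrightarrow> g z \<noteq> 0) \<Longrightarrow>
    holomorphic_vec_on (\<lambda>z. f z / g z) S"
  unfolding divide_inverse by (intro holomorphic_vec_on_mult holomorphic_vec_on_inverse)

lemma holomorphic_vec_on_exp: "holomorphic_vec_on f S \<Longrightarrow> holomorphic_vec_on (\<lambda>z. exp (f z)) S"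
  by (rule holomorphic_vec_on_compose[where g = exp])
    (auto simp: field_differentiable_def intro!: derivative_eq_intros)

lemmas holomorphic_vec_intros = holomorphic_vec_on_const holomorphic_vec_on_nth holomorphic_vec_on_add
  holomorphic_vec_on_mult holomorphic_vec_on_minus holomorphic_vec_on_diff holomorphic_vec_on_power
  holomorphic_vec_on_divide holomorphic_vec_on_exp

lemma has_derivative_vecI:
  fixes f :: "'a::real_normed_vector \<Rightarrow> complex^'n"
  assumes "\<And>i. ((\<lambda>x. f x $ i) has_derivative (\<lambda>h. f' h $ i)) F"
  shows "(f has_derivative f') F"
proof -
  have ax: "(\<Sum>i\<in>UNIV. axis i (v $ i)) = v" for v :: "complex^'n"
    by (simp add: vec_eq_iff axis_def if_distrib cong: if_cong)
  have bl: "bounded_linear (axis i :: complex \<Rightarrow> complex^'n)" for i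
  proof -
    have "linear (axis i :: complex \<Rightarrow> complex^'n)"
      by (rule linearI) (simp_all add: vec_eq_iff axis_def)
    then show ?thesis by (rule linear_conv_bounded_linear[THEN iffD1])
  qed
  have "((\<lambda>x. \<Sum>i\<in>UNIV. axis i (f x $ i)) has_derivative (\<lambda>h. \<Sum>i\<in>UNIV. axis i (f' h $ i))) F"
    by (intro has_derivative_sum bounded_linear.has_derivative[OF bl] assms)
  then show ?thesis by (simp only: ax)
qed

lemma holomorphic_on_compose_vec:
  fixes \<gamma> :: "complex \<Rightarrow> complex^'n"
  assumes f: "holomorphic_vec_on f S" and \<gamma>: "\<And>i. (\<lambda>w. \<gamma> w $ i) holomorphic_on U"
    and U: "open U" "\<And>w. w \<in> U \<Longrightarrow> \<gamma> w \<in> S"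
  shows "(\<lambda>w. f (\<gamma> w)) holomorphic_on U"
proof -
  have "\<exists>D. ((\<lambda>w. f (\<gamma> w)) has_field_derivative D) (at w)" if w: "w \<in> U" for w
  proof -
    have "\<exists>g. \<forall>i. ((\<lambda>w. \<gamma> w $ i) has_field_derivative g i) (at w)"
      using \<gamma> w U(1) by (auto simp: holomorphic_on_open intro!: choice)
    then obtain g where g: "\<And>i. ((\<lambda>w. \<gamma> w $ i) has_field_derivative g i) (at w)" by blast
    define v where "v = (\<chi> i. g i)"
    have "(\<gamma> has_derivative (\<lambda>h. h *s v)) (at w)"
      by (rule has_derivative_vecI) (use g in \<open>simp add: v_def has_field_derivative_def mult_commute_abs\<close>)
    then have d\<gamma>: "(\<gamma> has_derivative (\<lambda>h. h *s v)) (at w within U)" by (rule has_derivative_at_withinI)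
    obtain f' where f': "(f has_derivative f') (at (\<gamma> w) within S)" "\<forall>c v. f' (c *s v) = c * f' v"
      using f U(2)[OF w] unfolding holomorphic_vec_on_def by meson
    have "(f has_derivative f') (at (\<gamma> w) within \<gamma> ` U)"
      by (rule has_derivative_subset[OF f'(1)]) (use U(2) in auto)
    from diff_chain_within[OF d\<gamma> this] have "((\<lambda>w. f (\<gamma> w)) has_derivative (\<lambda>h. h * f' v)) (at w within U)"
      using f'(2) by (simp add: o_def)
    then have "((\<lambda>w. f (\<gamma> w)) has_field_derivative f' v) (at w within U)"
      by (simp add: has_field_derivative_def mult_commute_abs)
    then show ?thesis using at_within_open[OF w U(1)] by auto
  qed
  then show ?thesis using U(1) by (auto simp: holomorphic_on_open)
qed

lemma norm_vector_scalar_mult: "norm (c *s v) = norm c * norm (v :: complex^'n)"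
  by (simp add: norm_vec_def norm_mult L2_set_right_distrib)

text \<open>Cauchy's inequality in one variable on the complex line through \<open>p\<close> in the
  direction \<open>h\<close>. The disc has half the admissible radius, so that its closure stays in
  the ball; hence the factor 2.\<close>

lemma has_derivative_vec_Cauchy_bound:
  fixes f :: "complex^'n \<Rightarrow> complex"
  assumes f: "holomorphic_vec_on f (ball p \<delta>)" and \<delta>: "\<delta> > 0"
    and B: "\<And>q. q \<in> ball p \<delta> \<Longrightarrow> norm (f q) \<le> B"
    and D: "(f has_derivative D) (at p)" "\<And>c v. D (c *s v) = c * D v"
  shows "norm (D h) \<le> 2 * B / \<delta> * norm h"
proof (cases "h = 0")
  case True
  then show ?thesis using D(2)[of 0 h] by simp
next
  case False
  define \<rho> where "\<rho> = \<delta> / (2 * norm h)"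
  have \<rho>: "\<rho> > 0" using False \<delta> by (simp add: \<rho>_def)
  define \<phi> where "\<phi> w = f (p + w *s h)" for w
  have inb: "p + w *s h \<in> ball p \<delta>" if "w \<in> ball 0 (2 * \<rho>)" for w
    using that False by (simp add: dist_norm norm_vector_scalar_mult \<rho>_def field_simps)
  have hol: "\<phi> holomorphic_on ball 0 (2 * \<rho>)"
    unfolding \<phi>_def by (rule holomorphic_on_compose_vec[OF f]) (use inb in \<open>auto intro!: holomorphic_intros\<close>)
  have "((\<lambda>w. p + w *s h) has_derivative (\<lambda>w. w *s h)) (at 0)"
  proof (rule has_derivative_vecI)
    fix i
    have "((\<lambda>w. p $ i + w * h $ i) has_derivative (\<lambda>w. 0 + w * h $ i)) (at 0)"
      by (intro has_derivative_add has_derivative_const has_derivative_mult_left has_derivative_ident)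
    then show "((\<lambda>w. (p + w *s h) $ i) has_derivative (\<lambda>w. (w *s h) $ i)) (at 0)" by simp
  qed
  then have "(\<phi> has_derivative (\<lambda>w. D (w *s h))) (at 0)"
    unfolding \<phi>_def by (rule has_derivative_compose) (use D(1) in simp)
  then have "(\<phi> has_field_derivative D h) (at 0)"
    by (simp add: has_field_derivative_def D(2) mult_commute_abs)
  then have "deriv \<phi> 0 = D h" by (rule DERIV_imp_deriv)
  moreover have "norm ((deriv ^^ 1) \<phi> 0) \<le> fact 1 * B / \<rho> ^ 1"
  proof (rule Cauchy_inequality)
    show "\<phi> holomorphic_on ball 0 \<rho>" by (rule holomorphic_on_subset[OF hol]) (use \<rho> in auto)
    show "continuous_on (cball 0 \<rho>) \<phi>"
      by (rule continuous_on_subset[OF holomorphic_on_imp_continuous_on[OF hol]]) (use \<rho> in auto)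
    show "norm (\<phi> w) \<le> B" if "norm (0 - w) = \<rho>" for w
      unfolding \<phi>_def using that \<rho> by (intro B inb) auto
  qed (use \<rho> in simp)
  ultimately show ?thesis by (simp add: \<rho>_def field_simps)
qed

text \<open>Cauchy's inequality turns the majorant of the functions into one of the derivatives on a
  ball of half the radius. This justifies differentiation term by term, and complex homogeneity
  passes to the sum of the derivatives.\<close>

theorem holomorphic_vec_on_suminf:
  fixes F :: "nat \<Rightarrow> complex^'n \<Rightarrow> complex"
  assumes W: "open W" and F: "\<And>k. holomorphic_vec_on (F k) W"
    and M: "\<And>q. q \<in> W \<Longrightarrow> \<exists>\<delta>>0. \<exists>M. ball q \<delta> \<subseteq> W \<and> summable M \<and> (\<forall>k. \<forall>p\<in>ball q \<delta>. norm (F k p) \<le> M k)"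
  shows "holomorphic_vec_on (\<lambda>q. \<Sum>k. F k q) W"
  unfolding holomorphic_vec_on_def
proof
  fix q assume q: "q \<in> W"
  then obtain \<delta> M where \<delta>: "\<delta> > 0" "ball q \<delta> \<subseteq> W" "summable M"
    and FM: "\<And>k p. p \<in> ball q \<delta> \<Longrightarrow> norm (F k p) \<le> M k" using M by meson
  let ?S = "ball q (\<delta> / 2)"
  define D where "D k p = (SOME D. (F k has_derivative D) (at p) \<and> (\<forall>c v. D (c *s v) = c * D v))" for k p
  have "(F k has_derivative D k p) (at p) \<and> (\<forall>c v. D k p (c *s v) = c * D k p v)" if p: "p \<in> W" for k p
  proof -
    have "\<exists>D. (F k has_derivative D) (at p) \<and> (\<forall>c v. D (c *s v) = c * D v)"
      using F[of k, unfolded holomorphic_vec_on_def, rule_format, OF p] at_within_open[OF p W] by simp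
    from someI_ex[OF this] show ?thesis unfolding D_def .
  qed
  then have D: "\<And>k p. p \<in> W \<Longrightarrow> (F k has_derivative D k p) (at p)"
      "\<And>k p c v. p \<in> W \<Longrightarrow> D k p (c *s v) = c * D k p v" by blast+
  have "?S \<subseteq> ball q \<delta>" using \<delta>(1) by (intro subset_ball) simp
  then have SW: "?S \<subseteq> W" using \<delta>(2) by (rule order_trans)
  have sub: "ball p (\<delta> / 2) \<subseteq> ball q \<delta>" if "p \<in> ?S" for p
  proof
    fix x assume "x \<in> ball p (\<delta> / 2)"
    then show "x \<in> ball q \<delta>" using that dist_triangle[of q x p] by simp
  qed
  define C where "C k = 2 * M k / (\<delta> / 2)" for k
  have Db: "norm (D k p h) \<le> C k * norm h" if p: "p \<in> ?S" for k p h
    unfolding C_def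
  proof (rule has_derivative_vec_Cauchy_bound[of "F k"])
    show "holomorphic_vec_on (F k) (ball p (\<delta> / 2))"
      using sub[OF p] \<delta>(2) by (intro holomorphic_vec_on_subset[OF F]) auto
    show "norm (F k q') \<le> M k" if "q' \<in> ball p (\<delta> / 2)" for q'
      using that sub[OF p] by (intro FM) auto
    show "(F k has_derivative D k p) (at p)" "\<And>c v. D k p (c *s v) = c * D k p v"
      using D SW p by auto
  qed (use \<delta> in simp)
  have sC: "summable C" unfolding C_def using \<delta>(3) by (intro summable_divide summable_mult)
  have sD: "summable (\<lambda>k. D k p h)" if "p \<in> ?S" for p h
    by (rule summable_comparison_test'[of "\<lambda>k. C k * norm h"]) (use that Db sC in \<open>auto intro: summable_mult2\<close>)
  let ?g = "\<lambda>p h. \<Sum>k. D k p h"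
  have "\<exists>g. \<forall>x\<in>?S. (\<lambda>n. F n x) sums (g x) \<and> (g has_derivative ?g x) (at x within ?S)"
  proof (rule has_derivative_series[where f' = D and x = q and l = "\<Sum>k. F k q"])
    show "(F n has_derivative D n x) (at x within ?S)" if "x \<in> ?S" for n x
      by (rule has_derivative_at_withinI, rule D(1)) (use SW that in blast)
    show "\<forall>\<^sub>F n in sequentially. \<forall>x\<in>?S. \<forall>h. norm ((\<Sum>i<n. D i x h) - ?g x h) \<le> e * norm h" if e: "e > 0" for e
    proof -
      obtain N where N: "\<And>n. n \<ge> N \<Longrightarrow> norm (\<Sum>i. C (i + n)) < e"
        using suminf_exist_split[OF e sC] by blast
      have "norm ((\<Sum>i<n. D i x h) - ?g x h) \<le> e * norm h" if n: "n \<ge> N" and x: "x \<in> ?S" for n x h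
      proof -
        have "?g x h = (\<Sum>i. D (i + n) x h) + (\<Sum>i<n. D i x h)"
          by (rule suminf_split_initial_segment[OF sD[OF x]])
        then have "norm ((\<Sum>i<n. D i x h) - ?g x h) = norm (\<Sum>i. D (i + n) x h)"
          by (simp add: norm_minus_commute)
        also have "\<dots> \<le> (\<Sum>i. C (i + n) * norm h)"
          using Db[OF x] sC by (intro norm_suminf_le summable_mult2) (auto simp: summable_iff_shift)
        also have "\<dots> = (\<Sum>i. C (i + n)) * norm h"
          using sC by (intro suminf_mult2[symmetric]) (simp add: summable_iff_shift)
        also have "\<dots> \<le> e * norm h"
          using N[OF n] by (intro mult_right_mono) auto
        finally show ?thesis .
      qed
      then show ?thesis unfolding eventually_sequentially by blast
    qed
    show "(\<lambda>n. F n q) sums (\<Sum>k. F k q)"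
      by (rule summable_sums, rule summable_comparison_test'[OF \<delta>(3)]) (use FM \<delta>(1) in auto)
  qed (use \<delta>(1) in auto)
  then obtain g where g: "\<And>x. x \<in> ?S \<Longrightarrow> (\<lambda>n. F n x) sums g x"
      "\<And>x. x \<in> ?S \<Longrightarrow> (g has_derivative ?g x) (at x within ?S)" by blast
  have qS: "q \<in> ?S" using \<delta>(1) by simp
  have "(g has_derivative ?g q) (at q)" using g(2)[OF qS] at_within_open[OF qS] by simp
  then have "((\<lambda>q. \<Sum>k. F k q) has_derivative ?g q) (at q)"
    by (rule has_derivative_transform_within_open[OF _ open_ball qS]) (use g(1) in \<open>simp add: sums_iff\<close>)
  then have "((\<lambda>q. \<Sum>k. F k q) has_derivative ?g q) (at q within W)" by (rule has_derivative_at_withinI)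
  moreover have "?g q (c *s v) = c * ?g q v" for c v
    using D(2)[OF q] sD[OF qS] by (simp add: suminf_mult)
  ultimately show "\<exists>f'. ((\<lambda>q. \<Sum>k. F k q) has_derivative f') (at q within W) \<and> (\<forall>c v. f' (c *s v) = c * f' v)"
    by blast
qed

section \<open>The algebra \<open>H\<^sup>\<infinity>\<close>\<close>

lemma carrier_Hinf:
  "f \<in> carrier (Hinf \<Omega>) \<longleftrightarrow> f \<in> extensional \<Omega> \<and> holomorphic_vec_on f \<Omega> \<and> bounded (f ` \<Omega>)"
  by (simp add: Hinf_def)

lemma restrict_in_Hinf:
  assumes "holomorphic_vec_on g \<Omega>" "\<And>z. z \<in> \<Omega> \<Longrightarrow> norm (g z) \<le> B"
  shows "restrict g \<Omega> \<in> carrier (Hinf \<Omega>)"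
  using assms holomorphic_vec_on_cong[OF assms(1), of "restrict g \<Omega>"]
  by (auto simp: carrier_Hinf bounded_iff)

lemma Hinf_bound:
  assumes "f \<in> carrier (Hinf \<Omega>)"
  shows "\<exists>B\<ge>0. \<forall>z\<in>\<Omega>. norm (f z) \<le> B"
proof -
  obtain B where "B > 0" "\<forall>z\<in>\<Omega>. norm (f z) \<le> B" using assms by (auto simp: carrier_Hinf bounded_pos)
  then show ?thesis by (intro exI[of _ B]) simp
qed

lemma Hinf_simps:
  "\<one>\<^bsub>Hinf \<Omega>\<^esub> = (\<lambda>z\<in>\<Omega>. 1)" "f \<oplus>\<^bsub>Hinf \<Omega>\<^esub> g = (\<lambda>z\<in>\<Omega>. f z + g z)"
  "f \<otimes>\<^bsub>Hinf \<Omega>\<^esub> g = (\<lambda>z\<in>\<Omega>. f z * g z)" "c \<odot>\<^bsub>Hinf \<Omega>\<^esub> f = (\<lambda>z\<in>\<Omega>. c * f z)"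
  by (simp_all add: Hinf_def)

lemma Hinf_one_closed: "\<one>\<^bsub>Hinf \<Omega>\<^esub> \<in> carrier (Hinf \<Omega>)"
  unfolding Hinf_simps by (rule restrict_in_Hinf[of _ _ 1]) (auto intro: holomorphic_vec_on_const)

lemma Hinf_smult_closed: "f \<in> carrier (Hinf \<Omega>) \<Longrightarrow> c \<odot>\<^bsub>Hinf \<Omega>\<^esub> f \<in> carrier (Hinf \<Omega>)"
  unfolding Hinf_simps
proof -
  assume f: "f \<in> carrier (Hinf \<Omega>)"
  then obtain B where "\<And>z. z \<in> \<Omega> \<Longrightarrow> norm (f z) \<le> B" using Hinf_bound by blast
  then show "(\<lambda>z\<in>\<Omega>. c * f z) \<in> carrier (Hinf \<Omega>)"
    using f by (intro restrict_in_Hinf[of _ _ "norm c * B"])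
      (auto simp: carrier_Hinf norm_mult intro!: holomorphic_vec_intros mult_left_mono)
qed

lemma Hinf_add_closed:
  assumes f: "f \<in> carrier (Hinf \<Omega>)" and g: "g \<in> carrier (Hinf \<Omega>)"
  shows "f \<oplus>\<^bsub>Hinf \<Omega>\<^esub> g \<in> carrier (Hinf \<Omega>)"
proof -
  obtain B where B: "\<And>z. z \<in> \<Omega> \<Longrightarrow> norm (f z) \<le> B" using Hinf_bound[OF f] by blast
  obtain C where C: "\<And>z. z \<in> \<Omega> \<Longrightarrow> norm (g z) \<le> C" using Hinf_bound[OF g] by blast
  show ?thesis unfolding Hinf_simps
    using f g by (intro restrict_in_Hinf[of _ _ "B + C"])
      (auto simp: carrier_Hinf intro!: holomorphic_vec_intros norm_triangle_mono B C)
qed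

lemma Hinf_mult_closed:
  assumes f: "f \<in> carrier (Hinf \<Omega>)" and g: "g \<in> carrier (Hinf \<Omega>)"
  shows "f \<otimes>\<^bsub>Hinf \<Omega>\<^esub> g \<in> carrier (Hinf \<Omega>)"
proof -
  obtain B where B: "B \<ge> 0" "\<And>z. z \<in> \<Omega> \<Longrightarrow> norm (f z) \<le> B" using Hinf_bound[OF f] by blast
  obtain C where C: "C \<ge> 0" "\<And>z. z \<in> \<Omega> \<Longrightarrow> norm (g z) \<le> C" using Hinf_bound[OF g] by blast
  show ?thesis unfolding Hinf_simps
    using f g B C by (intro restrict_in_Hinf[of _ _ "B * C"])
      (auto simp: carrier_Hinf norm_mult intro!: holomorphic_vec_intros mult_mono)
qed

text \<open>If \<open>l = \<phi> f\<close> had modulus above \<open>B\<close>, then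
  \<open>f - l\<close> would be bounded away from 0 and invertible in the algebra, although
  \<open>\<phi>\<close> annihilates it.\<close>

lemma Hinf_character_le:
  assumes \<phi>: "\<phi> \<in> characters (Hinf \<Omega>)" and f: "f \<in> carrier (Hinf \<Omega>)"
    and B: "\<And>z. z \<in> \<Omega> \<Longrightarrow> norm (f z) \<le> B"
  shows "norm (\<phi> f) \<le> B"
proof (rule ccontr)
  define l where "l = \<phi> f"
  assume "\<not> norm (\<phi> f) \<le> B"
  then have d: "norm l - B > 0" by (simp add: l_def)
  have lower: "norm l - B \<le> norm (f z - l)" if "z \<in> \<Omega>" for z
    using B[OF that] norm_triangle_ineq2[of l "f z"] by (simp add: norm_minus_commute)
  have nz: "f z - l \<noteq> 0" if "z \<in> \<Omega>" for z using lower[OF that] d by auto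
  define g where "g = (\<lambda>z\<in>\<Omega>. 1 / (f z - l))"
  have g: "g \<in> carrier (Hinf \<Omega>)"
    unfolding g_def
  proof (rule restrict_in_Hinf)
    show "holomorphic_vec_on (\<lambda>z. 1 / (f z - l)) \<Omega>"
      using f nz by (intro holomorphic_vec_intros) (auto simp: carrier_Hinf)
    show "norm (1 / (f z - l)) \<le> 1 / (norm l - B)" if "z \<in> \<Omega>" for z
      using lower[OF that] d by (auto simp: norm_divide intro!: divide_left_mono mult_pos_pos)
  qed
  define k where "k = f \<oplus>\<^bsub>Hinf \<Omega>\<^esub> (- l) \<odot>\<^bsub>Hinf \<Omega>\<^esub> \<one>\<^bsub>Hinf \<Omega>\<^esub>"
  have k: "k \<in> carrier (Hinf \<Omega>)" "\<phi> k = 0"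
    using \<phi> f Hinf_one_closed[of \<Omega>] Hinf_smult_closed[OF Hinf_one_closed[of \<Omega>], of "- l"]
    by (auto simp: k_def characters_def l_def intro!: Hinf_add_closed)
  have "k \<otimes>\<^bsub>Hinf \<Omega>\<^esub> g = \<one>\<^bsub>Hinf \<Omega>\<^esub>"
    using nz by (auto simp: k_def g_def Hinf_simps fun_eq_iff)
  then have "\<phi> k * \<phi> g = 1" using \<phi> k(1) g by (auto simp: characters_def) metis
  then show False using k(2) by simp
qed

lemma evaluation_character:
  assumes z: "z \<in> \<Omega>"
  shows "(\<lambda>f\<in>carrier (Hinf \<Omega>). f z) \<in> characters (Hinf \<Omega>)"
  unfolding characters_def
proof (intro CollectI conjI ballI allI)
  let ?e = "\<lambda>f\<in>carrier (Hinf \<Omega>). f z"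
  show "?e \<in> extensional (carrier (Hinf \<Omega>))" by simp
  show "?e \<one>\<^bsub>Hinf \<Omega>\<^esub> = 1"
    unfolding restrict_apply'[OF Hinf_one_closed] by (simp add: Hinf_simps z)
  show "?e (c \<odot>\<^bsub>Hinf \<Omega>\<^esub> f) = c * ?e f" if f: "f \<in> carrier (Hinf \<Omega>)" for c f
    unfolding restrict_apply'[OF f] restrict_apply'[OF Hinf_smult_closed[OF f]] by (simp add: Hinf_simps z)
  fix f g assume f: "f \<in> carrier (Hinf \<Omega>)" and g: "g \<in> carrier (Hinf \<Omega>)"
  show "?e (f \<oplus>\<^bsub>Hinf \<Omega>\<^esub> g) = ?e f + ?e g"
    unfolding restrict_apply'[OF f] restrict_apply'[OF g] restrict_apply'[OF Hinf_add_closed[OF f g]]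
    by (simp add: Hinf_simps z)
  show "?e (f \<otimes>\<^bsub>Hinf \<Omega>\<^esub> g) = ?e f * ?e g"
    unfolding restrict_apply'[OF f] restrict_apply'[OF g] restrict_apply'[OF Hinf_mult_closed[OF f g]]
    by (simp add: Hinf_simps z)
qed

lemma bounded_characters_Hinf: "bounded_characters (Hinf \<Omega>)"
proof
  fix f assume f: "f \<in> carrier (Hinf \<Omega>)"
  obtain B where B: "\<And>z. z \<in> \<Omega> \<Longrightarrow> norm (f z) \<le> B" using Hinf_bound[OF f] by blast
  have "norm (\<phi> f) \<le> B" if "\<phi> \<in> characters (Hinf \<Omega>)" for \<phi>
    using that f B by (rule Hinf_character_le)
  then show "\<exists>B. \<forall>\<phi>\<in>characters (Hinf \<Omega>). norm (\<phi> f) \<le> B" by blast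
qed (rule Hinf_one_closed Hinf_add_closed Hinf_mult_closed Hinf_smult_closed; assumption)+

lemma sup_norm_on_upper:
  assumes "f \<in> carrier (Hinf \<Omega>)" "z \<in> \<Omega>" shows "norm (f z) \<le> sup_norm_on \<Omega> f"
proof -
  obtain B where "\<And>z. z \<in> \<Omega> \<Longrightarrow> norm (f z) \<le> B" using Hinf_bound[OF assms(1)] by blast
  then have "bdd_above ((\<lambda>z. norm (f z)) ` \<Omega>)" by (intro bdd_aboveI2)
  then show ?thesis unfolding sup_norm_on_def using assms(2) by (rule cSUP_upper[rotated])
qed

text \<open>Characters are bounded by the sup norm, and evaluations at points of \<Omega> are
  characters. So \<open>sup_norm_on\<close> is the largest modulus of a character at
  \<open>f\<close>, and compactness makes the supremum over \<open>C\<close> a maximum.\<close>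

lemma closed_boundary_iff:
  assumes \<Omega>: "\<Omega> \<noteq> {}"
  shows "closed_boundary \<Omega> C \<longleftrightarrow>
    norm_boundary (maximal_ideal_space (Hinf \<Omega>)) ((\<lambda>f \<psi>. \<psi> f) ` carrier (Hinf \<Omega>)) C"
proof -
  interpret fa: function_algebra "maximal_ideal_space (Hinf \<Omega>)" "(\<lambda>f \<psi>. \<psi> f) ` carrier (Hinf \<Omega>)"
    by (rule bounded_characters.function_algebra_Gelfand[OF bounded_characters_Hinf])
  have ub: "norm (\<phi> f) \<le> sup_norm_on \<Omega> f" if "\<phi> \<in> characters (Hinf \<Omega>)" "f \<in> carrier (Hinf \<Omega>)" for \<phi> f
    by (rule Hinf_character_le[OF that]) (rule sup_norm_on_upper[OF that(2)])
  show ?thesis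
  proof
    assume L: "closed_boundary \<Omega> C"
    then have cl: "closedin (maximal_ideal_space (Hinf \<Omega>)) C" by (simp add: closed_boundary_def)
    have "C \<noteq> {}"
    proof
      \<comment> \<open>The supremum of the empty set is some fixed real number, but there are functions of different norms.\<close>
      assume "C = {}"
      moreover have "sup_norm_on \<Omega> (\<lambda>z\<in>\<Omega>. c) = norm c" for c :: complex
        using \<Omega> by (simp add: sup_norm_on_def)
      moreover have "(\<lambda>z\<in>\<Omega>. c) \<in> carrier (Hinf \<Omega>)" for c :: complex
        by (rule restrict_in_Hinf[of _ _ "norm c"]) (auto intro: holomorphic_vec_on_const)
      ultimately have "norm c = Sup {}" for c :: complex
        using L by (auto simp: closed_boundary_def)
      from this[of 0] this[of 1] show False by simp
    qed
    have "\<exists>y\<in>C. \<forall>x\<in>topspace (maximal_ideal_space (Hinf \<Omega>)). norm (x f) \<le> norm (y f)"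
      if f: "f \<in> carrier (Hinf \<Omega>)" for f
    proof -
      have "(\<lambda>\<psi>. \<psi> f) \<in> (\<lambda>f \<psi>. \<psi> f) ` carrier (Hinf \<Omega>)" using f by auto
      from fa.attains_sup[OF cl \<open>C \<noteq> {}\<close> this]
      obtain y where y: "y \<in> C" "\<forall>x\<in>C. norm (x f) \<le> norm (y f)" by auto
      have "(SUP \<phi>\<in>C. norm (\<phi> f)) = norm (y f)"
        using y by (intro cSup_eq_maximum) auto
      then have "sup_norm_on \<Omega> f = norm (y f)" using L f by (simp add: closed_boundary_def)
      then show ?thesis using y(1) ub[OF _ f] by (auto simp: topspace_maximal_ideal_space)
    qed
    then show "norm_boundary (maximal_ideal_space (Hinf \<Omega>)) ((\<lambda>f \<psi>. \<psi> f) ` carrier (Hinf \<Omega>)) C"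
      using cl by (auto simp: norm_boundary_def)
  next
    assume R: "norm_boundary (maximal_ideal_space (Hinf \<Omega>)) ((\<lambda>f \<psi>. \<psi> f) ` carrier (Hinf \<Omega>)) C"
    then have cl: "closedin (maximal_ideal_space (Hinf \<Omega>)) C" by (simp add: norm_boundary_def)
    have "sup_norm_on \<Omega> f = (SUP \<phi>\<in>C. norm (\<phi> f))" if f: "f \<in> carrier (Hinf \<Omega>)" for f
    proof -
      obtain y where y: "y \<in> C" "\<And>x. x \<in> characters (Hinf \<Omega>) \<Longrightarrow> norm (x f) \<le> norm (y f)"
        using R f by (auto simp: norm_boundary_def topspace_maximal_ideal_space)
      have CX: "C \<subseteq> characters (Hinf \<Omega>)" using closedin_subset[OF cl] by (simp add: topspace_maximal_ideal_space)
      have "(SUP \<phi>\<in>C. norm (\<phi> f)) = norm (y f)"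
        using y CX by (intro cSup_eq_maximum) auto
      moreover have "sup_norm_on \<Omega> f \<le> norm (y f)"
        unfolding sup_norm_on_def
      proof (rule cSUP_least[OF \<Omega>])
        fix z assume "z \<in> \<Omega>"
        define e where "e = (\<lambda>f\<in>carrier (Hinf \<Omega>). f z)"
        have "e \<in> characters (Hinf \<Omega>)" unfolding e_def using \<open>z \<in> \<Omega>\<close> by (rule evaluation_character)
        then have "norm (e f) \<le> norm (y f)" by (rule y(2))
        then show "norm (f z) \<le> norm (y f)" using f by (simp add: e_def)
      qed
      moreover have "y \<in> characters (Hinf \<Omega>)" using y(1) CX by blast
      then have "norm (y f) \<le> sup_norm_on \<Omega> f" using f by (rule ub)
      ultimately show ?thesis by simp
    qed
    with cl show "closed_boundary \<Omega> C" by (simp add: closed_boundary_def)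
  qed
qed

text \<open>\<open>LEAST\<close> denotes something useful only if a least closed boundary exists.
  One closed boundary being given, the intersection of all of them is again one and hence the
  least.\<close>

theorem silov_boundary_subset:
  assumes \<Omega>: "\<Omega> \<noteq> {}" and C: "closed_boundary \<Omega> C"
  shows "silov_boundary \<Omega> \<subseteq> C"
proof -
  interpret fa: function_algebra "maximal_ideal_space (Hinf \<Omega>)" "(\<lambda>f \<psi>. \<psi> f) ` carrier (Hinf \<Omega>)"
    by (rule bounded_characters.function_algebra_Gelfand[OF bounded_characters_Hinf])
  let ?S = "\<Inter>{E. closed_boundary \<Omega> E}"
  have S: "closed_boundary \<Omega> ?S"
    using fa.norm_boundary_Inter C by (simp add: closed_boundary_iff[OF \<Omega>])
  have "silov_boundary \<Omega> = ?S"
    unfolding silov_boundary_def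
  proof (rule Least_equality)
    show "closed_boundary \<Omega> ?S" by (rule S)
    show "?S \<subseteq> E" if "closed_boundary \<Omega> E" for E using that by blast
  qed
  then show ?thesis using C by auto
qed

section \<open>Boundary functions\<close>

lemma polydisc_scale_torus:
  "norm c < 1 \<Longrightarrow> z \<in> torus \<Longrightarrow> c *s z \<in> polydisc"
  by (auto simp: polydisc_def torus_def norm_mult)

lemma dilate_in_domain:
  assumes "q \<in> theta m t ` torus" "0 \<le> r" "r < 1"
  shows "dilate m t r q \<in> theta m t ` polydisc"
proof -
  from assms(1) obtain z where z: "z \<in> torus" "q = theta m t z" by auto
  show ?thesis unfolding z(2) theta_dilate[symmetric]
    by (rule imageI, rule polydisc_scale_torus) (use assms z in auto)
qed

lemma slice_holomorphic:
  fixes \<zeta> :: "complex^'n::{finite,linorder}"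
  assumes f: "holomorphic_vec_on f (theta m t ` polydisc)" and \<zeta>: "\<zeta> \<in> torus"
  shows "(\<lambda>w. f (theta m t (w *s \<zeta>))) holomorphic_on ball 0 1"
proof (rule holomorphic_on_compose_vec[OF f])
  show "(\<lambda>w. theta m t (w *s \<zeta>) $ i) holomorphic_on ball 0 1" for i
    by (rule holomorphic_theta) (auto intro!: holomorphic_intros)
qed (use \<zeta> polydisc_scale_torus in auto)

lemma measurable_theta_torus_point:
  "(\<lambda>x. theta m t (torus_point x)) \<in> measurable borel (restrict_space borel (theta m t ` torus))"
  by (intro measurable_restrict_space2 borel_measurable_continuous_onI
      continuous_on_compose2[OF continuous_theta continuous_torus_point]) auto

lemma theta_lines_pred:
  assumes Q: "{q \<in> theta m t ` torus. Q q} \<in> sets (restrict_space borel (theta m t ` torus))"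
  shows "Measurable.pred borel (\<lambda>x. Q (theta m t (torus_point x)))"
  using measurable_sets[OF measurable_theta_torus_point Q] by (simp add: pred_def vimage_def)

text \<open>The slices \<open>s \<mapsto> cis (2 \<pi> s) z\<close> reduce statements about \<open>\<mu>\<close> to statements about one variable.\<close>

lemma AE_boundary_measure_slices:
  assumes Q: "{q \<in> theta m t ` torus. Q q} \<in> sets (restrict_space borel (theta m t ` torus))"
  shows "(AE q in boundary_measure m t. Q q) \<longleftrightarrow>
    (AE x in lborel. AE s in (lborel :: real measure). Q (theta m t (cis (2 * pi * s) *s torus_point x)))"
  unfolding AE_boundary_measure[OF Q]
  by (subst AE_lborel_iff_AE_lines[OF theta_lines_pred[OF Q], of 1]) (simp add: torus_point_line)

text \<open>Cauchy's criterion with rational parameters, to which continuity reduces the real ones.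
  In this form the existence of a limit is a countable combination of inequalities, each of them
  measurable in a boundary point.\<close>

lemma has_left_limit_iff:
  fixes \<phi> :: "real \<Rightarrow> complex"
  assumes \<phi>: "continuous_on {0<..<1} \<phi>"
  shows "(\<exists>l. (\<phi> \<longlongrightarrow> l) (at_left 1)) \<longleftrightarrow>
    (\<forall>n::nat. \<exists>N::nat. \<forall>a b :: rat. of_rat a \<in> {1 - 1 / (real N + 1)<..<1} \<and> of_rat b \<in> {1 - 1 / (real N + 1)<..<1}
      \<longrightarrow> dist (\<phi> (of_rat a)) (\<phi> (of_rat b)) \<le> 1 / (real n + 1))" (is "?L \<longleftrightarrow> ?R")
proof
  assume ?L
  then obtain l where l: "(\<phi> \<longlongrightarrow> l) (at_left 1)" ..
  show ?R
  proof
    fix n :: nat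
    have "eventually (\<lambda>r. dist (\<phi> r) l < 1 / (real n + 1) / 2) (at_left 1)"
      using l by (rule tendstoD) simp
    then obtain b where b: "b < 1" "\<And>r. b < r \<Longrightarrow> r < 1 \<Longrightarrow> dist (\<phi> r) l < 1 / (real n + 1) / 2"
      by (auto simp: eventually_at_left[of 0 "1::real", simplified])
    obtain N :: nat where N: "1 / (real N + 1) < 1 - b"
      using b(1) reals_Archimedean[of "1 - b"] by (auto simp: inverse_eq_divide add.commute)
    show "\<exists>N::nat. \<forall>a b :: rat. of_rat a \<in> {1 - 1 / (real N + 1)<..<1} \<and> of_rat b \<in> {1 - 1 / (real N + 1)<..<1}
      \<longrightarrow> dist (\<phi> (of_rat a)) (\<phi> (of_rat b)) \<le> 1 / (real n + 1)"
    proof (intro exI[of _ N] allI impI)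
      fix u v :: rat
      assume "of_rat u \<in> {1 - 1 / (real N + 1)<..<1} \<and> of_rat v \<in> {1 - 1 / (real N + 1)<..<1}"
      then have "dist (\<phi> (of_rat u)) l < 1 / (real n + 1) / 2" "dist (\<phi> (of_rat v)) l < 1 / (real n + 1) / 2"
        using N b(2)[of "of_rat u"] b(2)[of "of_rat v"] by auto
      then show "dist (\<phi> (of_rat u)) (\<phi> (of_rat v)) \<le> 1 / (real n + 1)"
        using dist_triangle2[of "\<phi> (of_rat u)" "\<phi> (of_rat v)" l] by linarith
    qed
  qed
next
  assume R: ?R
  have "\<exists>N::nat. \<forall>a\<in>{1 - 1 / (real N + 1)<..<1}. \<forall>b\<in>{1 - 1 / (real N + 1)<..<1}. dist (\<phi> a) (\<phi> b) \<le> 1 / (real n + 1)" for n :: nat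
  proof -
    obtain N :: nat where N: "\<And>a b :: rat. of_rat a \<in> {1 - 1 / (real N + 1)<..<1} \<Longrightarrow> of_rat b \<in> {1 - 1 / (real N + 1)<..<1}
      \<Longrightarrow> dist (\<phi> (of_rat a)) (\<phi> (of_rat b)) \<le> 1 / (real n + 1)" using R by blast
    let ?I = "{1 - 1 / (real N + 1)<..<1}"
    have "1 / (real N + 1) \<le> 1" by simp
    then have "0 < x" if "x \<in> ?I" for x
      using that unfolding greaterThanLessThan_iff by linarith
    then have I: "?I \<subseteq> {0<..<1}" by auto
    have dense: "?I \<subseteq> closure (?I \<inter> \<rat>)"
      using open_Int_closure_subset[of ?I \<rat>] by (simp add: Rats_closure_real)
    have cont: "continuous_on ?I \<phi>" by (rule continuous_on_subset[OF \<phi> I])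
    have seq: "\<exists>x. (\<forall>k. x k \<in> ?I \<inter> \<rat>) \<and> x \<longlonglongrightarrow> a" if "a \<in> ?I" for a
    proof -
      have "a \<in> closure (?I \<inter> \<rat>)" using dense that by blast
      then show ?thesis unfolding closure_sequential .
    qed
    have "dist (\<phi> a) (\<phi> b) \<le> 1 / (real n + 1)" if ab: "a \<in> ?I" "b \<in> ?I" for a b
    proof -
      obtain x y where x: "\<And>k. x k \<in> ?I \<inter> \<rat>" "x \<longlonglongrightarrow> a" and y: "\<And>k. y k \<in> ?I \<inter> \<rat>" "y \<longlonglongrightarrow> b"
        using seq[OF ab(1)] seq[OF ab(2)] by blast
      have lx: "(\<lambda>k. \<phi> (x k)) \<longlonglongrightarrow> \<phi> a"
        by (rule continuous_on_tendsto_compose[OF cont x(2) ab(1)]) (use x in auto)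
      have ly: "(\<lambda>k. \<phi> (y k)) \<longlonglongrightarrow> \<phi> b"
        by (rule continuous_on_tendsto_compose[OF cont y(2) ab(2)]) (use y in auto)
      have "(\<lambda>k. dist (\<phi> (x k)) (\<phi> (y k))) \<longlonglongrightarrow> dist (\<phi> a) (\<phi> b)"
        by (rule tendsto_dist[OF lx ly])
      moreover have "dist (\<phi> (x k)) (\<phi> (y k)) \<le> 1 / (real n + 1)" for k
      proof -
        obtain u v where "x k = of_rat u" "y k = of_rat v" using x(1)[of k] y(1)[of k] by (auto elim!: Rats_cases)
        then show ?thesis using N[of u v] x(1)[of k] y(1)[of k] by auto
      qed
      ultimately show ?thesis by (intro LIMSEQ_le_const2[OF _ exI[of _ 0]]) auto
    qed
    then show ?thesis by blast
  qed
  then have N: "\<exists>N::nat. \<forall>a\<in>{1 - 1 / (real N + 1)<..<1}. \<forall>b\<in>{1 - 1 / (real N + 1)<..<1}. dist (\<phi> a) (\<phi> b) \<le> 1 / (real n + 1)" for n :: nat .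
  have "cauchy_filter (filtermap \<phi> (at_left 1))"
    unfolding cauchy_filter_metric_filtermap
  proof (intro allI impI)
    fix e :: real assume "e > 0"
    then obtain n :: nat where n: "1 / (real n + 1) < e"
      using reals_Archimedean[of e] by (auto simp: inverse_eq_divide add.commute)
    obtain N :: nat where N': "\<And>a b. a \<in> {1 - 1 / (real N + 1)<..<1} \<Longrightarrow> b \<in> {1 - 1 / (real N + 1)<..<1} \<Longrightarrow> dist (\<phi> a) (\<phi> b) \<le> 1 / (real n + 1)"
      using N[of n] by blast
    have "eventually (\<lambda>r. r \<in> {1 - 1 / (real N + 1)<..<1}) (at_left (1::real))"
      by (rule eventually_at_left_real) simp
    then show "\<exists>P. eventually P (at_left 1) \<and> (\<forall>x y. P x \<and> P y \<longrightarrow> dist (\<phi> x) (\<phi> y) < e)"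
      using N' n by (intro exI[of _ "\<lambda>r. r \<in> {1 - 1 / (real N + 1)<..<1}"]) (auto intro: le_less_trans)
  qed
  then have "\<exists>l. filtermap \<phi> (at_left 1) \<le> nhds l"
    by (intro cauchy_filter_complete_converges[OF _ complete_UNIV]) (auto simp: filtermap_bot_iff)
  then show ?L by (auto simp: filterlim_def)
qed

lemma continuous_dilate:
  fixes S :: "(complex^'n::{finite,linorder}) set"
  shows "continuous_on S (dilate m t r)"
  unfolding dilate_def by (intro continuous_intros)

lemma continuous_dilate_r:
  fixes q :: "complex^'n::{finite,linorder}"
  shows "continuous_on S (\<lambda>r. dilate m t r q)"
  unfolding dilate_def by (intro continuous_intros)

text \<open>\<open>AE_boundary_measure_slices\<close> demands a measurable set, so Fatou's theorem
  on the slices can be integrated to a statement about the boundary measure only after this.\<close>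

lemma sets_radial_limit_exists:
  fixes f :: "complex^'n::{finite,linorder} \<Rightarrow> complex"
  assumes f: "continuous_on (theta m t ` polydisc) f"
  shows "{q \<in> theta m t ` torus. \<exists>l. ((\<lambda>r. f (dilate m t r q)) \<longlongrightarrow> l) (at_left (1::real))}
    \<in> sets (restrict_space borel (theta m t ` torus))"
proof -
  let ?M = "restrict_space borel (theta m t ` torus) :: ((complex, 'n) vec) measure"
  have c: "continuous_on {0<..<1} (\<lambda>r. f (dilate m t r q))" if "q \<in> theta m t ` torus" for q
    by (rule continuous_on_compose2[OF f continuous_dilate_r]) (use that in \<open>auto intro!: dilate_in_domain\<close>)
  have meas: "(\<lambda>q. f (dilate m t a q)) \<in> borel_measurable ?M" if "0 < a" "a < 1" for a :: real
    by (intro borel_measurable_continuous_on_restrict continuous_on_compose2[OF f continuous_dilate])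
      (use that in \<open>auto intro!: dilate_in_domain\<close>)
  have pos: "0 < x" if "1 - 1 / (real N + 1) < x" for x N
  proof -
    have "1 / (real N + 1) \<le> 1" by simp
    then show ?thesis using that by linarith
  qed
  let ?P = "\<lambda>(n::nat) (N::nat) (a::rat) (b::rat) q. of_rat a \<in> {1 - 1 / (real N + 1)<..<1} \<and> of_rat b \<in> {1 - 1 / (real N + 1)<..<1}
      \<longrightarrow> dist (f (dilate m t (of_rat a) q)) (f (dilate m t (of_rat b) q)) \<le> 1 / (real n + 1)"
  have P[measurable]: "Measurable.pred ?M (?P n N a b)" for n N a b
  proof (cases "of_rat a \<in> {1 - 1 / (real N + 1)<..<1} \<and> of_rat b \<in> {1 - 1 / (real N + 1)<..<1}")
    case True
    then have ab: "real_of_rat a \<in> {0<..<1}" "real_of_rat b \<in> {0<..<1}"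
      using pos unfolding greaterThanLessThan_iff by blast+
    have m: "(\<lambda>q. f (dilate m t c q)) \<in> borel_measurable ?M" if "c \<in> {0<..<1}" for c
      using that by (intro meas) (simp_all only: greaterThanLessThan_iff)
    have "Measurable.pred ?M (\<lambda>q. dist (f (dilate m t (of_rat a) q)) (f (dilate m t (of_rat b) q)) \<le> 1 / (real n + 1))"
      unfolding pred_def
      by (rule borel_measurable_le[OF borel_measurable_dist[OF m[OF ab(1)] m[OF ab(2)]] borel_measurable_const])
    moreover have eq: "(\<lambda>q. ?P n N a b q) = (\<lambda>q. dist (f (dilate m t (of_rat a) q)) (f (dilate m t (of_rat b) q)) \<le> 1 / (real n + 1))"
      by (rule ext) (use True in blast)
    ultimately show ?thesis by (intro ssubst[OF eq, of "Measurable.pred ?M"])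
  next
    case False
    then have eq: "(\<lambda>q. ?P n N a b q) = (\<lambda>_. True)" by blast
    have "Measurable.pred ?M (\<lambda>_. True)" by measurable
    then show ?thesis by (intro ssubst[OF eq, of "Measurable.pred ?M"])
  qed
  have "{q \<in> theta m t ` torus. \<exists>l. ((\<lambda>r. f (dilate m t r q)) \<longlongrightarrow> l) (at_left (1::real))} =
      {q \<in> space ?M. \<forall>n. \<exists>N. \<forall>a b. ?P n N a b q}"
  proof (intro Collect_cong conj_cong)
    show "q \<in> theta m t ` torus \<longleftrightarrow> q \<in> space ?M" for q :: "(complex, 'n) vec"
      by (simp add: space_restrict_space)
    show "(\<exists>l. ((\<lambda>r. f (dilate m t r q)) \<longlongrightarrow> l) (at_left (1::real))) \<longleftrightarrow> (\<forall>n. \<exists>N. \<forall>a b. ?P n N a b q)"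
      if "q \<in> space ?M" for q
      by (rule has_left_limit_iff[OF c]) (use that in \<open>simp add: space_restrict_space\<close>)
  qed
  also have "\<dots> \<in> sets ?M" by measurable
  finally show ?thesis .
qed

lemma dilate_theta_slice:
  fixes z :: "complex^'n::{finite,linorder}"
  shows "dilate m t r (theta m t (c *s z)) = theta m t ((of_real r * c) *s z)"
  by (simp add: vec.scale_scale flip: theta_dilate)

theorem radial_limit_AE:
  fixes f :: "complex^'n::{finite,linorder} \<Rightarrow> complex"
  assumes f: "f \<in> carrier (Hinf (theta m t ` polydisc))"
  shows "AE q in boundary_measure m t. \<exists>l. ((\<lambda>r. f (dilate m t r q)) \<longlongrightarrow> l) (at_left (1::real))"
proof -
  have hol: "holomorphic_vec_on f (theta m t ` polydisc)" using f by (simp add: carrier_Hinf)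
  obtain B where B: "\<And>z. z \<in> theta m t ` polydisc \<Longrightarrow> norm (f z) \<le> B" using Hinf_bound[OF f] by blast
  have "AE s in lborel. \<exists>l. ((\<lambda>r. f (theta m t ((of_real r * cis (2 * pi * s)) *s z))) \<longlongrightarrow> l) (at_left (1::real))"
    if z: "z \<in> torus" for z
    by (rule Fatou_radial_limit[OF slice_holomorphic[OF hol z], of B])
      (use polydisc_scale_torus[OF _ z] B in auto)
  then show ?thesis
    by (subst AE_boundary_measure_slices[OF sets_radial_limit_exists[OF holomorphic_vec_on_imp_continuous_on[OF hol]]])
      (simp add: dilate_theta_slice)
qed

lemma boundary_fun_bound:
  fixes f :: "complex^'n::{finite,linorder} \<Rightarrow> complex"
  assumes B: "\<And>z. z \<in> theta m t ` polydisc \<Longrightarrow> norm (f z) \<le> B"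
    and q: "q \<in> theta m t ` torus" and l: "((\<lambda>r. f (dilate m t r q)) \<longlongrightarrow> l) (at_left (1::real))"
  shows "norm l \<le> B"
proof (rule tendsto_upperbound[OF tendsto_norm[OF l]])
  have "eventually (\<lambda>r::real. r \<in> {0<..<1}) (at_left 1)"
    by (rule eventually_at_left_real) simp
  then show "eventually (\<lambda>r. norm (f (dilate m t r q)) \<le> B) (at_left (1::real))"
    by eventually_elim (intro B dilate_in_domain q, auto)
qed simp

text \<open>A measurable boundary function is the limit along one fixed sequence of radii.
  \<open>lim\<close> is total, so the function is defined everywhere, and it agrees with the radial
  limit wherever that exists.\<close>

lemma boundary_fun_nonempty:
  fixes f :: "complex^'n::{finite,linorder} \<Rightarrow> complex"
  assumes f: "f \<in> carrier (Hinf (theta m t ` polydisc))"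
  shows "boundary_fun m t f \<noteq> {}"
proof -
  let ?M = "boundary_measure m t :: ((complex, 'n) vec) measure"
  have hol: "holomorphic_vec_on f (theta m t ` polydisc)" using f by (simp add: carrier_Hinf)
  obtain B where B: "B \<ge> 0" "\<And>z. z \<in> theta m t ` polydisc \<Longrightarrow> norm (f z) \<le> B" using Hinf_bound[OF f] by blast
  define r where "r n = 1 - 1 / (real n + 2)" for n
  have r: "0 < r n" "r n < 1" for n by (auto simp: r_def field_simps)
  have r_lim: "r \<longlonglongrightarrow> 1" unfolding r_def by real_asymp
  have r_left: "filterlim r (at_left 1) sequentially"
    unfolding filterlim_at using r r_lim by (auto intro!: always_eventually) (metis less_irrefl)
  define h where "h q = lim (\<lambda>n. f (dilate m t (r n) q))" for q
  have "(\<lambda>q. f (dilate m t (r n) q)) \<in> borel_measurable (restrict_space borel (theta m t ` torus))" for n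
    by (intro borel_measurable_continuous_on_restrict
        continuous_on_compose2[OF holomorphic_vec_on_imp_continuous_on[OF hol] continuous_dilate])
      (use r in \<open>auto simp: less_imp_le intro!: dilate_in_domain\<close>)
  then have [measurable]: "(\<lambda>q. f (dilate m t (r n) q)) \<in> borel_measurable ?M" for n
    by (simp add: sets_boundary_measure cong: measurable_cong_sets)
  have hm: "h \<in> borel_measurable ?M" unfolding h_def by measurable
  have lim: "AE q in ?M. ((\<lambda>r. f (dilate m t r q)) \<longlongrightarrow> h q) (at_left 1)"
    using radial_limit_AE[OF f]
  proof eventually_elim
    case (elim q)
    then obtain l where l: "((\<lambda>r. f (dilate m t r q)) \<longlongrightarrow> l) (at_left 1)" ..
    have "(\<lambda>n. f (dilate m t (r n) q)) \<longlonglongrightarrow> l" by (rule filterlim_compose[OF l r_left])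
    then have "h q = l" unfolding h_def by (rule limI)
    with l show ?case by simp
  qed
  have "AE q in ?M. q \<in> space ?M" by (rule AE_space)
  with lim have "AE q in ?M. norm (h q) \<le> B"
    by eventually_elim (auto simp: space_boundary_measure intro!: boundary_fun_bound[OF B(2)])
  then have "h \<in> boundary_fun m t f"
    using hm lim by (auto simp: boundary_fun_def intro: ess_boundedI)
  then show ?thesis by blast
qed

lemma boundary_fun_eq_Linf_class:
  fixes f :: "complex^'n::{finite,linorder} \<Rightarrow> complex"
  assumes h: "h \<in> boundary_fun m t f"
  shows "boundary_fun m t f = Linf_class (boundary_measure m t) h"
proof -
  have lim: "AE q in boundary_measure m t. ((\<lambda>r. f (dilate m t r q)) \<longlongrightarrow> h q) (at_left (1::real))"
    using h by (simp add: boundary_fun_def)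
  have "(AE q in boundary_measure m t. ((\<lambda>r. f (dilate m t r q)) \<longlongrightarrow> g q) (at_left (1::real))) \<longleftrightarrow>
      (AE q in boundary_measure m t. g q = h q)" for g
  proof
    assume "AE q in boundary_measure m t. ((\<lambda>r. f (dilate m t r q)) \<longlongrightarrow> g q) (at_left (1::real))"
    with lim show "AE q in boundary_measure m t. g q = h q"
      by eventually_elim (rule tendsto_unique[OF trivial_limit_at_left_real])
  next
    assume "AE q in boundary_measure m t. g q = h q"
    with lim show "AE q in boundary_measure m t. ((\<lambda>r. f (dilate m t r q)) \<longlongrightarrow> g q) (at_left (1::real))"
      by eventually_elim simp
  qed
  then show ?thesis by (simp add: boundary_fun_def Linf_class_def)
qed

lemma boundary_fun_ess_bounded: "h \<in> boundary_fun m t f \<Longrightarrow> h \<in> ess_bounded (boundary_measure m t)"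
  by (simp add: boundary_fun_def)

lemma boundary_fun_in_carrier:
  fixes f :: "complex^'n::{finite,linorder} \<Rightarrow> complex"
  assumes f: "f \<in> carrier (Hinf (theta m t ` polydisc))"
  shows "boundary_fun m t f \<in> carrier (Linf (boundary_measure m t))"
proof -
  obtain h where h: "h \<in> boundary_fun m t f" using boundary_fun_nonempty[OF f] by blast
  show ?thesis unfolding boundary_fun_eq_Linf_class[OF h]
    by (rule Linf_class_in_carrier[OF boundary_fun_ess_bounded[OF h]])
qed

text \<open>Dilates of boundary points lie in the domain, so the restrictions to the domain in the
  operations of \<open>Hinf\<close> do not affect radial limits.\<close>

lemma boundary_funI:
  fixes f g :: "complex^'n::{finite,linorder} \<Rightarrow> complex"
  assumes h: "h \<in> ess_bounded (boundary_measure m t)"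
    and lim: "AE q in boundary_measure m t. ((\<lambda>r. g (dilate m t r q)) \<longlongrightarrow> h q) (at_left (1::real))"
    and fg: "\<And>z. z \<in> theta m t ` polydisc \<Longrightarrow> f z = g z"
  shows "h \<in> boundary_fun m t f"
proof -
  have "AE q in boundary_measure m t. q \<in> theta m t ` torus"
    using AE_space[of "boundary_measure m t"] by (simp add: space_boundary_measure)
  with lim have "AE q in boundary_measure m t. ((\<lambda>r. f (dilate m t r q)) \<longlongrightarrow> h q) (at_left (1::real))"
  proof eventually_elim
    case (elim q)
    have "eventually (\<lambda>r::real. r \<in> {0<..<1}) (at_left 1)"
      by (rule eventually_at_left_real) simp
    then have "eventually (\<lambda>r. g (dilate m t r q) = f (dilate m t r q)) (at_left (1::real))"
    proof eventually_elim
      case (elim r)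
      then have "dilate m t r q \<in> theta m t ` polydisc"
        using \<open>q \<in> theta m t ` torus\<close> by (intro dilate_in_domain) auto
      then show ?case by (rule fg[symmetric])
    qed
    then show ?case by (rule Lim_transform_eventually[OF elim(1)])
  qed
  with h show ?thesis by (simp add: boundary_fun_def)
qed

section \<open>The restriction map from characters of bounded measurable to characters of bounded
  holomorphic functions\<close>

theorem tau1_character:
  fixes \<phi> :: "(complex^'n::{finite,linorder} \<Rightarrow> complex) set \<Rightarrow> complex"
  assumes \<phi>: "\<phi> \<in> characters (Linf (boundary_measure m t))"
  shows "tau1 m t \<phi> \<in> characters (Hinf (theta m t ` (polydisc :: ((complex, 'n) vec) set)))"
  unfolding characters_def
proof (intro CollectI conjI ballI allI)
  let ?\<Omega> = "theta m t ` (polydisc :: ((complex, 'n) vec) set)"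
  let ?M = "boundary_measure m t :: ((complex, 'n) vec) measure"
  note simps = Linf_character_simps[OF \<phi>]
  have tau: "tau1 m t \<phi> f = \<phi> (Linf_class ?M h)"
    if "f \<in> carrier (Hinf ?\<Omega>)" "h \<in> boundary_fun m t f" for f h
    using that boundary_fun_eq_Linf_class[OF that(2)] by (simp add: tau1_def)
  show "tau1 m t \<phi> \<in> extensional (carrier (Hinf ?\<Omega>))" by (simp add: tau1_def)
  have "(\<lambda>_. 1) \<in> boundary_fun m t (\<lambda>z\<in>?\<Omega>. 1)"
    by (rule boundary_funI[where g = "\<lambda>_. 1"]) (auto intro: ess_bounded_const)
  then show "tau1 m t \<phi> \<one>\<^bsub>Hinf ?\<Omega>\<^esub> = 1"
    using tau[OF Hinf_one_closed] simps(1) by (simp add: Hinf_simps)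
  fix f assume f: "f \<in> carrier (Hinf ?\<Omega>)"
  obtain h where h: "h \<in> boundary_fun m t f" using boundary_fun_nonempty[OF f] by blast
  have lim: "AE q in ?M. ((\<lambda>r. f (dilate m t r q)) \<longlongrightarrow> h q) (at_left (1::real))"
    using h by (simp add: boundary_fun_def)
  note hb = boundary_fun_ess_bounded[OF h]
  show "tau1 m t \<phi> (c \<odot>\<^bsub>Hinf ?\<Omega>\<^esub> f) = c * tau1 m t \<phi> f" for c
  proof -
    have "(\<lambda>q. c * h q) \<in> boundary_fun m t (\<lambda>z\<in>?\<Omega>. c * f z)"
    proof (rule boundary_funI[where g = "\<lambda>z. c * f z"])
      show "AE q in ?M. ((\<lambda>r. c * f (dilate m t r q)) \<longlongrightarrow> c * h q) (at_left (1::real))"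
        using lim by eventually_elim (intro tendsto_intros)
    qed (auto intro: ess_bounded_mult[OF ess_bounded_const] hb)
    then show ?thesis
      using tau[OF Hinf_smult_closed[OF f, of c]] tau[OF f h] simps(4)[OF hb] by (simp add: Hinf_simps)
  qed
  fix g assume g: "g \<in> carrier (Hinf ?\<Omega>)"
  obtain k where k: "k \<in> boundary_fun m t g" using boundary_fun_nonempty[OF g] by blast
  have limg: "AE q in ?M. ((\<lambda>r. g (dilate m t r q)) \<longlongrightarrow> k q) (at_left (1::real))"
    using k by (simp add: boundary_fun_def)
  note kb = boundary_fun_ess_bounded[OF k]
  have "(\<lambda>q. h q + k q) \<in> boundary_fun m t (\<lambda>z\<in>?\<Omega>. f z + g z)"
  proof (rule boundary_funI[where g = "\<lambda>z. f z + g z"])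
    show "AE q in ?M. ((\<lambda>r. f (dilate m t r q) + g (dilate m t r q)) \<longlongrightarrow> h q + k q) (at_left (1::real))"
      using lim limg by eventually_elim (intro tendsto_intros)
  qed (auto intro: ess_bounded_add hb kb)
  then show "tau1 m t \<phi> (f \<oplus>\<^bsub>Hinf ?\<Omega>\<^esub> g) = tau1 m t \<phi> f + tau1 m t \<phi> g"
    using tau[OF Hinf_add_closed[OF f g]] tau[OF f h] tau[OF g k] simps(2)[OF hb kb] by (simp add: Hinf_simps)
  have "(\<lambda>q. h q * k q) \<in> boundary_fun m t (\<lambda>z\<in>?\<Omega>. f z * g z)"
  proof (rule boundary_funI[where g = "\<lambda>z. f z * g z"])
    show "AE q in ?M. ((\<lambda>r. f (dilate m t r q) * g (dilate m t r q)) \<longlongrightarrow> h q * k q) (at_left (1::real))"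
      using lim limg by eventually_elim (intro tendsto_intros)
  qed (auto intro: ess_bounded_mult hb kb)
  then show "tau1 m t \<phi> (f \<otimes>\<^bsub>Hinf ?\<Omega>\<^esub> g) = tau1 m t \<phi> f * tau1 m t \<phi> g"
    using tau[OF Hinf_mult_closed[OF f g]] tau[OF f h] tau[OF g k] simps(3)[OF hb kb] by (simp add: Hinf_simps)
qed

theorem continuous_map_tau1:
  "continuous_map (maximal_ideal_space (Linf (boundary_measure m t :: ((complex, 'n::{finite,linorder}) vec) measure)))
     (maximal_ideal_space (Hinf (theta m t ` polydisc))) (tau1 m t)"
proof -
  let ?X = "maximal_ideal_space (Linf (boundary_measure m t :: ((complex, 'n) vec) measure))"
  let ?\<Omega> = "theta m t ` (polydisc :: ((complex, 'n) vec) set)"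
  have im: "tau1 m t ` topspace ?X \<subseteq> characters (Hinf ?\<Omega>)"
    using tau1_character by (auto simp: topspace_maximal_ideal_space)
  have "continuous_map ?X (product_topology (\<lambda>_. euclidean) (carrier (Hinf ?\<Omega>))) (tau1 m t)"
    unfolding continuous_map_componentwise
  proof (intro conjI ballI)
    show "tau1 m t ` topspace ?X \<subseteq> extensional (carrier (Hinf ?\<Omega>))"
      by (auto simp: tau1_def)
    fix f assume f: "f \<in> carrier (Hinf ?\<Omega>)"
    have "continuous_map ?X euclidean (\<lambda>\<phi>. \<phi> (boundary_fun m t f))"
      by (rule continuous_map_evaluation[OF boundary_fun_in_carrier[OF f]])
    then show "continuous_map ?X euclidean (\<lambda>\<phi>. tau1 m t \<phi> f)"
      using f by (simp add: tau1_def)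
  qed
  then show ?thesis
    unfolding maximal_ideal_space_def[of "Hinf ?\<Omega>"]
    using im by (intro continuous_map_into_subtopology) (auto simp: image_subset_iff_funcset)
qed

section \<open>Sets of boundary points that determine the norm\<close>

lemma norm_moebius_le_1:
  assumes a: "norm a < 1" and w: "norm w \<le> 1"
  shows "norm ((w + a) / (1 + cnj a * w)) \<le> 1" "norm w = 1 \<Longrightarrow> norm ((w + a) / (1 + cnj a * w)) = 1"
    "1 + cnj a * w \<noteq> 0"
proof -
  have "norm (cnj a * w) < 1"
    using mult_mono[OF order_refl w, of "norm a"] a by (simp add: norm_mult)
  then have nz: "1 + cnj a * w \<noteq> 0"
    by (metis add.commute add_eq_0_iff less_irrefl norm_minus_cancel norm_one)
  have id: "(norm (1 + cnj a * w))\<^sup>2 - (norm (w + a))\<^sup>2 = (1 - (norm a)\<^sup>2) * (1 - (norm w)\<^sup>2)"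
  proof -
    have "complex_of_real ((norm (1 + cnj a * w))\<^sup>2 - (norm (w + a))\<^sup>2) = of_real ((1 - (norm a)\<^sup>2) * (1 - (norm w)\<^sup>2))"
      unfolding of_real_diff of_real_mult complex_norm_square of_real_1
      by (simp add: algebra_simps)
    then show ?thesis by (simp only: of_real_eq_iff)
  qed
  have a2: "0 < 1 - (norm a)\<^sup>2" using a by (simp add: abs_square_less_1)
  have "(norm w)\<^sup>2 \<le> 1" using w by (simp add: abs_square_le_1)
  with a2 have "0 \<le> (1 - (norm a)\<^sup>2) * (1 - (norm w)\<^sup>2)" by (intro mult_nonneg_nonneg) auto
  then have "(norm (w + a))\<^sup>2 \<le> (norm (1 + cnj a * w))\<^sup>2" using id by linarith
  then have "norm (w + a) \<le> norm (1 + cnj a * w)" by (simp add: power2_le_iff_abs_le)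
  then show "norm ((w + a) / (1 + cnj a * w)) \<le> 1" using nz by (simp add: norm_divide divide_le_eq)
  show "norm ((w + a) / (1 + cnj a * w)) = 1" if "norm w = 1"
  proof -
    have "(norm (w + a))\<^sup>2 = (norm (1 + cnj a * w))\<^sup>2" using id that by simp
    then have "norm (w + a) = norm (1 + cnj a * w)" by (metis norm_ge_zero power2_eq_imp_eq)
    then show ?thesis using nz by (simp add: norm_divide)
  qed
  show "1 + cnj a * w \<noteq> 0" by (rule nz)
qed

text \<open>The analytic disc \<open>w \<mapsto> (\<rho> (w + a\<^sub>i) / (1 + cnj a\<^sub>i w))\<^sub>i\<close> passes through \<open>z\<close> for \<open>a = z / \<rho>\<close>,
  and its boundary lies in the dilated torus.\<close>

lemma polydisc_maximum_modulus:
  fixes z :: "complex^'n::{finite,linorder}"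
  assumes f: "holomorphic_vec_on f (theta m t ` polydisc)" and z: "z \<in> polydisc"
  obtains \<rho> \<zeta> where "0 < \<rho>" "\<rho> < 1" "\<zeta> \<in> torus" "norm (f (theta m t z)) \<le> norm (f (theta m t (of_real \<rho> *s \<zeta>)))"
proof -
  define s where "s = Max (range (\<lambda>i. norm (z $ i)))"
  have "s \<in> range (\<lambda>i. norm (z $ i))" unfolding s_def by (rule Max_in) auto
  then have s1: "0 \<le> s" "s < 1" using z by (auto simp: polydisc_def)
  have sz: "norm (z $ i) \<le> s" for i unfolding s_def by (rule Max_ge) auto
  \<comment> \<open>Any value strictly between \<open>s\<close> and 1 would do:
    \<open>s < \<rho>\<close> puts the points \<open>a i\<close> into the unit disc, and
    \<open>\<rho> < 1\<close> keeps the closed analytic disc in the polydisc.\<close>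
  define \<rho> where "\<rho> = (1 + s) / 2"
  have \<rho>: "0 < \<rho>" "\<rho> < 1" "s < \<rho>" using s1 by (auto simp: \<rho>_def)
  define a where "a i = z $ i / of_real \<rho>" for i
  have a: "norm (a i) < 1" for i
    using sz[of i] \<rho> by (simp add: a_def norm_divide)
  define \<gamma> where "\<gamma> w = (\<chi> i. of_real \<rho> * ((w + a i) / (1 + cnj (a i) * w)))" for w
  have \<gamma>0: "\<gamma> 0 = z" using \<rho> by (simp add: \<gamma>_def a_def vec_eq_iff)
  have \<gamma>p: "\<gamma> w \<in> polydisc" if "w \<in> cball 0 1" for w
  proof -
    have "\<rho> * norm ((w + a i) / (1 + cnj (a i) * w)) \<le> \<rho> * 1" for i
      using that \<rho> a by (intro mult_left_mono norm_moebius_le_1) auto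
    then have "norm (of_real \<rho> * ((w + a i) / (1 + cnj (a i) * w))) < 1" for i
      using \<rho> unfolding norm_mult norm_of_real by (metis abs_of_pos le_less_trans mult.right_neutral)
    then show ?thesis unfolding polydisc_def \<gamma>_def mem_Collect_eq vec_lambda_beta by blast
  qed
  have nz: "1 + cnj (a i) * w \<noteq> 0" if "w \<in> cball 0 1" for w i
    using that a[of i] by (intro norm_moebius_le_1(3)) auto
  let ?g = "\<lambda>w. f (theta m t (\<gamma> w))"
  have hol: "?g holomorphic_on ball 0 1"
  proof (rule holomorphic_on_compose_vec[OF f])
    show "(\<lambda>w. theta m t (\<gamma> w) $ i) holomorphic_on ball 0 1" for i
      by (rule holomorphic_theta) (use nz in \<open>auto simp: \<gamma>_def intro!: holomorphic_intros\<close>)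
  qed (use \<gamma>p in auto)
  have cont: "continuous_on (cball 0 1) ?g"
  proof (rule continuous_on_compose2[OF holomorphic_vec_on_imp_continuous_on[OF f]])
    show "continuous_on (cball 0 1) (\<lambda>w. theta m t (\<gamma> w))"
      by (rule continuous_on_compose2[OF continuous_theta[of UNIV]])
        (use nz in \<open>auto simp: \<gamma>_def intro!: continuous_intros\<close>)
  qed (use \<gamma>p in auto)
  have "continuous_on (sphere 0 1) (\<lambda>w. norm (?g w))"
    by (intro continuous_on_norm continuous_on_subset[OF cont]) auto
  then obtain w0 where w0: "w0 \<in> sphere 0 1" "\<And>w. w \<in> sphere 0 1 \<Longrightarrow> norm (?g w) \<le> norm (?g w0)"
    using continuous_attains_sup[of "sphere (0::complex) 1" "\<lambda>w. norm (?g w)"] by auto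
  have "norm (?g 0) \<le> norm (?g w0)"
  proof (rule maximum_modulus_frontier[of ?g "cball 0 1"])
    show "norm (?g w) \<le> norm (?g w0)" if "w \<in> frontier (cball 0 1)" for w
      using that by (intro w0(2)) simp
  qed (use hol cont in auto)
  moreover define \<zeta> where "\<zeta> = (\<chi> i. (w0 + a i) / (1 + cnj (a i) * w0))"
  have "\<zeta> \<in> torus"
    using w0(1) a norm_moebius_le_1(2)[of "a _" w0] by (simp add: torus_def \<zeta>_def)
  moreover have "\<gamma> w0 = of_real \<rho> *s \<zeta>" by (simp add: \<gamma>_def \<zeta>_def vec_eq_iff)
  ultimately show ?thesis using that[of \<rho> \<zeta>] \<rho> \<gamma>0 by simp
qed

lemma measurable_slice:
  fixes z :: "complex^'n::{finite,linorder}"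
  assumes z: "z \<in> torus"
  shows "(\<lambda>s. theta m t (cis (2 * pi * s) *s z)) \<in> measurable borel (restrict_space borel (theta m t ` torus))"
proof -
  have "continuous_on UNIV (\<lambda>s. cis (2 * pi * s) *s z)"
    unfolding vector_scalar_mult_def by (intro continuous_intros)
  then have "continuous_on UNIV (\<lambda>s. theta m t (cis (2 * pi * s) *s z))"
    by (rule continuous_on_compose2[OF continuous_theta[of UNIV]]) auto
  moreover have "theta m t (cis (2 * pi * s) *s z) \<in> theta m t ` torus" for s
    by (rule imageI) (use z in \<open>simp add: torus_def norm_mult\<close>)
  ultimately show ?thesis
    by (intro measurable_restrict_space2 borel_measurable_continuous_onI) auto
qed

text \<open>\<open>h\<close> matters only up to null sets, while a single slice is itself a null
  set; for almost every slice its restriction is nevertheless the radial limit. \<open>R\<close>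
  carries a further almost everywhere property over to the same slices.\<close>

lemma boundary_fun_slices:
  fixes f h :: "complex^'n::{finite,linorder} \<Rightarrow> complex"
  assumes h: "h \<in> boundary_fun m t f" and R: "AE q in boundary_measure m t. R q"
  shows "AE x in lborel. \<exists>hs\<in>borel_measurable borel. AE s in (lborel :: real measure).
    hs s = h (theta m t (cis (2 * pi * s) *s torus_point x)) \<and>
    ((\<lambda>r. f (theta m t ((of_real r * cis (2 * pi * s)) *s torus_point x))) \<longlongrightarrow> hs s) (at_left (1::real)) \<and>
    R (theta m t (cis (2 * pi * s) *s torus_point x))"
proof -
  let ?M = "boundary_measure m t :: ((complex, 'n) vec) measure"
  have hb: "h \<in> borel_measurable ?M" using h by (simp add: boundary_fun_def ess_bounded_def)
  have lim: "AE q in ?M. ((\<lambda>r. f (dilate m t r q)) \<longlongrightarrow> h q) (at_left (1::real))"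
    using h by (simp add: boundary_fun_def)
  \<comment> \<open>The exceptional null set may be enlarged to a measurable one, for which the slices make sense.\<close>
  have "AE q in ?M. ((\<lambda>r. f (dilate m t r q)) \<longlongrightarrow> h q) (at_left (1::real)) \<and> R q"
    using lim R by eventually_elim simp
  then obtain N where N: "N \<in> null_sets ?M"
      "{q \<in> space ?M. \<not> (((\<lambda>r. f (dilate m t r q)) \<longlongrightarrow> h q) (at_left (1::real)) \<and> R q)} \<subseteq> N"
    unfolding eventually_ae_filter by blast
  have good: "((\<lambda>r. f (dilate m t r q)) \<longlongrightarrow> h q) (at_left (1::real)) \<and> R q"
    if "q \<in> theta m t ` torus" "q \<notin> N" for q
    using N(2) that by (auto simp: space_boundary_measure)
  have Nm: "{q \<in> theta m t ` torus. q \<notin> N} \<in> sets (restrict_space borel (theta m t ` torus))"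
  proof -
    have "N \<in> sets ?M" using N(1) by auto
    then have "space ?M - N \<in> sets ?M" by auto
    also have "space ?M - N = {q \<in> theta m t ` torus. q \<notin> N}" by (auto simp: space_boundary_measure)
    finally show ?thesis by (simp add: sets_boundary_measure)
  qed
  have "AE q in ?M. q \<notin> N" using N(1) by (rule AE_not_in)
  then have "AE x in lborel. AE s in (lborel :: real measure). theta m t (cis (2 * pi * s) *s torus_point x) \<notin> N"
    by (simp only: AE_boundary_measure_slices[OF Nm])
  then show ?thesis
  proof eventually_elim
    case (elim x)
    define hs where "hs s = h (theta m t (cis (2 * pi * s) *s torus_point x))" for s
    have cs: "theta m t (cis (2 * pi * s) *s torus_point x) \<in> theta m t ` torus" for s
      by (rule imageI) (simp add: torus_def norm_mult)
    have "(\<lambda>s. theta m t (cis (2 * pi * s) *s torus_point x)) \<in> measurable borel ?M"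
      using measurable_slice[OF torus_point_in_torus] by (simp add: sets_boundary_measure cong: measurable_cong_sets)
    then have "hs \<in> borel_measurable borel" unfolding hs_def by (rule measurable_compose[OF _ hb])
    moreover have "AE s in lborel. hs s = h (theta m t (cis (2 * pi * s) *s torus_point x)) \<and>
      ((\<lambda>r. f (theta m t ((of_real r * cis (2 * pi * s)) *s torus_point x))) \<longlongrightarrow> hs s) (at_left (1::real)) \<and>
      R (theta m t (cis (2 * pi * s) *s torus_point x))"
      using elim
    proof eventually_elim
      case (elim s)
      then show ?case using good[OF cs elim] by (simp add: hs_def dilate_theta_slice)
    qed
    ultimately show ?case by blast
  qed
qed

theorem norm_determined_by_invariant_set:
  fixes f h :: "complex^'n::{finite,linorder} \<Rightarrow> complex"
  assumes f: "f \<in> carrier (Hinf (theta m t ` polydisc))" and h: "h \<in> boundary_fun m t f"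
    and K: "K \<subseteq> theta m t ` torus" "K \<in> sets (restrict_space borel (theta m t ` torus))"
    and openK: "open {x. theta m t (torus_point x) \<in> K}"
    and denseK: "\<And>U. open U \<Longrightarrow> U \<noteq> {} \<Longrightarrow> \<exists>x\<in>U. theta m t (torus_point x) \<in> K"
    and invK: "\<And>c z. norm c = 1 \<Longrightarrow> z \<in> torus \<Longrightarrow> theta m t z \<in> K \<Longrightarrow> theta m t (c *s z) \<in> K"
    and AE: "AE q in boundary_measure m t. q \<in> K \<longrightarrow> norm (h q) \<le> c"
    and z: "z \<in> theta m t ` polydisc"
  shows "norm (f z) \<le> c"
proof (rule ccontr)
  let ?M = "boundary_measure m t :: ((complex, 'n) vec) measure"
  assume "\<not> norm (f z) \<le> c"
  have hol: "holomorphic_vec_on f (theta m t ` polydisc)" using f by (simp add: carrier_Hinf)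
  obtain B where B: "\<And>z. z \<in> theta m t ` polydisc \<Longrightarrow> norm (f z) \<le> B" using Hinf_bound[OF f] by blast
  obtain z' where z': "z' \<in> polydisc" "z = theta m t z'" using z by blast
  obtain \<rho> \<zeta> where \<rho>: "0 < \<rho>" "\<rho> < 1" "\<zeta> \<in> torus" "norm (f (theta m t z')) \<le> norm (f (theta m t (of_real \<rho> *s \<zeta>)))"
    using polydisc_maximum_modulus[OF hol z'(1)] by blast
  then have gt: "c < norm (f (theta m t (of_real \<rho> *s \<zeta>)))" using \<open>\<not> norm (f z) \<le> c\<close> z'(2) by simp
  obtain x0 where x0: "\<zeta> = torus_point x0" using torus_point_surj[OF \<rho>(3)] by blast
  let ?v = "\<lambda>x. norm (f (theta m t (of_real \<rho> *s torus_point x)))"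
  have "continuous_on UNIV ?v"
  proof (intro continuous_on_norm continuous_on_compose2[OF holomorphic_vec_on_imp_continuous_on[OF hol]]
      continuous_on_compose2[OF continuous_theta[of UNIV]])
    show "continuous_on UNIV (\<lambda>x. of_real \<rho> *s torus_point x)"
      unfolding torus_point_def vector_scalar_mult_def by (intro continuous_intros)
  qed (use \<rho> in \<open>auto intro!: imageI polydisc_scale_torus\<close>)
  then have "open {x. c < ?v x}" by (rule open_Collect_less[OF continuous_on_const])
  then have oU: "open ({x. c < ?v x} \<inter> {x. theta m t (torus_point x) \<in> K})" using openK by (rule open_Int)
  have ne: "{x. c < ?v x} \<inter> {x. theta m t (torus_point x) \<in> K} \<noteq> {}"
    using denseK[OF \<open>open {x. c < ?v x}\<close>] gt x0 by blast
  note slices = boundary_fun_slices[OF h AE]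
  let ?S = "\<lambda>x. \<exists>hs\<in>borel_measurable borel. AE s in (lborel :: real measure).
    hs s = h (theta m t (cis (2 * pi * s) *s torus_point x)) \<and>
    ((\<lambda>r. f (theta m t ((of_real r * cis (2 * pi * s)) *s torus_point x))) \<longlongrightarrow> hs s) (at_left (1::real)) \<and>
    (theta m t (cis (2 * pi * s) *s torus_point x) \<in> K \<longrightarrow> norm (h (theta m t (cis (2 * pi * s) *s torus_point x))) \<le> c)"
  \<comment> \<open>A non-empty open set is not a null set and so meets the slices on which
    \<open>h\<close> behaves well. Openness and density of \<open>K\<close> are used here in place
    of full measure.\<close>
  have "\<exists>x\<in>{x. c < ?v x} \<inter> {x. theta m t (torus_point x) \<in> K}. ?S x"
  proof (rule ccontr)
    assume neg: "\<not> ?thesis"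
    have "AE x in lborel. x \<notin> {x. c < ?v x} \<inter> {x. theta m t (torus_point x) \<in> K}"
      using slices by eventually_elim (use neg in blast)
    then have "{x. c < ?v x} \<inter> {x. theta m t (torus_point x) \<in> K} \<in> null_sets lborel"
      using oU by (subst AE_iff_null_sets) auto
    then show False using open_not_negligible[OF oU ne] by (simp add: negligible_iff_null_sets null_sets_completionI)
  qed
  then obtain x hs where x: "c < ?v x" "theta m t (torus_point x) \<in> K" and hs: "hs \<in> borel_measurable borel"
    and xs: "AE s in (lborel :: real measure).
    hs s = h (theta m t (cis (2 * pi * s) *s torus_point x)) \<and>
    ((\<lambda>r. f (theta m t ((of_real r * cis (2 * pi * s)) *s torus_point x))) \<longlongrightarrow> hs s) (at_left (1::real)) \<and>
    (theta m t (cis (2 * pi * s) *s torus_point x) \<in> K \<longrightarrow> norm (h (theta m t (cis (2 * pi * s) *s torus_point x))) \<le> c)"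
    by blast
  have "norm (f (theta m t (of_real \<rho> *s torus_point x))) \<le> c"
  proof (rule radial_limit_norm_bound[of "\<lambda>w. f (theta m t (w *s torus_point x))" B hs "of_real \<rho>"])
    show "(\<lambda>w. f (theta m t (w *s torus_point x))) holomorphic_on ball 0 1"
      by (rule slice_holomorphic[OF hol]) simp
    show "norm (f (theta m t (w *s torus_point x))) \<le> B" if "w \<in> ball 0 1" for w
      using that by (intro B imageI polydisc_scale_torus) auto
    show "AE s in lborel. ((\<lambda>r. f (theta m t ((of_real r * cis (2 * pi * s)) *s torus_point x))) \<longlongrightarrow> hs s) (at_left (1::real))"
      using xs by eventually_elim blast
    show "AE s in lborel. norm (hs s) \<le> c"
      using xs
    proof eventually_elim
      case (elim s)
      \<comment> \<open>Invariance puts the whole slice into \<open>K\<close>, so the bound holds at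
        almost all of its boundary points and the maximum principle in one variable applies.\<close>
      have "theta m t (cis (2 * pi * s) *s torus_point x) \<in> K" by (rule invK) (use x in auto)
      then show ?case using elim by metis
    qed
    show "hs \<in> borel_measurable borel" by (rule hs)
  qed (use \<rho> in simp)
  then show False using x(1) by simp
qed

section \<open>A lower semicontinuous function as a sum of polynomial peaks\<close>

text \<open>On \<open>{0..D}\<close> this lies between 0 and 1 and concentrates at \<open>x\<close>
  as \<open>n\<close> grows. It is a polynomial, so it can be homogenized in the coordinates of the
  domain.\<close>

definition peak :: "real \<Rightarrow> real \<Rightarrow> nat \<Rightarrow> real \<Rightarrow> real" where
  "peak D x n y = (1 - ((y - x) / D)\<^sup>2) ^ n"

lemma peak_bounds:
  assumes "D > 0" "x \<in> {0..D}" "y \<in> {0..D}"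
  shows "0 \<le> peak D x n y" "peak D x n y \<le> 1"
proof -
  have "\<bar>(y - x) / D\<bar> \<le> 1" using assms by (auto simp: abs_le_iff field_simps)
  then have "((y - x) / D)\<^sup>2 \<le> 1" by (simp only: abs_square_le_1)
  then show "0 \<le> peak D x n y" "peak D x n y \<le> 1"
    by (auto simp: peak_def power_le_one)
qed

lemma continuous_peak: "continuous_on S (peak D x n)"
  unfolding peak_def divide_inverse by (intro continuous_intros)

lemma peak_self [simp]: "peak D x n x = 1"
  by (simp add: peak_def)

text \<open>If \<open>\<psi> x\<close> is already at least 1, nothing is added. Otherwise \<psi> is
  below 1 near \<open>x\<close>, where adding a narrow peak keeps the sum below 2; elsewhere the
  peak is at most \<open>e\<close>. The exceptional neighbourhood has small measure because
  \<open>x\<close> is not an atom.\<close>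

lemma peak_step:
  fixes \<psi> :: "real \<Rightarrow> real" and \<nu> :: "real measure"
  assumes D: "D > 0" and x: "x \<in> {0..D}" and \<psi>: "continuous_on UNIV \<psi>" and e: "e > 0"
    and \<nu>: "finite_measure \<nu>" "sets \<nu> = sets borel" "measure \<nu> {x} = 0"
  shows "\<exists>a n. a \<in> {0, 1} \<and> (\<forall>y\<in>{0..D}. \<psi> y + a * peak D x n y \<le> max 2 (\<psi> y + e)) \<and>
    \<psi> x + a * peak D x n x \<ge> min 1 (1 + \<psi> x) \<and>
    (\<exists>I\<in>sets borel. measure \<nu> I \<le> e \<and> (\<forall>y\<in>{0..D} - I. a * peak D x n y \<le> e))"
proof (cases "\<psi> x \<ge> 1")
  case True
  then show ?thesis
    using e by (intro exI[of _ 0] exI[of _ 0]) (auto intro!: bexI[of _ "{}"])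
next
  case False
  interpret finite_measure \<nu> by fact
  have "open {y. \<psi> y < 1}" by (rule open_Collect_less[OF \<psi> continuous_on_const])
  moreover have "x \<in> {y. \<psi> y < 1}" using False by simp
  ultimately obtain d where d: "d > 0" "ball x d \<subseteq> {y. \<psi> y < 1}" by (rule openE)
  have "(\<lambda>k. measure \<nu> (ball x (1 / (real k + 1)))) \<longlonglongrightarrow> measure \<nu> (\<Inter>k. ball x (1 / (real k + 1)))"
  proof (rule finite_Lim_measure_decseq)
    have "ball x \<rho> \<in> sets \<nu>" for \<rho> unfolding \<nu>(2) by simp
    then show "range (\<lambda>k. ball x (1 / (real k + 1))) \<subseteq> sets \<nu>" by blast
    show "decseq (\<lambda>k. ball x (1 / (real k + 1)))"
      unfolding decseq_def by (intro allI impI subset_ball) (simp add: frac_le)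
  qed
  also have "(\<Inter>k. ball x (1 / (real k + 1))) = {x}"
  proof -
    have "y = x" if "\<forall>k. dist x y < 1 / (real k + 1)" for y
    proof (rule ccontr)
      assume "y \<noteq> x"
      then have "dist x y > 0" by simp
      then obtain k where "inverse (real (Suc k)) < dist x y" using reals_Archimedean by blast
      moreover have "dist x y < 1 / (real k + 1)" using that by blast
      ultimately show False by (simp add: inverse_eq_divide add.commute)
    qed
    then show ?thesis by auto
  qed
  finally have "eventually (\<lambda>k. measure \<nu> (ball x (1 / (real k + 1))) < e) sequentially"
    using e \<nu>(3) by (intro order_tendstoD(2)[where y = "measure \<nu> {x}"]) auto
  then obtain k where k: "measure \<nu> (ball x (1 / (real k + 1))) < e"
    using eventually_happens sequentially_bot by blast
  \<comment> \<open>The first bound keeps \<psi> below 1 on the ball, the second keeps the measure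
    of the ball small, and the third makes \<open>q\<close> below non-negative.\<close>
  define r where "r = min (min d (1 / (real k + 1))) D"
  have r: "0 < r" "r \<le> D" using d(1) D by (auto simp: r_def)
  have I: "measure \<nu> (ball x r) \<le> e"
  proof -
    have "measure \<nu> (ball x r) \<le> measure \<nu> (ball x (1 / (real k + 1)))"
      using \<nu>(2) by (intro finite_measure_mono subset_ball) (auto simp: r_def)
    then show ?thesis using k by simp
  qed
  define q where "q = 1 - (r / D)\<^sup>2"
  have q: "0 \<le> q" "q < 1" using r D by (auto simp: q_def abs_square_le_1)
  have "(\<lambda>n. q ^ n) \<longlonglongrightarrow> 0" using q by (intro LIMSEQ_realpow_zero)
  then have "eventually (\<lambda>n. q ^ n < e) sequentially" using e by (rule order_tendstoD(2))
  then obtain n where n: "q ^ n < e" using eventually_happens sequentially_bot by blast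
  have out: "peak D x n y \<le> e" if y: "y \<in> {0..D}" "y \<notin> ball x r" for y
  proof -
    have "r \<le> \<bar>y - x\<bar>" using y(2) by (simp add: dist_real_def)
    then have "(r / D)\<^sup>2 \<le> (\<bar>y - x\<bar> / D)\<^sup>2" using r D by (intro power_mono divide_right_mono) auto
    then have le: "1 - ((y - x) / D)\<^sup>2 \<le> q" by (simp add: q_def power_divide)
    have "0 \<le> 1 - ((y - x) / D)\<^sup>2" using peak_bounds(1)[OF D x y(1), of 1] by (simp add: peak_def)
    then have "peak D x n y \<le> q ^ n" unfolding peak_def using le by (intro power_mono)
    then show ?thesis using n by simp
  qed
  have "\<psi> y + peak D x n y \<le> max 2 (\<psi> y + e)" if y: "y \<in> {0..D}" for y
  proof (cases "y \<in> ball x r")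
    case True
    then have "\<psi> y < 1" using d(2) by (auto simp: r_def)
    then show ?thesis using peak_bounds(2)[OF D x y, of n] by simp
  qed (use out[OF y] in simp)
  then show ?thesis
    using I out by (intro exI[of _ 1] exI[of _ n]) (auto intro!: bexI[of _ "ball x r"])
qed

text \<open>The peaks are chosen one after the other. Their number is unlimited, yet the sums stay
  bounded, because a peak is added only where the sum so far is below 1; elsewhere only the errors
  accumulate.\<close>

theorem exists_peak_sum:
  fixes \<nu> :: "real measure" and x :: "nat \<Rightarrow> real"
  assumes D: "D > 0" and x: "\<And>k. x k \<in> {0..D}"
    and \<nu>: "finite_measure \<nu>" "sets \<nu> = sets borel" "measure \<nu> {0..D} = 1" "\<And>k. measure \<nu> {x k} = 0"
  obtains a n where "\<And>k. a k \<in> {0, 1 :: real}"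
    "\<And>N y. y \<in> {0..D} \<Longrightarrow> (\<Sum>k<N. a k * peak D (x k) (n k) y) \<le> 3"
    "\<And>k. \<exists>N. (\<Sum>j<N. a j * peak D (x j) (n j) (x k)) \<ge> 1"
    "\<exists>E\<in>sets borel. E \<subseteq> {0..D} \<and> measure \<nu> E > 0 \<and>
      (\<forall>y\<in>E. \<forall>N. (\<Sum>k<N. a k * peak D (x k) (n k) y) \<le> 1 / 2)"
proof -
  interpret finite_measure \<nu> by fact
  \<comment> \<open>The errors sum to 1/2, which serves three times: the upper bound is at most 2 +
    1/2, the exceptional sets have total measure at most 1/2, and outside them the whole sum is at
    most 1/2.\<close>
  define e :: "nat \<Rightarrow> real" where "e k = 1 / 4 * (1 / 2) ^ k" for k
  have e: "e k > 0" for k by (simp add: e_def)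
  have esum: "(\<Sum>k<N. e k) \<le> 1 / 2" for N
  proof -
    have "(\<Sum>k<N. e k) = 1 / 4 * (\<Sum>k<N. (1 / 2 :: real) ^ k)" by (simp add: e_def sum_distrib_left)
    also have "(\<Sum>k<N. (1 / 2 :: real) ^ k) = 2 - 2 * (1 / 2) ^ N" by (induction N) simp_all
    finally have "(\<Sum>k<N. e k) = 1 / 2 - 1 / 2 * (1 / 2) ^ N" by (simp only: right_diff_distrib)
    moreover have "(0::real) \<le> (1 / 2) ^ N" by simp
    ultimately show ?thesis by linarith
  qed
  define good where "good \<psi> k p \<longleftrightarrow> fst p \<in> {0, 1} \<and>
      (\<forall>y\<in>{0..D}. \<psi> y + fst p * peak D (x k) (snd p) y \<le> max 2 (\<psi> y + e k)) \<and>
      \<psi> (x k) + fst p * peak D (x k) (snd p) (x k) \<ge> min 1 (1 + \<psi> (x k)) \<and>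
      (\<exists>I\<in>sets borel. measure \<nu> I \<le> e k \<and> (\<forall>y\<in>{0..D} - I. fst p * peak D (x k) (snd p) y \<le> e k))"
    for \<psi> :: "real \<Rightarrow> real" and k and p :: "real \<times> nat"
  define pick where "pick \<psi> k = (SOME p. good \<psi> k p)" for \<psi> :: "real \<Rightarrow> real" and k
  have pick: "good \<psi> k (pick \<psi> k)" if c: "continuous_on UNIV \<psi>" for \<psi> k
  proof -
    obtain a n where "a \<in> {0, 1} \<and> (\<forall>y\<in>{0..D}. \<psi> y + a * peak D (x k) n y \<le> max 2 (\<psi> y + e k)) \<and>
      \<psi> (x k) + a * peak D (x k) n (x k) \<ge> min 1 (1 + \<psi> (x k)) \<and>
      (\<exists>I\<in>sets borel. measure \<nu> I \<le> e k \<and> (\<forall>y\<in>{0..D} - I. a * peak D (x k) n y \<le> e k))"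
      using peak_step[OF D x[of k] c e[of k] \<nu>(1) \<nu>(2) \<nu>(4)[of k]] by (elim exE) blast
    then have "good \<psi> k (a, n)" by (simp add: good_def)
    then show ?thesis unfolding pick_def by (rule someI)
  qed
  \<comment> \<open>The choice at stage \<open>k\<close> depends on the sum built so far, so the
    recursion produces the partial sums, and the sequences \<open>a\<close> and \<open>n\<close> are
    read off from them.\<close>
  define \<Psi> where "\<Psi> = rec_nat (\<lambda>_. 0) (\<lambda>k \<psi> y. \<psi> y + fst (pick \<psi> k) * peak D (x k) (snd (pick \<psi> k)) y)"
  have \<Psi>0: "\<Psi> 0 y = 0" for y by (simp add: \<Psi>_def)
  have \<Psi>S: "\<Psi> (Suc k) y = \<Psi> k y + fst (pick (\<Psi> k) k) * peak D (x k) (snd (pick (\<Psi> k) k)) y" for k y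
    by (simp add: \<Psi>_def)
  have cont: "continuous_on UNIV (\<Psi> k)" for k
  proof (induction k)
    case (Suc k)
    then have "continuous_on UNIV (\<lambda>y. \<Psi> k y + fst (pick (\<Psi> k) k) * peak D (x k) (snd (pick (\<Psi> k) k)) y)"
      by (intro continuous_intros continuous_peak)
    then show ?case by (simp add: \<Psi>S[abs_def])
  qed (simp add: \<Psi>0[abs_def])
  define a where "a k = fst (pick (\<Psi> k) k)" for k
  define n where "n k = snd (pick (\<Psi> k) k)" for k
  have \<Psi>: "\<Psi> N y = (\<Sum>k<N. a k * peak D (x k) (n k) y)" for N y
    by (induction N) (simp_all add: \<Psi>0 \<Psi>S a_def n_def)
  have g: "good (\<Psi> k) k (a k, n k)" for k
    using pick[OF cont, of k k] by (simp add: a_def n_def)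
  have a01: "a k \<in> {0, 1}" for k using g[of k] by (simp add: good_def)
  have nn: "0 \<le> a k * peak D (x k) (n k) y" if "y \<in> {0..D}" for k y
    using a01[of k] peak_bounds(1)[OF D x that] by (intro mult_nonneg_nonneg) auto
  have up: "\<Psi> N y \<le> 2 + (\<Sum>k<N. e k)" if y: "y \<in> {0..D}" for N y
  proof (induction N)
    case (Suc N)
    have "\<Psi> (Suc N) y \<le> max 2 (\<Psi> N y + e N)"
      using g[of N] y by (simp add: good_def \<Psi>S a_def n_def)
    also have "\<dots> \<le> 2 + (\<Sum>k<Suc N. e k)"
      using Suc e sum_nonneg[of "{..<Suc N}" e] by (simp add: less_imp_le)
    finally show ?case .
  qed (simp add: \<Psi>0)
  show ?thesis
  proof (rule that[of a n])
    show "a k \<in> {0, 1}" for k by (rule a01)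
    show "(\<Sum>k<N. a k * peak D (x k) (n k) y) \<le> 3" if "y \<in> {0..D}" for N y
      using up[OF that, of N] esum[of N] by (simp add: \<Psi>)
    show "\<exists>N. (\<Sum>j<N. a j * peak D (x j) (n j) (x k)) \<ge> 1" for k
    proof -
      have "\<Psi> k (x k) \<ge> 0" unfolding \<Psi> by (intro sum_nonneg nn x)
      moreover have "\<Psi> k (x k) + a k * peak D (x k) (n k) (x k) \<ge> min 1 (1 + \<Psi> k (x k))"
        using g[of k] by (simp add: good_def)
      ultimately have "\<Psi> (Suc k) (x k) \<ge> 1" by (simp add: \<Psi>S a_def n_def)
      then show ?thesis unfolding \<Psi> by blast
    qed
    have "\<forall>k. \<exists>I. I \<in> sets borel \<and> measure \<nu> I \<le> e k \<and> (\<forall>y\<in>{0..D} - I. a k * peak D (x k) (n k) y \<le> e k)"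
      using g unfolding good_def fst_conv snd_conv by blast
    then obtain I where I: "\<And>k. I k \<in> sets borel" "\<And>k. measure \<nu> (I k) \<le> e k"
        "\<And>k y. y \<in> {0..D} - I k \<Longrightarrow> a k * peak D (x k) (n k) y \<le> e k" by metis
    define E where "E = {0..D} - (\<Union>k. I k)"
    have es: "summable e" unfolding e_def by (intro summable_mult summable_geometric) simp
    have "measure \<nu> (\<Union>k. I k) \<le> (\<Sum>k. measure \<nu> (I k))"
      using I \<nu>(2) by (intro finite_measure_subadditive_countably summable_comparison_test'[OF es, of 0]) auto
    also have "\<dots> \<le> (\<Sum>k. e k)"
      using I(2) by (intro suminf_le summable_comparison_test'[OF es, of 0] es) auto
    also have "\<dots> \<le> 1 / 2" by (rule suminf_le_const[OF es esum])
    finally have "measure \<nu> (\<Union>k. I k) \<le> 1 / 2" .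
    moreover have "measure \<nu> {0..D} \<le> measure \<nu> (E \<union> (\<Union>k. I k))"
      using I(1) \<nu>(2) by (intro finite_measure_mono) (auto simp: E_def)
    moreover have "measure \<nu> (E \<union> (\<Union>k. I k)) \<le> measure \<nu> E + measure \<nu> (\<Union>k. I k)"
      using I(1) \<nu>(2) by (intro measure_Un_le) (auto simp: E_def)
    ultimately have "measure \<nu> E > 0" using \<nu>(3) by linarith
    moreover have "(\<Sum>k<N. a k * peak D (x k) (n k) y) \<le> 1 / 2" if "y \<in> E" for y N
    proof -
      have "(\<Sum>k<N. a k * peak D (x k) (n k) y) \<le> (\<Sum>k<N. e k)"
        using that by (intro sum_mono I(3)) (auto simp: E_def)
      then show ?thesis using esum[of N] by linarith
    qed
    ultimately show "\<exists>E\<in>sets borel. E \<subseteq> {0..D} \<and> measure \<nu> E > 0 \<and>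
      (\<forall>y\<in>E. \<forall>N. (\<Sum>k<N. a k * peak D (x k) (n k) y) \<le> 1 / 2)"
      using I(1) by (intro bexI[of _ E]) (auto simp: E_def)
  qed
qed

text \<open>A finite measure has at most countably many atoms, and an open interval is uncountable.
  Density brings peaks into every open set of the torus, and the absence of atoms makes them
  negligible in measure.\<close>

lemma dense_sequence_of_non_atoms:
  fixes \<nu> :: "real measure"
  assumes D: "D > 0" and \<nu>: "finite_measure \<nu>"
  obtains x where "\<And>k::nat. x k \<in> {0..D}" "\<And>k. measure \<nu> {x k} = 0"
    "\<And>u v. 0 \<le> u \<Longrightarrow> u < v \<Longrightarrow> v \<le> D \<Longrightarrow> \<exists>k. u < x k \<and> x k < v"
proof -
  interpret finite_measure \<nu> by fact
  define S where "S = {0..D} - {y. measure \<nu> {y} \<noteq> 0}"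
  have ct: "countable {y. measure \<nu> {y} \<noteq> 0}" by (rule countable_support)
  obtain T where T: "countable T" "T \<subseteq> S" "S \<subseteq> closure T" by (rule separable)
  have dense: "\<exists>y\<in>T. u < y \<and> y < v" if "0 \<le> u" "u < v" "v \<le> D" for u v
  proof -
    have "uncountable {u<..<v}" using that by (simp add: uncountable_open_interval)
    then have "\<not> {u<..<v} \<subseteq> {y. measure \<nu> {y} \<noteq> 0}" using ct countable_subset by blast
    then obtain s where "s \<in> {u<..<v}" "measure \<nu> {s} = 0" by blast
    moreover then have "s \<in> closure T" using T(3) that by (auto simp: S_def)
    ultimately have "{u<..<v} \<inter> T \<noteq> {}"
      using open_Int_closure_eq_empty[of "{u<..<v}" T] by auto
    then show ?thesis by auto
  qed
  then have ne: "T \<noteq> {}" using D by (metis empty_iff order_refl)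
  show ?thesis
  proof (rule that[of "from_nat_into T"])
    have "from_nat_into T k \<in> S" for k using from_nat_into[OF ne] T(2) by blast
    then show "from_nat_into T k \<in> {0..D}" "measure \<nu> {from_nat_into T k} = 0" for k
      by (auto simp: S_def)
    show "\<exists>k. u < from_nat_into T k \<and> from_nat_into T k < v" if "0 \<le> u" "u < v" "v \<le> D" for u v
      using dense[OF that] from_nat_into_surj[OF T(1)] by metis
  qed
qed

section \<open>The modulus of the first coordinate on the torus\<close>

definition coord :: "nat \<Rightarrow> 'n::{finite,linorder}" where
  "coord k = (SOME j. coord_no j = k)"

lemma coord_no_coord:
  "1 \<le> k \<Longrightarrow> k \<le> CARD('n) \<Longrightarrow> coord_no (coord k :: 'n::{finite,linorder}) = k"
  unfolding coord_def by (rule someI_ex) (rule coord_no_surj)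

lemma elem_sym_1: "elem_sym 1 u = (\<Sum>i\<in>UNIV. u $ i)"
proof -
  have "{S :: 'a set. card S = 1} = range (\<lambda>i. {i})" by (auto simp: card_1_singleton_iff)
  then show ?thesis by (simp add: elem_sym_def sum.reindex)
qed

text \<open>The index sets are the complements of single points. On the torus the reciprocals are
  conjugates, so the sum becomes the conjugate of the first elementary symmetric polynomial.\<close>

lemma elem_sym_pred_card:
  fixes u :: "complex^'n"
  assumes u: "\<And>i. u $ i \<noteq> 0"
  shows "elem_sym (CARD('n) - 1) u = (\<Prod>i\<in>UNIV. u $ i) * (\<Sum>i\<in>UNIV. 1 / u $ i)"
proof -
  have "{S :: 'n set. card S = CARD('n) - 1} = range (\<lambda>i. UNIV - {i})"
  proof safe
    fix S :: "'n set" assume S: "card S = CARD('n) - 1"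
    have "card (UNIV - S) = 1"
      using S card_Diff_subset[of S UNIV] zero_less_card_finite[where 'a = 'n] by simp
    then obtain i where "UNIV - S = {i}" by (auto simp: card_1_singleton_iff)
    then show "S \<in> range (\<lambda>i. UNIV - {i})" by (intro image_eqI[of _ _ i]) auto
  qed simp
  moreover have "inj (\<lambda>i. UNIV - {i :: 'n})" by (auto simp: inj_def)
  moreover have "(\<Prod>j\<in>UNIV - {i}. u $ j) = (\<Prod>j\<in>UNIV. u $ j) * (1 / u $ i)" for i
    using prod.remove[of UNIV i "\<lambda>j. u $ j"] u[of i] by simp
  ultimately show ?thesis
    by (simp add: elem_sym_def sum.reindex sum_distrib_left o_def)
qed

lemma theta_last:
  fixes z :: "complex^'n::{finite,linorder}"
  shows "theta m t z $ coord CARD('n) = (\<Prod>i\<in>UNIV. z $ i) ^ (m div t)"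
  using coord_no_coord[of "CARD('n)", where 'n = 'n] by (simp add: theta_def Suc_le_eq)

lemma theta_coord:
  fixes z :: "complex^'n::{finite,linorder}"
  assumes "1 \<le> k" "k < CARD('n)"
  shows "theta m t z $ coord k = elem_sym k (\<chi> i. (z $ i) ^ m)"
  using coord_no_coord[of k, where 'n = 'n] assms by (simp add: theta_def)

text \<open>The function \<open>v\<close> of the overview. The square of the modulus is what equals,
  on the boundary, the product of the coordinates numbered \<open>1\<close> and \<open>d - 1\<close>
  divided by the \<open>t\<close>-th power of the last one.\<close>

definition first_coord_sq :: "complex^'n::{finite,linorder} \<Rightarrow> real" where
  "first_coord_sq q = (norm (q $ coord 1))\<^sup>2"

lemma continuous_first_coord_sq:
  fixes S :: "(complex, 'n::{finite,linorder}) vec set"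
  shows "continuous_on S first_coord_sq"
  unfolding first_coord_sq_def by (intro continuous_intros)

lemma first_coord_sq_range:
  fixes z :: "complex^'n::{finite,linorder}"
  assumes "z \<in> torus" "CARD('n) > 1"
  shows "first_coord_sq (theta m t z) \<in> {0..(real CARD('n))\<^sup>2}"
proof -
  have "norm (\<Sum>i\<in>UNIV. (z $ i) ^ m) \<le> (\<Sum>i\<in>(UNIV::'n set). 1)"
    using assms(1) by (intro sum_norm_le) (simp add: torus_def norm_power)
  then have "norm (\<Sum>i\<in>UNIV. (z $ i) ^ m) \<le> real CARD('n)" by simp
  then show ?thesis
    using assms(2) theta_coord[of 1 m t z] by (simp add: first_coord_sq_def elem_sym_1[unfolded One_nat_def] power_mono)
qed

lemma first_coord_sq_scale:
  fixes z :: "complex^'n::{finite,linorder}"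
  assumes "norm c = 1" "CARD('n) > 1"
  shows "first_coord_sq (theta m t (c *s z)) = first_coord_sq (theta m t z)"
  using assms coord_no_coord[of 1, where 'n = 'n] by (simp add: first_coord_sq_def theta_scale norm_mult norm_power)

text \<open>On the torus \<open>E\<^sub>d\<^sub>-\<^sub>1\<close> is \<open>E\<^sub>d\<close> times the conjugate of \<open>E\<^sub>1\<close>, so that \<open>q\<^sub>1 q\<^sub>d\<^sub>-\<^sub>1\<close> is the
  real number \<open>\<bar>q\<^sub>1\<bar>\<^sup>2\<close> times a power of the last coordinate.\<close>

lemma first_coord_sq_slice:
  fixes z :: "complex^'n::{finite,linorder}"
  assumes z: "z \<in> torus" and d: "CARD('n) > 1" and mt: "t dvd m"
  shows "theta m t (w *s z) $ coord 1 * theta m t (w *s z) $ coord (CARD('n) - 1) =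
    of_real (first_coord_sq (theta m t z)) * (theta m t (w *s z) $ coord CARD('n)) ^ t"
proof -
  let ?u = "\<chi> i. (z $ i) ^ m"
  have nz: "?u $ i * cnj (?u $ i) = 1" for i
    using z complex_norm_square[of "?u $ i"] by (simp add: torus_def norm_power)
  have u0: "?u $ i \<noteq> 0" for i using nz[of i] by (metis mult_zero_left zero_neq_one)
  have inv: "1 / ?u $ i = cnj (?u $ i)" for i using nz[of i] u0[of i] by (simp add: divide_eq_eq mult.commute)
  have e: "elem_sym (CARD('n) - 1) ?u = (\<Prod>i\<in>UNIV. ?u $ i) * cnj (elem_sym 1 ?u)"
    unfolding elem_sym_pred_card[OF u0] inv elem_sym_1 by simp
  have t1: "theta m t (w *s z) $ coord 1 = w ^ m * elem_sym 1 ?u"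
    using d coord_no_coord[of 1, where 'n = 'n] theta_coord[of 1 m t z] by (simp add: theta_scale)
  have t2: "theta m t (w *s z) $ coord (CARD('n) - 1) = w ^ ((CARD('n) - 1) * m) * elem_sym (CARD('n) - 1) ?u"
    using d coord_no_coord[of "CARD('n) - 1", where 'n = 'n] theta_coord[of "CARD('n) - 1" m t z] by (simp add: theta_scale)
  have v: "elem_sym 1 ?u * cnj (elem_sym 1 ?u) = of_real (first_coord_sq (theta m t z))"
    using d theta_coord[of 1 m t z] by (simp add: first_coord_sq_def complex_norm_square flip: of_real_power)
  \<comment> \<open>Because \<open>t\<close> divides \<open>m\<close>, the \<open>t\<close>-th power
    of the last coordinate has weight \<open>d * m\<close>, the same as the product of the
    coordinates numbered \<open>1\<close> and \<open>d - 1\<close>.\<close>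
  have ex: "CARD('n) * (m div t) * t = CARD('n) * m" "m div t * t = m" using mt by (simp_all add: mult.assoc)
  have "theta m t (w *s z) $ coord CARD('n) = w ^ (CARD('n) * (m div t)) * (\<Prod>i\<in>UNIV. z $ i) ^ (m div t)"
    unfolding theta_last by (simp add: prod.distrib power_mult_distrib power_mult)
  then have "(theta m t (w *s z) $ coord CARD('n)) ^ t = w ^ (CARD('n) * m) * (\<Prod>i\<in>UNIV. z $ i) ^ m"
    by (simp only: power_mult_distrib power_mult[symmetric] ex)
  then have t3: "(theta m t (w *s z) $ coord CARD('n)) ^ t = w ^ (CARD('n) * m) * (\<Prod>i\<in>UNIV. ?u $ i)"
    by (simp add: prod_power_distrib)
  have "m + (CARD('n) - 1) * m = CARD('n) * m" using d by (cases "CARD('n)") auto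
  then have "w ^ m * w ^ ((CARD('n) - 1) * m) = w ^ (CARD('n) * m)"
    by (simp only: power_add[symmetric])
  then have "theta m t (w *s z) $ coord 1 * theta m t (w *s z) $ coord (CARD('n) - 1) =
      w ^ (CARD('n) * m) * (\<Prod>i\<in>UNIV. ?u $ i) * (elem_sym 1 ?u * cnj (elem_sym 1 ?u))"
    unfolding t1 t2 e by (simp add: mult_ac)
  then show ?thesis unfolding t3 v by (simp add: mult_ac)
qed

text \<open>If \<open>\<bar>c\<^sub>1 + \<dots> + c\<^sub>d\<bar>\<close> did not change when a single unimodular \<open>c\<^sub>i\<close> is rotated slightly, then the sum of the
  other terms would vanish. For all \<open>i\<close> at once this is impossible if \<open>d > 1\<close>.\<close>

lemma first_coord_sq_not_constant:
  fixes x0 :: "real^'n::{finite,linorder}"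
  assumes d: "CARD('n) > 1" and m: "m > 0" and \<epsilon>: "\<epsilon> > 0"
  shows "\<exists>x\<in>ball x0 \<epsilon>. first_coord_sq (theta m t (torus_point x)) \<noteq> first_coord_sq (theta m t (torus_point x0))"
proof (rule ccontr)
  assume neg: "\<not> ?thesis"
  define c where "c i = cis (2 * pi * m * x0 $ i)" for i
  define E where "E = (\<Sum>i\<in>UNIV. c i)"
  have V: "first_coord_sq (theta m t (torus_point x)) = (norm (\<Sum>i\<in>UNIV. cis (2 * pi * m * x $ i)))\<^sup>2" for x :: "(real, 'n) vec"
  proof -
    have "cis (2 * pi * x $ i) ^ m = cis (2 * pi * m * x $ i)" for i
      by (subst Complex.DeMoivre) (simp add: mult_ac)
    then show ?thesis using d theta_coord[of 1 m t "torus_point x"]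
      by (simp add: first_coord_sq_def elem_sym_1[unfolded One_nat_def])
  qed
  \<comment> \<open>The bound \<open>1 / (8 * m)\<close> keeps the rotation angle
    \<open>\<beta> = 2 * pi * m * \<tau>\<close> at most \<open>pi / 4\<close>, so that
    \<open>sin \<beta>\<close> and \<open>1 - cos \<beta>\<close> are positive.\<close>
  define \<tau> where "\<tau> = min (\<epsilon> / 2) (1 / (8 * m))"
  have \<tau>: "0 < \<tau>" "\<tau> < \<epsilon>" "\<tau> \<le> 1 / (8 * m)" using \<epsilon> m by (auto simp: \<tau>_def)
  define \<beta> where "\<beta> = 2 * pi * m * \<tau>"
  have \<beta>: "0 < \<beta>" "\<beta> < pi / 2"
  proof -
    show "0 < \<beta>" using \<tau>(1) m by (simp add: \<beta>_def)
    have "\<beta> \<le> 2 * pi * m * (1 / (8 * m))" unfolding \<beta>_def using \<tau>(3) by (intro mult_left_mono) auto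
    also have "\<dots> = pi / 4" using m by simp
    finally show "\<beta> < pi / 2" using pi_gt_zero by linarith
  qed
  have shift: "norm (E - c i + c i * cis (s * \<beta>)) = norm E" if s: "\<bar>s\<bar> = 1" for i and s :: real
  proof -
    let ?x = "x0 + (s * \<tau>) *\<^sub>R axis i 1"
    have "?x \<in> ball x0 \<epsilon>" using \<tau> s by (simp add: dist_norm abs_mult)
    then have "first_coord_sq (theta m t (torus_point ?x)) = first_coord_sq (theta m t (torus_point x0))" using neg by blast
    then have "norm (\<Sum>k\<in>UNIV. cis (2 * pi * m * ?x $ k)) = norm E"
      unfolding V E_def c_def by (simp only: norm_ge_zero power2_eq_iff_nonneg)
    moreover have "(\<Sum>k\<in>UNIV. cis (2 * pi * m * ?x $ k)) = E - c i + c i * cis (s * \<beta>)"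
    proof -
      have "(\<Sum>k\<in>UNIV. cis (2 * pi * m * ?x $ k)) = (\<Sum>k\<in>UNIV. if k = i then c i * cis (s * \<beta>) else c k)"
        by (intro sum.cong) (auto simp: c_def \<beta>_def cis_mult axis_def algebra_simps)
      also have "\<dots> = c i * cis (s * \<beta>) + (\<Sum>k\<in>UNIV - {i}. c k)"
        by (subst sum.remove[of _ i]) (auto intro!: sum.cong)
      also have "(\<Sum>k\<in>UNIV - {i}. c k) = E - c i"
        unfolding E_def by (subst sum.remove[of UNIV i]) auto
      finally show ?thesis by simp
    qed
    ultimately show ?thesis by simp
  qed
  have Ec: "c i = E" for i
  proof -
    define a where "a = E - c i"
    have nc: "norm (c i) = 1" by (simp add: c_def)
    define b where "b = cnj a * c i"
    have expand: "(norm (a + c i * cis \<alpha>))\<^sup>2 = (norm a)\<^sup>2 + 1 + 2 * Re (b * cis \<alpha>)" for \<alpha>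
    proof -
      have "norm (c i * cis \<alpha>) = 1" by (simp add: norm_mult nc)
      moreover have "(norm (a + w))\<^sup>2 = (norm a)\<^sup>2 + (norm w)\<^sup>2 + 2 * Re (cnj a * w)" for w
        unfolding cmod_power2 by (simp add: power2_eq_square algebra_simps)
      ultimately show ?thesis by (simp add: b_def mult.assoc)
    qed
    have "(norm (a + c i * cis (s * \<beta>)))\<^sup>2 = (norm (a + c i * cis 0))\<^sup>2" if "\<bar>s\<bar> = 1" for s
      using shift[OF that, of i] by (simp add: a_def)
    then have "Re (b * cis (s * \<beta>)) = Re (b * cis 0)" if "\<bar>s\<bar> = 1" for s
      using that unfolding expand by (metis add_left_cancel mult_left_cancel zero_neq_numeral)
    then have "Re (b * cis (s * \<beta>)) = Re b" if "\<bar>s\<bar> = 1" for s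
      using that by (simp only: cis_zero mult_1_right)
    \<comment> \<open>Rotations in both directions are compared: the difference of the two equations
      isolates the imaginary part of \<open>b\<close>, their sum the real part.\<close>
    from this[of 1] this[of "-1"] have "Re b * cos \<beta> - Im b * sin \<beta> = Re b" "Re b * cos \<beta> + Im b * sin \<beta> = Re b"
      by simp_all
    then have "Im b * sin \<beta> = 0" "Re b * (1 - cos \<beta>) = 0" by (simp_all add: algebra_simps)
    moreover have "sin \<beta> > 0" using \<beta> pi_gt_zero by (intro sin_gt_zero) auto
    moreover have "cos \<beta> < cos 0" using \<beta> pi_gt_zero by (intro cos_monotone_0_pi) auto
    ultimately have "b = 0" by (simp add: complex_eq_iff)
    then have "a = 0" using nc by (auto simp: b_def)
    then show ?thesis by (simp add: a_def)
  qed
  have "E = (\<Sum>i\<in>(UNIV :: 'n set). E)" by (subst (1) E_def) (rule sum.cong[OF refl], rule Ec)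
  then have "E = of_nat CARD('n) * E" by simp
  then have "(of_nat CARD('n) - 1) * E = 0" by (simp add: algebra_simps)
  moreover have "of_nat CARD('n) \<noteq> (1 :: complex)" using d by (metis of_nat_1 of_nat_eq_iff less_irrefl)
  ultimately have "E = 0" by simp
  then have "c (coord 1) = 0" by (simp only: Ec)
  then show False by (simp add: c_def)
qed

text \<open>A ball is connected and \<open>first_coord_sq\<close> is not constant on it, so its
  values there fill an interval, which contains one of the points \<open>x k\<close>.\<close>

lemma peak_set_dense:
  fixes U :: "(real, 'n::{finite,linorder}) vec set" and x :: "nat \<Rightarrow> real"
  assumes d: "CARD('n) > 1" and m: "m > 0" and U: "open U" "U \<noteq> {}"
    and x: "\<And>u v. 0 \<le> u \<Longrightarrow> u < v \<Longrightarrow> v \<le> (real CARD('n))\<^sup>2 \<Longrightarrow> \<exists>k. u < x k \<and> x k < v"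
  shows "\<exists>y\<in>U. \<exists>k. first_coord_sq (theta m t (torus_point y)) = x k"
proof -
  let ?V = "\<lambda>y :: (real, 'n) vec. first_coord_sq (theta m t (torus_point y))"
  obtain y0 where y0: "y0 \<in> U" using U(2) by blast
  obtain \<epsilon> where \<epsilon>: "\<epsilon> > 0" "ball y0 \<epsilon> \<subseteq> U" using U(1) y0 by (rule openE)
  obtain y1 where y1: "y1 \<in> ball y0 \<epsilon>" "?V y1 \<noteq> ?V y0"
    using first_coord_sq_not_constant[OF d m \<epsilon>(1)] by blast
  have "continuous_on (ball y0 \<epsilon>) ?V"
    by (rule continuous_on_compose2[OF continuous_first_coord_sq[of UNIV]])
      (auto intro!: continuous_on_compose2[OF continuous_theta[of UNIV]] continuous_torus_point)
  then have conn: "connected (?V ` ball y0 \<epsilon>)" by (intro connected_continuous_image connected_ball)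
  define u where "u = min (?V y0) (?V y1)"
  define v where "v = max (?V y0) (?V y1)"
  have uv: "u < v" "u \<in> ?V ` ball y0 \<epsilon>" "v \<in> ?V ` ball y0 \<epsilon>"
    using y1 \<epsilon>(1) by (auto simp: u_def v_def min_def max_def)
  have "0 \<le> u" "v \<le> (real CARD('n))\<^sup>2"
    using first_coord_sq_range[OF torus_point_in_torus d, of m t y0] first_coord_sq_range[OF torus_point_in_torus d, of m t y1]
    by (auto simp: u_def v_def)
  then obtain k where "u < x k" "x k < v" using x uv(1) by blast
  then have "x k \<in> ?V ` ball y0 \<epsilon>"
    using connectedD_interval[OF conn uv(2,3), of "x k"] by simp
  then obtain y where "y \<in> ball y0 \<epsilon>" "?V y = x k" by auto
  then show ?thesis using \<epsilon>(2) by blast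
qed

section \<open>A function with two-valued boundary modulus\<close>

text \<open>The Moebius map of the unit disc onto the half plane \<open>Re w < 1\<close> that fixes
  0. Its real part is 1 minus the Poisson kernel of the boundary point 1.\<close>

definition mobius_J :: "complex \<Rightarrow> complex" where
  "mobius_J u = - 2 * u / (1 - u)"

lemma Re_mobius_J:
  assumes "u \<noteq> 1" shows "Re (mobius_J u) = 1 - (1 - (norm u)\<^sup>2) / (norm (1 - u))\<^sup>2"
proof -
  have nz: "(norm (1 - u))\<^sup>2 > 0" using assms by simp
  have "mobius_J u = - 2 * u * cnj (1 - u) / of_real ((norm (1 - u))\<^sup>2)"
  proof -
    have "cnj (1 - u) \<noteq> 0" using assms by simp
    then show ?thesis
      unfolding mobius_J_def complex_norm_square by (rule mult_divide_mult_cancel_right[symmetric])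
  qed
  then have "Re (mobius_J u) = Re (- 2 * u * cnj (1 - u)) / (norm (1 - u))\<^sup>2"
    by (simp only: Re_divide_of_real)
  also have "Re (- 2 * u * cnj (1 - u)) = (norm (1 - u))\<^sup>2 - (1 - (norm u)\<^sup>2)"
    unfolding cmod_power2 by (simp add: power2_eq_square algebra_simps)
  also have "\<dots> / (norm (1 - u))\<^sup>2 = 1 - (1 - (norm u)\<^sup>2) / (norm (1 - u))\<^sup>2"
    using nz by (simp add: diff_divide_distrib)
  finally show ?thesis .
qed

lemma Re_mobius_J_le: "norm u < 1 \<Longrightarrow> Re (mobius_J u) \<le> 1"
  by (subst Re_mobius_J) (auto simp: abs_square_le_1 less_imp_le)

lemma Re_mobius_J_eq: "norm u = 1 \<Longrightarrow> u \<noteq> 1 \<Longrightarrow> Re (mobius_J u) = 1"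
  by (subst Re_mobius_J) auto

text \<open>Homogenized \<open>peak\<close> at the height \<open>x\<close>, with \<open>q\<^sub>1 q\<^sub>d\<^sub>-\<^sub>1\<close> in the role of the variable. The power \<open>q\<^sub>d\<^sup>M\<close> makes
  the term small inside the polydisc.\<close>

definition peak_term :: "nat \<Rightarrow> real \<Rightarrow> real \<Rightarrow> nat \<Rightarrow> nat \<Rightarrow> complex^'n::{finite,linorder} \<Rightarrow> complex" where
  "peak_term t a x n M q =
     - 2 * of_real a * ((q $ coord CARD('n)) ^ (2 * t) -
         ((q $ coord 1 * q $ coord (CARD('n) - 1) - of_real x * (q $ coord CARD('n)) ^ t) / of_real ((real CARD('n))\<^sup>2))\<^sup>2) ^ n *
       (q $ coord CARD('n)) ^ M / (1 - (q $ coord CARD('n)) ^ (M + 2 * t * n))"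

text \<open>With \<open>s\<close> the last coordinate, the slice identity turns the bracket into
  \<open>s ^ (2 * t) * (1 - b\<^sup>2)\<close>. Its \<open>n\<close>-th power together with
  \<open>s ^ M\<close> yields \<open>s ^ (M + 2 * t * n)\<close>, which is exactly the power in the
  denominator, and \<open>mobius_J\<close> of that power appears.\<close>

lemma peak_term_slice:
  fixes z :: "complex^'n::{finite,linorder}"
  assumes z: "z \<in> torus" and d: "CARD('n) > 1" and mt: "t dvd m"
  shows "peak_term t a x n M (theta m t (w *s z)) =
    of_real (a * peak ((real CARD('n))\<^sup>2) x n (first_coord_sq (theta m t z))) *
      mobius_J ((theta m t (w *s z) $ coord CARD('n)) ^ (M + 2 * t * n))"
proof -
  define s where "s = theta m t (w *s z) $ coord CARD('n)"
  define v where "v = first_coord_sq (theta m t z)"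
  define D where "D = (real CARD('n))\<^sup>2"
  have D: "D > 0" by (simp add: D_def)
  define b where "b = (v - x) / D"
  define y where "y = 1 - b\<^sup>2"
  have e1: "(of_real v * s ^ t - of_real x * s ^ t) / of_real D = of_real b * s ^ t"
    by (simp add: b_def left_diff_distrib diff_divide_distrib)
  have e2: "s ^ (2 * t) = (s ^ t)\<^sup>2" by (simp add: mult.commute flip: power_mult)
  have "s ^ (2 * t) - ((of_real v * s ^ t - of_real x * s ^ t) / of_real D)\<^sup>2
      = (s ^ t)\<^sup>2 - (of_real b * s ^ t)\<^sup>2"
    by (simp only: e1 e2)
  also have "\<dots> = (s ^ t)\<^sup>2 * of_real y"
    by (simp add: y_def power_mult_distrib right_diff_distrib mult.commute)
  also have "\<dots> = s ^ (2 * t) * of_real y" by (simp only: e2)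
  finally have "(s ^ (2 * t) - ((of_real v * s ^ t - of_real x * s ^ t) / of_real D)\<^sup>2) ^ n * s ^ M
     = of_real (peak D x n v) * s ^ (M + 2 * t * n)"
    by (simp add: peak_def b_def[symmetric] y_def[symmetric] power_mult_distrib power_add power_mult)
  then show ?thesis
    unfolding peak_term_def first_coord_sq_slice[OF z d mt] s_def[symmetric] v_def[symmetric] D_def[symmetric] mobius_J_def
    by (simp add: mult.assoc)
qed

text \<open>Crude, but \<open>M\<close> enters only through \<open>\<rho> ^ M\<close>. A large
  \<open>M\<close> therefore makes the term as small as desired wherever \<open>R\<close> and
  \<open>\<rho>\<close> are under control.\<close>

lemma peak_term_bound:
  fixes q :: "complex^'n::{finite,linorder}"
  assumes a: "a \<in> {0, 1}" and x: "x \<in> {0..(real CARD('n))\<^sup>2}" and M: "M \<ge> 1"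
    and R: "\<And>j. norm (q $ j) \<le> R" and \<rho>: "norm (q $ coord CARD('n)) \<le> \<rho>" "\<rho> < 1"
  shows "norm (peak_term t a x n M q) \<le> 2 * (1 + (R\<^sup>2 + (real CARD('n))\<^sup>2)\<^sup>2) ^ n * \<rho> ^ M / (1 - \<rho>)"
proof -
  define s where "s = q $ coord CARD('n)"
  define D where "D = (real CARD('n))\<^sup>2"
  have D: "D \<ge> 1" by (simp add: D_def Suc_le_eq)
  have s: "norm s \<le> \<rho>" "norm s \<le> 1" and \<rho>0: "0 \<le> \<rho>"
    using \<rho> norm_ge_zero[of s] unfolding s_def by linarith+
  have R0: "R \<ge> 0" using R norm_ge_zero order_trans by blast
  define p where "p = q $ coord 1 * q $ coord (CARD('n) - 1)"
  have p: "norm p \<le> R\<^sup>2" unfolding p_def norm_mult power2_eq_square using R R0 by (intro mult_mono) auto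
  have st: "norm (s ^ k) \<le> 1" for k using s by (simp add: norm_power power_le_one)
  have "norm (of_real x * s ^ t) \<le> D * 1"
    unfolding norm_mult using x st D by (intro mult_mono) (auto simp: D_def)
  then have "norm (p - of_real x * s ^ t) \<le> R\<^sup>2 + D"
    using p norm_triangle_ineq4[of p "of_real x * s ^ t"] by linarith
  then have "norm (p - of_real x * s ^ t) / D \<le> (R\<^sup>2 + D) / 1"
    using D by (intro frac_le) auto
  then have "norm (((p - of_real x * s ^ t) / of_real D)\<^sup>2) \<le> (R\<^sup>2 + D)\<^sup>2"
    using D unfolding norm_power norm_divide by (intro power_mono) auto
  then have "norm (s ^ (2 * t) - ((p - of_real x * s ^ t) / of_real D)\<^sup>2) \<le> 1 + (R\<^sup>2 + D)\<^sup>2"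
    using st[of "2 * t"] norm_triangle_ineq4[of "s ^ (2 * t)" "((p - of_real x * s ^ t) / of_real D)\<^sup>2"] by linarith
  then have A: "norm ((s ^ (2 * t) - ((p - of_real x * s ^ t) / of_real D)\<^sup>2) ^ n) \<le> (1 + (R\<^sup>2 + D)\<^sup>2) ^ n"
    unfolding norm_power by (intro power_mono) auto
  have sM: "norm (s ^ M) \<le> \<rho> ^ M" using s by (simp add: norm_power power_mono)
  have den: "1 - \<rho> \<le> norm (1 - s ^ (M + 2 * t * n))"
  proof -
    have "norm (s ^ (M + 2 * t * n)) \<le> norm s ^ 1"
      unfolding norm_power using s M by (intro power_decreasing) auto
    then show ?thesis using s(1) norm_triangle_ineq2[of 1 "s ^ (M + 2 * t * n)"] by simp
  qed
  have "norm (peak_term t a x n M q) = 2 * \<bar>a\<bar> * norm ((s ^ (2 * t) - ((p - of_real x * s ^ t) / of_real D)\<^sup>2) ^ n) *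
      norm (s ^ M) / norm (1 - s ^ (M + 2 * t * n))"
    unfolding peak_term_def s_def[symmetric] p_def[symmetric] D_def[symmetric] by (simp add: norm_mult norm_divide)
  also have "\<dots> \<le> 2 * 1 * (1 + (R\<^sup>2 + D)\<^sup>2) ^ n * \<rho> ^ M / (1 - \<rho>)"
    using A sM den \<rho>(2) a \<rho>0 by (intro frac_le mult_mono) auto
  finally show ?thesis by (simp add: D_def)
qed

lemma holomorphic_peak_term:
  assumes "M \<ge> 1"
  shows "holomorphic_vec_on (peak_term t a x n M) {q :: (complex, 'n::{finite,linorder}) vec. norm (q $ coord CARD('n)) < 1}"
proof -
  have "1 - (q $ coord CARD('n)) ^ (M + 2 * t * n) \<noteq> 0" if "norm (q $ coord CARD('n)) < 1" for q :: "(complex, 'n) vec"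
  proof
    assume "1 - (q $ coord CARD('n)) ^ (M + 2 * t * n) = 0"
    then have "norm (q $ coord CARD('n)) ^ (M + 2 * t * n) = 1"
      by (metis eq_iff_diff_eq_0 norm_one norm_power)
    moreover have "norm (q $ coord CARD('n)) ^ (M + 2 * t * n) \<le> norm (q $ coord CARD('n)) ^ 1"
      using that assms by (intro power_decreasing) auto
    ultimately show False using that by simp
  qed
  then show ?thesis
    unfolding peak_term_def[abs_def]
    by (intro holomorphic_vec_intros) (auto simp: power2_eq_square)
qed

section \<open>Boundary modulus of the exponential of a series of peaks\<close>

lemma AE_unit_interval_periodic:
  fixes P :: "complex \<Rightarrow> bool"
  assumes P: "Measurable.pred borel (\<lambda>s. P (cis (2 * pi * s)))"
    and AE: "AE s in lborel. s \<in> {0..1} \<longrightarrow> P (cis (2 * pi * s))"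
  shows "AE s in lborel. P (cis (2 * pi * s))"
proof -
  have per: "cis (2 * pi * (- of_int k + s)) = cis (2 * pi * s)" for k :: int and s :: real
    using cis_mult[of "2 * pi * (- of_int k)" "2 * pi * s"] cis_multiple_2pi[of "- of_int k"]
    by (simp add: distrib_left right_diff_distrib)
  have m: "Measurable.pred borel (\<lambda>s. s \<in> {0..1} \<longrightarrow> P (cis (2 * pi * s)))" using P by measurable
  have "AE s in lborel. - of_int k + s \<in> {0..1} \<longrightarrow> P (cis (2 * pi * s))" for k :: int
    using AE_lborel_translate[OF m, of "- of_int k"] AE by (simp only: per)
  then have "AE s in lborel. \<forall>k::int. - of_int k + s \<in> {0..1} \<longrightarrow> P (cis (2 * pi * s))"
    by (subst AE_all_countable) blast
  then show ?thesis
  proof eventually_elim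
    case (elim s)
    have "- of_int \<lfloor>s\<rfloor> + s \<in> {0..1}" by (simp add: algebra_simps) linarith
    then show ?case using elim by blast
  qed
qed

lemma countable_cis_eq:
  assumes "L > 0"
  shows "countable {s :: real. cis (2 * pi * L * s) = c}"
proof (cases "{s. cis (2 * pi * L * s) = c} = {}")
  case False
  then obtain s0 where s0: "cis (2 * pi * L * s0) = c" by auto
  have "{s. cis (2 * pi * L * s) = c} \<subseteq> range (\<lambda>k::int. s0 + of_int k / L)"
  proof
    fix s assume "s \<in> {s. cis (2 * pi * L * s) = c}"
    then have "cis (2 * pi * L * s) = cis (2 * pi * L * s0)" using s0 by simp
    then have "cis (2 * pi * L * s - 2 * pi * L * s0) = 1" by (simp flip: cis_divide)
    then have "cos (2 * pi * L * s - 2 * pi * L * s0) = 1" by (simp add: complex_eq_iff)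
    then obtain k :: int where "2 * pi * L * s - 2 * pi * L * s0 = of_int k * 2 * pi"
      using cos_one_2pi_int by blast
    then have "2 * pi * (L * (s - s0)) = 2 * pi * of_int k" by (simp add: algebra_simps)
    then have "L * (s - s0) = of_int k" by simp
    then have "s = s0 + of_int k / L" using assms by (simp add: field_simps)
    then show "s \<in> range (\<lambda>k::int. s0 + of_int k / L)" by blast
  qed
  then show ?thesis by (rule countable_subset) simp
qed simp

lemma sgn_torus_prod:
  fixes z :: "complex^'n::{finite,linorder}"
  shows "theta m t (w *s z) $ coord CARD('n) = w ^ (CARD('n) * (m div t)) * (\<Prod>i\<in>UNIV. z $ i) ^ (m div t)"
  unfolding theta_last by (simp add: prod.distrib power_mult_distrib power_mult)

text \<open>Slicewise, each summand \<open>peak_term\<close> of the exponent is a non-negative constant times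
  \<open>mobius_J\<close> of a monomial, and \<open>exp \<circ> mobius_J\<close> is \<open>exp 1\<close> times a singular inner function. Hence
  the boundary modulus of the exponential is the exponential of the sum of the constants: equality
  holds because the tails of the exponent vanish at the origin.\<close>

locale peak_series =
  fixes m t :: nat and a x :: "nat \<Rightarrow> real" and n M :: "nat \<Rightarrow> nat" and D :: real
    and dummy :: "'n::{finite,linorder} itself"
  assumes d: "CARD('n) > 1" and m: "m > 0" and t: "t > 0" and mt: "t dvd m"
    and D_eq: "D = (real CARD('n))\<^sup>2"
    and a: "\<And>k. a k \<in> {0, 1}" and x: "\<And>k. x k \<in> {0..D}"
    and M: "\<And>k. M k \<ge> 1"
    and small: "\<And>k. 2 * (1 + ((real k)\<^sup>2 + D)\<^sup>2) ^ n k * (1 - 1 / (real k + 2)) ^ M k * (real k + 2) \<le> (1 / 2) ^ k"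
    and le3: "\<And>N y. y \<in> {0..D} \<Longrightarrow> (\<Sum>k<N. a k * peak D (x k) (n k) y) \<le> 3"
begin

abbreviation c :: "nat \<Rightarrow> real \<Rightarrow> real" where "c k y \<equiv> a k * peak D (x k) (n k) y"

abbreviation F :: "nat \<Rightarrow> (complex, 'n) vec \<Rightarrow> complex" where "F k \<equiv> peak_term t (a k) (x k) (n k) (M k)"

abbreviation W :: "(complex, 'n) vec set" where "W \<equiv> {q. norm (q $ coord CARD('n)) < 1}"

definition f0 :: "(complex, 'n) vec \<Rightarrow> complex" where "f0 q = exp (\<Sum>k. F k q)"

lemma D_pos: "D > 0" by (simp add: D_eq)

lemma v_range:
  fixes z :: "(complex, 'n) vec"
  shows "z \<in> torus \<Longrightarrow> first_coord_sq (theta m t z) \<in> {0..D}"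
  unfolding D_eq by (rule first_coord_sq_range[OF _ d])

lemma c_nonneg: "y \<in> {0..D} \<Longrightarrow> 0 \<le> c k y"
  using a[of k] peak_bounds(1)[OF D_pos x] by auto

lemma summable_c: "y \<in> {0..D} \<Longrightarrow> summable (\<lambda>k. c k y)"
  by (rule summableI_nonneg_bounded[where x = 3]) (auto intro: c_nonneg le3)

lemma suminf_c_le: "y \<in> {0..D} \<Longrightarrow> (\<Sum>k. c k y) \<le> 3"
  by (intro suminf_le_const summable_c le3)

lemma sum_c_le_suminf: "y \<in> {0..D} \<Longrightarrow> (\<Sum>k<N. c k y) \<le> (\<Sum>k. c k y)"
  by (intro sum_le_suminf summable_c) (auto intro: c_nonneg)

text \<open>Near a fixed point the coordinates are bounded by some \<open>R\<close> and the last one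
  by some \<open>\<rho> < 1\<close>. From some \<open>k\<close> on, \<open>R <= k\<close>,
  \<open>\<rho> <= 1 - 1 / (k + 2)\<close> and \<open>1 / (1 - \<rho>) <= k + 2\<close>, so that the
  assumption \<open>small\<close>, made for these growing bounds, dominates the terms by a geometric
  series.\<close>

lemma F_local_bound:
  assumes "q \<in> W"
  shows "\<exists>\<delta>>0. \<exists>B. ball q \<delta> \<subseteq> W \<and> summable B \<and> (\<forall>k. \<forall>p\<in>ball q \<delta>. norm (F k p) \<le> B k)"
proof -
  define s0 where "s0 = norm (q $ coord CARD('n))"
  have s0: "0 \<le> s0" "s0 < 1" using assms by (auto simp: s0_def)
  define \<delta> where "\<delta> = (1 - s0) / 2"
  define \<rho> where "\<rho> = s0 + \<delta>"
  have \<delta>: "0 < \<delta>" "\<delta> \<le> 1" and \<rho>: "0 \<le> \<rho>" "\<rho> < 1" using s0 by (auto simp: \<delta>_def \<rho>_def field_simps)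
  define R where "R = norm q + 1"
  have R: "R \<ge> 0" by (simp add: R_def)
  define B where "B k = 2 * (1 + (R\<^sup>2 + D)\<^sup>2) ^ n k * \<rho> ^ M k / (1 - \<rho>)" for k
  have near: "norm (p $ j) \<le> norm (q $ j) + \<delta>" if "p \<in> ball q \<delta>" for p j
  proof -
    have "norm (p $ j) \<le> norm (q $ j) + norm ((p - q) $ j)"
      using norm_triangle_ineq[of "q $ j" "p $ j - q $ j"] by simp
    also have "norm ((p - q) $ j) \<le> norm (p - q)" by (rule Finite_Cartesian_Product.norm_nth_le)
    finally show ?thesis using that by (simp add: dist_norm norm_minus_commute)
  qed
  have pR: "norm (p $ j) \<le> R" if "p \<in> ball q \<delta>" for p j
    using near[OF that, of j] Finite_Cartesian_Product.norm_nth_le[of q j] \<delta>(2) by (simp add: R_def)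
  have p\<rho>: "norm (p $ coord CARD('n)) \<le> \<rho>" if "p \<in> ball q \<delta>" for p
    using near[OF that, of "coord CARD('n)"] by (simp add: \<rho>_def s0_def)
  have "eventually (\<lambda>k. real k \<ge> R \<and> real k \<ge> 1 / (1 - \<rho>)) sequentially"
    by (intro eventually_conj) (auto intro!: eventually_ge_at_top filterlim_real_sequentially[THEN filterlim_at_top[THEN iffD1, rule_format]])
  then have "eventually (\<lambda>k. norm (B k) \<le> (1 / 2) ^ k) sequentially"
  proof eventually_elim
    case (elim k)
    have k0: "real k > 0" using elim \<rho> by (metis diff_gt_0_iff_gt less_le_trans zero_less_divide_1_iff)
    have "1 / (1 - \<rho>) \<le> real k + 2" using elim by linarith
    then have \<rho>k: "\<rho> \<le> 1 - 1 / (real k + 2)" using \<rho>(2) by (simp add: field_simps)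
    have "B k = 2 * (1 + (R\<^sup>2 + D)\<^sup>2) ^ n k * \<rho> ^ M k * (1 / (1 - \<rho>))" by (simp add: B_def)
    also have "\<dots> \<le> 2 * (1 + ((real k)\<^sup>2 + D)\<^sup>2) ^ n k * (1 - 1 / (real k + 2)) ^ M k * (real k + 2)"
      using elim R \<rho> \<rho>k \<open>1 / (1 - \<rho>) \<le> real k + 2\<close> D_pos
      by (intro mult_mono power_mono add_mono) auto
    also have "\<dots> \<le> (1 / 2) ^ k" by (rule small)
    finally show ?case using \<rho> by (simp add: B_def)
  qed
  then have "summable B" by (rule summable_comparison_test_ev) (simp add: summable_geometric)
  moreover have "norm (F k p) \<le> B k" if "p \<in> ball q \<delta>" for k p
    unfolding B_def D_eq by (rule peak_term_bound[OF a x[unfolded D_eq] M pR[OF that] p\<rho>[OF that] \<rho>(2)])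
  moreover have "ball q \<delta> \<subseteq> W" using p\<rho> \<rho>(2) by fastforce
  ultimately show ?thesis using \<delta>(1) by blast
qed

lemma summable_F: "q \<in> W \<Longrightarrow> summable (\<lambda>k. F k q)"
proof -
  assume "q \<in> W"
  from F_local_bound[OF this] obtain \<delta> B where B: "\<delta> > 0" "summable B" "\<forall>k. \<forall>p\<in>ball q \<delta>. norm (F k p) \<le> B k" by blast
  then have "norm (F k q) \<le> B k" for k by simp
  then show ?thesis by (intro summable_comparison_test'[OF B(2), of 0])
qed

lemma open_W: "open W"
  by (rule open_Collect_less) (intro continuous_intros)+

lemma holomorphic_f0: "holomorphic_vec_on f0 W"
  unfolding f0_def
  by (intro holomorphic_vec_on_exp holomorphic_vec_on_suminf[OF open_W holomorphic_peak_term[OF M]] F_local_bound)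

lemma mdt: "m div t > 0"
  using mt m t by (simp add: div_greater_zero_iff dvd_imp_le)

lemma slice_in_W:
  assumes z: "z \<in> torus" and w: "norm w < 1"
  shows "theta m t (w *s z) \<in> W"
proof -
  have "norm (\<Prod>i\<in>UNIV. z $ i) = 1" using z by (simp add: torus_def prod_norm[symmetric])
  moreover have "norm w ^ (CARD('n) * (m div t)) < 1"
    using w mdt by (intro power_less_one_iff[THEN iffD2]) auto
  ultimately show ?thesis by (simp add: sgn_torus_prod norm_mult norm_power)
qed

lemma domain_subset_W: "theta m t ` polydisc \<subseteq> W"
proof
  fix q :: "(complex, 'n) vec" assume "q \<in> theta m t ` polydisc"
  then obtain z :: "(complex, 'n) vec" where z: "z \<in> polydisc" "q = theta m t z" by blast
  have "norm (\<Prod>i\<in>UNIV. z $ i) = (\<Prod>i\<in>UNIV. norm (z $ i))" by (simp add: prod_norm)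
  also have "\<dots> < (\<Prod>i\<in>(UNIV::'n set). 1)"
    using z(1) by (intro prod_mono_strict) (auto simp: polydisc_def less_imp_le)
  finally have "norm (\<Prod>i\<in>UNIV. z $ i) < 1" by simp
  then show "q \<in> W" using mdt by (simp add: z(2) theta_last norm_power power_less_one_iff)
qed

lemma slice_F:
  assumes "z \<in> torus"
  shows "F k (theta m t (w *s z)) = of_real (c k (first_coord_sq (theta m t z))) *
    mobius_J ((theta m t (w *s z) $ coord CARD('n)) ^ (M k + 2 * t * n k))"
  unfolding D_eq by (rule peak_term_slice[OF assms d mt])

lemma Re_slice_F_le:
  assumes z: "z \<in> torus" and w: "norm w < 1"
  shows "Re (F k (theta m t (w *s z))) \<le> c k (first_coord_sq (theta m t z))"
proof -
  have "norm (theta m t (w *s z) $ coord CARD('n)) < 1" using slice_in_W[OF z w] by simp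
  then have "norm ((theta m t (w *s z) $ coord CARD('n)) ^ (M k + 2 * t * n k)) < 1"
    using M[of k] unfolding norm_power by (intro power_less_one_iff[THEN iffD2]) auto
  then have "Re (mobius_J ((theta m t (w *s z) $ coord CARD('n)) ^ (M k + 2 * t * n k))) \<le> 1"
    by (rule Re_mobius_J_le)
  then have "c k (first_coord_sq (theta m t z)) * Re (mobius_J ((theta m t (w *s z) $ coord CARD('n)) ^ (M k + 2 * t * n k)))
      \<le> c k (first_coord_sq (theta m t z)) * 1"
    using c_nonneg[OF v_range[OF z]] by (rule mult_left_mono)
  then show ?thesis unfolding slice_F[OF z] by simp
qed

lemma norm_f0_slice_le:
  assumes z: "z \<in> torus" and w: "norm w < 1"
  shows "norm (f0 (theta m t (w *s z))) \<le> exp (\<Sum>k. c k (first_coord_sq (theta m t z)))"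
proof -
  have s: "summable (\<lambda>k. F k (theta m t (w *s z)))" by (rule summable_F[OF slice_in_W[OF z w]])
  have "Re (\<Sum>k. F k (theta m t (w *s z))) = (\<Sum>k. Re (F k (theta m t (w *s z))))"
    by (rule Re_suminf[OF s])
  also have "\<dots> \<le> (\<Sum>k. c k (first_coord_sq (theta m t z)))"
    by (intro suminf_le summable_Re s summable_c v_range z Re_slice_F_le w)
  finally show ?thesis by (simp add: f0_def)
qed

definition f :: "(complex, 'n) vec \<Rightarrow> complex" where "f = restrict f0 (theta m t ` polydisc)"

text \<open>Slices through the torus reach only points whose coordinates have equal moduli.
  \<open>polydisc_maximum_modulus\<close> carries the bound \<open>exp 3\<close> from there to the
  whole polydisc.\<close>

lemma f_in_Hinf: "f \<in> carrier (Hinf (theta m t ` polydisc))"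
  unfolding f_def
proof (rule restrict_in_Hinf)
  show hol: "holomorphic_vec_on f0 (theta m t ` polydisc)"
    by (rule holomorphic_vec_on_subset[OF holomorphic_f0 domain_subset_W])
  fix q :: "(complex, 'n) vec" assume "q \<in> theta m t ` polydisc"
  then obtain z :: "(complex, 'n) vec" where z: "z \<in> polydisc" "q = theta m t z" by blast
  obtain \<rho> and \<zeta> :: "(complex, 'n) vec" where \<rho>: "0 < \<rho>" "\<rho> < 1" "\<zeta> \<in> torus"
    "norm (f0 (theta m t z)) \<le> norm (f0 (theta m t (of_real \<rho> *s \<zeta>)))"
    using polydisc_maximum_modulus[OF hol z(1)] by blast
  note \<rho>(4)
  also have "norm (f0 (theta m t (of_real \<rho> *s \<zeta>))) \<le> exp (\<Sum>k. c k (first_coord_sq (theta m t \<zeta>)))"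
    by (rule norm_f0_slice_le) (use \<rho> in auto)
  also have "\<dots> \<le> exp 3" using suminf_c_le[OF v_range[OF \<rho>(3)]] by simp
  finally show "norm (f0 q) \<le> exp 3" by (simp add: z(2))
qed

lemma f_slice: "z \<in> torus \<Longrightarrow> norm w < 1 \<Longrightarrow> f (theta m t (w *s z)) = f0 (theta m t (w *s z))"
  using polydisc_scale_torus[of w z] by (simp add: f_def)

lemma limit_norm_f_le:
  assumes q: "q \<in> theta m t ` torus" and l: "((\<lambda>r. f (dilate m t r q)) \<longlongrightarrow> l) (at_left (1::real))"
  shows "norm l \<le> exp (\<Sum>k. c k (first_coord_sq q))"
proof (rule tendsto_upperbound[OF tendsto_norm[OF l]])
  obtain z where z: "z \<in> torus" "q = theta m t z" using q by blast
  have "eventually (\<lambda>r::real. r \<in> {0<..<1}) (at_left 1)"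
    by (rule eventually_at_left_real) simp
  then show "eventually (\<lambda>r. norm (f (dilate m t r q)) \<le> exp (\<Sum>k. c k (first_coord_sq q))) (at_left (1::real))"
  proof eventually_elim
    case (elim r)
    then have "norm (complex_of_real r) < 1" by simp
    then show ?case
      unfolding z(2) theta_dilate[symmetric] using norm_f0_slice_le[OF z(1)] f_slice[OF z(1)] by simp
  qed
qed simp

text \<open>The upper bound \<open>exp \<psi>\<close> holds pointwise. For the lower one,
  \<open>f\<close> is divided by the exponential of a partial sum of the exponent: the quotient is 1
  at the origin, and \<open>radial_limit_estimate\<close> there shows that the mean of
  \<open>norm (hs s)\<close> is at least the exponential of the partial sum. In the limit the mean
  is at least \<open>exp \<psi>\<close>, and a function bounded by its mean equals it almost
  everywhere.\<close>

lemma slice_limit_norm_eq: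
  assumes z: "z \<in> torus" and hs[measurable]: "hs \<in> borel_measurable borel"
    and lim: "AE s in lborel. ((\<lambda>r. f (theta m t ((of_real r * cis (2 * pi * s)) *s z))) \<longlongrightarrow> hs s) (at_left (1::real))"
  shows "AE s in lborel. s \<in> {0..1} \<longrightarrow> norm (hs s) = exp (\<Sum>k. c k (first_coord_sq (theta m t z)))"
proof -
  define y where "y = first_coord_sq (theta m t z)"
  have y: "y \<in> {0..D}" unfolding y_def by (rule v_range[OF z])
  define \<psi> where "\<psi> = (\<Sum>k. c k y)"
  define L where "L = CARD('n) * (m div t)"
  have L: "L > 0" using mdt by (simp add: L_def)
  define \<sigma> where "\<sigma> = (\<Prod>i\<in>UNIV. z $ i) ^ (m div t)"
  have \<sigma>: "norm \<sigma> = 1" using z by (simp add: \<sigma>_def torus_def prod_norm[symmetric] norm_power)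
  define K where "K k = M k + 2 * t * n k" for k
  have K: "K k > 0" for k using M[of k] by (simp add: K_def)
  have Fs: "F k (theta m t (w *s z)) = of_real (c k y) * mobius_J ((w ^ L * \<sigma>) ^ K k)" for k w
    unfolding slice_F[OF z] sgn_torus_prod y_def L_def \<sigma>_def K_def ..
  let ?g = "\<lambda>w. f (theta m t (w *s z))"
  have holg: "?g holomorphic_on ball 0 1"
    using f_in_Hinf by (intro slice_holomorphic z) (simp add: carrier_Hinf)
  have hs_le: "AE s in lborel. norm (hs s) \<le> exp \<psi>"
    using lim
  proof eventually_elim
    case (elim s)
    have "cis (2 * pi * s) *s z \<in> torus" using z by (simp add: torus_def norm_mult)
    then have "norm (hs s) \<le> exp (\<Sum>k. c k (first_coord_sq (theta m t (cis (2 * pi * s) *s z))))"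
      using elim by (intro limit_norm_f_le) (auto simp: dilate_theta_slice)
    also have "first_coord_sq (theta m t (cis (2 * pi * s) *s z)) = y"
      unfolding y_def by (rule first_coord_sq_scale) (use d in auto)
    finally show ?case by (simp add: \<psi>_def)
  qed
  have nz: "(w ^ L * \<sigma>) ^ K k \<noteq> 1" if "norm w < 1" for w k
  proof
    assume "(w ^ L * \<sigma>) ^ K k = 1"
    then have "norm ((w ^ L * \<sigma>) ^ K k) = 1" by simp
    moreover have "norm ((w ^ L * \<sigma>) ^ K k) < 1"
      using that \<sigma> L K[of k] by (simp add: norm_power norm_mult power_less_one_iff)
    ultimately show False by simp
  qed
  have low: "exp (\<Sum>k<N. c k y) \<le> (\<integral>s. indicator {0..1} s * norm (hs s) \<partial>lborel)" for N
  proof -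
    define P where "P w = exp (- (\<Sum>k<N. of_real (c k y) * mobius_J ((w ^ L * \<sigma>) ^ K k)))" for w
    define hT where "hT s = hs s * P (cis (2 * pi * s))" for s
    have T: "?g w * P w = exp (\<Sum>k. F (k + N) (theta m t (w *s z)))" if w: "norm w < 1" for w
    proof -
      have "(\<Sum>k. F k (theta m t (w *s z))) = (\<Sum>k. F (k + N) (theta m t (w *s z))) + (\<Sum>k<N. F k (theta m t (w *s z)))"
        by (rule suminf_split_initial_segment[OF summable_F[OF slice_in_W[OF z w]]])
      then show ?thesis
        unfolding f_slice[OF z w] f0_def P_def Fs[symmetric] by (simp add: exp_minus exp_add)
    qed
    \<comment> \<open>\<open>P\<close> itself may be unbounded near the zeros of the denominators.
      The product is the exponential of a tail of the series and inherits the bound from its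
      non-negative coefficients.\<close>
    have bT: "norm (?g w * P w) \<le> exp \<psi>" if w: "norm w < 1" for w
    proof -
      have s: "summable (\<lambda>k. F k (theta m t (w *s z)))" by (rule summable_F[OF slice_in_W[OF z w]])
      then have s': "summable (\<lambda>k. F (k + N) (theta m t (w *s z)))" by (rule summable_ignore_initial_segment)
      have sc: "summable (\<lambda>k. c (k + N) y)" using summable_c[OF y] by (simp only: summable_iff_shift[of "\<lambda>k. c k y"])
      have "Re (\<Sum>k. F (k + N) (theta m t (w *s z))) = (\<Sum>k. Re (F (k + N) (theta m t (w *s z))))"
        by (rule Re_suminf[OF s'])
      also have "\<dots> \<le> (\<Sum>k. c (k + N) y)"
        using sc Re_slice_F_le[OF z w] by (intro suminf_le summable_Re s') (simp_all add: y_def)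
      also have "\<dots> \<le> \<psi>"
        using suminf_split_initial_segment[OF summable_c[OF y], of N] sum_nonneg[of "{..<N}" "\<lambda>k. c k y"] c_nonneg[OF y]
        by (simp add: \<psi>_def)
      finally show ?thesis unfolding T[OF w] by simp
    qed
    have holP: "P holomorphic_on ball 0 1"
      unfolding P_def mobius_J_def using nz by (intro holomorphic_intros) auto
    have ctble: "countable {s. (cis (2 * pi * s) ^ L * \<sigma>) ^ K k = 1}" for k
    proof -
      have "{s. (cis (2 * pi * s) ^ L * \<sigma>) ^ K k = 1} \<subseteq> {s. cis (2 * pi * real (L * K k) * s) = 1 / \<sigma> ^ K k}"
      proof
        fix s assume "s \<in> {s. (cis (2 * pi * s) ^ L * \<sigma>) ^ K k = 1}"
        then have "cis (2 * pi * s) ^ (L * K k) * \<sigma> ^ K k = 1"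
          by (simp add: power_mult_distrib power_mult)
        moreover have "cis (2 * pi * s) ^ (L * K k) = cis (2 * pi * real (L * K k) * s)"
          by (subst Complex.DeMoivre) (simp add: mult_ac)
        moreover have "\<sigma> ^ K k \<noteq> 0" using \<sigma> by auto
        ultimately show "s \<in> {s. cis (2 * pi * real (L * K k) * s) = 1 / \<sigma> ^ K k}"
          by (simp add: eq_divide_eq)
      qed
      then show ?thesis by (rule countable_subset) (use countable_cis_eq[of "real (L * K k)"] L K[of k] in simp)
    qed
    \<comment> \<open>Outside these countably many points \<open>P\<close> extends continuously to
      the circle and each \<open>mobius_J\<close> has real part exactly 1 there.\<close>
    have AEnz: "AE s in lborel. \<forall>k. (cis (2 * pi * s) ^ L * \<sigma>) ^ K k \<noteq> 1"
      unfolding AE_all_countable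
    proof
      show "AE s in lborel. (cis (2 * pi * s) ^ L * \<sigma>) ^ K k \<noteq> 1" for k
        using AE_not_in[OF countable_imp_null_set_lborel[OF ctble[of k]]] by simp
    qed
    have [measurable]: "mobius_J \<in> borel_measurable borel" unfolding mobius_J_def by measurable
    have Pm: "P \<in> borel_measurable borel" unfolding P_def by measurable
    have [measurable]: "(\<lambda>s. P (cis (2 * pi * s))) \<in> borel_measurable borel"
      by (rule measurable_compose[OF _ Pm]) (intro borel_measurable_continuous_onI continuous_intros)
    have F0: "F k (theta m t (0 *s z)) = 0" for k
      unfolding Fs using L K[of k] by (simp add: mobius_J_def zero_power)
    have "norm (?g 0 * P 0) * (1 - norm (0::complex)) \<le> (\<integral>s. indicator {0..1} s * norm (hT s) \<partial>lborel)"
    proof (rule radial_limit_estimate[of "\<lambda>w. ?g w * P w" "exp \<psi>"])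
      show "(\<lambda>w. ?g w * P w) holomorphic_on ball 0 1" by (intro holomorphic_intros holg holP)
      show "norm (?g w * P w) \<le> exp \<psi>" if "w \<in> ball 0 1" for w using that by (intro bT) simp
      show "hT \<in> borel_measurable borel" unfolding hT_def by measurable
      show "AE s in lborel. ((\<lambda>r. ?g (of_real r * cis (2 * pi * s)) * P (of_real r * cis (2 * pi * s))) \<longlongrightarrow> hT s) (at_left (1::real))"
        using lim AEnz
      proof eventually_elim
        case (elim s)
        have "((\<lambda>r. of_real r * cis (2 * pi * s)) \<longlongrightarrow> of_real 1 * cis (2 * pi * s)) (at_left (1::real))"
          by (intro tendsto_intros)
        then have w: "((\<lambda>r. of_real r * cis (2 * pi * s)) \<longlongrightarrow> cis (2 * pi * s)) (at_left (1::real))" by simp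
        have "((\<lambda>r. P (of_real r * cis (2 * pi * s))) \<longlongrightarrow> P (cis (2 * pi * s))) (at_left (1::real))"
          unfolding P_def mobius_J_def using elim(2) by (intro tendsto_intros w) auto
        then show ?case unfolding hT_def by (intro tendsto_mult elim(1))
      qed
    qed simp
    moreover have "?g 0 * P 0 = 1"
      by (subst T) (simp_all only: F0 norm_zero zero_less_one suminf_zero exp_zero)
    moreover have "AE s in lborel. norm (hT s) = norm (hs s) * exp (- (\<Sum>k<N. c k y))"
      using AEnz
    proof eventually_elim
      case (elim s)
      have "Re (mobius_J ((cis (2 * pi * s) ^ L * \<sigma>) ^ K k)) = 1" for k
        using elim \<sigma> by (intro Re_mobius_J_eq) (simp_all add: norm_power norm_mult)
      then show ?case by (simp add: hT_def P_def norm_mult)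
    qed
    then have "(\<integral>s. indicator {0..1} s * norm (hT s) \<partial>lborel) =
        (\<integral>s. (indicator {0..1} s * norm (hs s)) * exp (- (\<Sum>k<N. c k y)) \<partial>lborel)"
    proof (intro integral_cong_AE)
      show "(\<lambda>s. indicator {0..1} s * norm (hT s)) \<in> borel_measurable lborel"
        unfolding hT_def by measurable
      show "(\<lambda>s. (indicator {0..1} s * norm (hs s)) * exp (- (\<Sum>k<N. c k y))) \<in> borel_measurable lborel"
        by measurable
    qed (auto elim: AE_mp)
    ultimately have "1 \<le> (\<integral>s. indicator {0..1} s * norm (hs s) \<partial>lborel) * exp (- (\<Sum>k<N. c k y))"
      by simp
    then show ?thesis by (simp add: exp_minus field_simps)
  qed
  have "(\<lambda>N. exp (\<Sum>k<N. c k y)) \<longlonglongrightarrow> exp \<psi>"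
    unfolding \<psi>_def by (intro tendsto_exp summable_LIMSEQ summable_c y)
  then have int: "exp \<psi> \<le> (\<integral>s. indicator {0..1} s * norm (hs s) \<partial>lborel)"
    by (rule LIMSEQ_le_const2) (use low in blast)
  have i1: "integrable lborel (\<lambda>s. indicator {0..1::real} s * exp \<psi>)"
    by (intro integrable_mult_left integrable_real_indicator) auto
  have i2: "integrable lborel (\<lambda>s. indicator {0..1} s * norm (hs s))"
  proof (rule Bochner_Integration.integrable_bound[OF i1])
    show "AE s in lborel. norm (indicator {0..1} s * norm (hs s)) \<le> norm (indicator {0..1::real} s * exp \<psi>)"
      using hs_le by eventually_elim (simp add: indicator_def)
  qed measurable
  let ?diff = "\<lambda>s. indicator {0..1} s * exp \<psi> - indicator {0..1} s * norm (hs s)"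
  have nn: "AE s in lborel. 0 \<le> ?diff s"
    using hs_le by eventually_elim (auto simp: indicator_def)
  have "(\<integral>s. ?diff s \<partial>lborel) = exp \<psi> - (\<integral>s. indicator {0..1} s * norm (hs s) \<partial>lborel)"
    by (subst Bochner_Integration.integral_diff[OF i1 i2]) simp
  then have "(\<integral>s. ?diff s \<partial>lborel) = 0"
    using int integral_nonneg_AE[OF nn] by linarith
  then have "AE s in lborel. ?diff s = 0"
    using integral_nonneg_eq_0_iff_AE[OF Bochner_Integration.integrable_diff[OF i1 i2] nn] by blast
  then show ?thesis
    by eventually_elim (auto simp: \<psi>_def y_def indicator_def)
qed

end

lemma exists_small_power:
  fixes \<rho> C e :: real
  assumes \<rho>: "0 \<le> \<rho>" "\<rho> < 1" and e: "e > 0"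
  shows "\<exists>M\<ge>1. C * \<rho> ^ M \<le> e"
proof -
  have "(\<lambda>M. C * \<rho> ^ M) \<longlonglongrightarrow> C * 0" using \<rho> by (intro tendsto_intros LIMSEQ_realpow_zero)
  then have "eventually (\<lambda>M. C * \<rho> ^ M < e) sequentially" using e by (intro order_tendstoD(2)) auto
  then have "eventually (\<lambda>M. C * \<rho> ^ M < e \<and> M \<ge> 1) sequentially"
    by (intro eventually_conj eventually_ge_at_top)
  then obtain M where "C * \<rho> ^ M < e" "M \<ge> 1" using eventually_happens sequentially_bot by blast
  then show ?thesis by (intro exI[of _ M]) simp
qed

theorem exists_boundary_gap:
  fixes m t :: nat and dummy :: "'n::{finite,linorder} itself"
  assumes d: "CARD('n) > 1" and m: "m > 0" and t: "t > 0" and mt: "t dvd m"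
  obtains f :: "(complex, 'n) vec \<Rightarrow> complex" and K E :: "(complex, 'n) vec set" where
    "f \<in> carrier (Hinf (theta m t ` polydisc))"
    "K \<subseteq> theta m t ` torus" "K \<in> sets (restrict_space borel (theta m t ` torus))"
    "open {x. theta m t (torus_point x) \<in> K}"
    "\<And>U. open U \<Longrightarrow> U \<noteq> {} \<Longrightarrow> \<exists>x\<in>U. theta m t (torus_point x) \<in> K"
    "\<And>c z. norm c = 1 \<Longrightarrow> z \<in> torus \<Longrightarrow> theta m t z \<in> K \<Longrightarrow> theta m t (c *s z) \<in> K"
    "E \<in> sets (boundary_measure m t)" "emeasure (boundary_measure m t) E \<noteq> 0"
    "\<And>h. h \<in> boundary_fun m t f \<Longrightarrow> AE q in boundary_measure m t. q \<in> K \<longrightarrow> exp (3 / 4) \<le> norm (h q)"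
    "\<And>h. h \<in> boundary_fun m t f \<Longrightarrow> AE q in boundary_measure m t. q \<in> E \<longrightarrow> norm (h q) \<le> exp (1 / 2)"
proof -
  let ?M = "boundary_measure m t :: ((complex, 'n) vec) measure"
  let ?R = "restrict_space borel (theta m t ` torus) :: ((complex, 'n) vec) measure"
  interpret bm: prob_space ?M by (rule prob_space_boundary_measure)
  define D where "D = (real CARD('n))\<^sup>2"
  have D: "D > 0" by (simp add: D_def)
  have vR[measurable]: "first_coord_sq \<in> borel_measurable ?R"
    by (intro borel_measurable_continuous_on_restrict continuous_first_coord_sq)
  then have vm[measurable]: "first_coord_sq \<in> borel_measurable ?M"
    by (simp add: sets_boundary_measure cong: measurable_cong_sets)
  define \<nu> where "\<nu> = distr ?M borel first_coord_sq"
  have "prob_space \<nu>" unfolding \<nu>_def by (rule bm.prob_space_distr[OF vm])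
  then interpret \<nu>: prob_space \<nu> .
  have \<nu>s: "sets \<nu> = sets borel" by (simp add: \<nu>_def)
  have \<nu>D: "measure \<nu> {0..D} = 1"
  proof -
    have "AE q in ?M. first_coord_sq q \<in> {0..D}"
      using AE_space[of ?M] by eventually_elim (use first_coord_sq_range[OF _ d] in \<open>auto simp: space_boundary_measure D_def\<close>)
    then have "AE y in \<nu>. y \<in> {0..D}" unfolding \<nu>_def by (subst AE_distr_iff) auto
    then show ?thesis by (intro \<nu>.prob_eq_1[THEN iffD2]) (auto simp: \<nu>s)
  qed
  obtain x where x: "\<And>k::nat. x k \<in> {0..D}" "\<And>k. measure \<nu> {x k} = 0"
    "\<And>u v. 0 \<le> u \<Longrightarrow> u < v \<Longrightarrow> v \<le> D \<Longrightarrow> \<exists>k. u < x k \<and> x k < v"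
    using dense_sequence_of_non_atoms[OF D \<nu>.finite_measure_axioms] by blast
  obtain a n where an: "\<And>k. a k \<in> {0, 1 :: real}"
    "\<And>N y. y \<in> {0..D} \<Longrightarrow> (\<Sum>k<N. a k * peak D (x k) (n k) y) \<le> 3"
    "\<And>k. \<exists>N. (\<Sum>j<N. a j * peak D (x j) (n j) (x k)) \<ge> 1"
    "\<exists>E\<in>sets borel. E \<subseteq> {0..D} \<and> measure \<nu> E > 0 \<and>
      (\<forall>y\<in>E. \<forall>N. (\<Sum>k<N. a k * peak D (x k) (n k) y) \<le> 1 / 2)"
    by (rule exists_peak_sum[where x = x, OF D x(1) \<nu>.finite_measure_axioms \<nu>s \<nu>D x(2)]) (rule that; assumption)
  \<comment> \<open>The exponents \<open>M\<close> are chosen after the peaks. They do not change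
    the boundary moduli and can be taken so large that the series converges.\<close>
  have "\<exists>M\<ge>1. (2 * (1 + ((real k)\<^sup>2 + D)\<^sup>2) ^ n k * (real k + 2)) * (1 - 1 / (real k + 2)) ^ M \<le> (1 / 2) ^ k" for k
    by (intro exists_small_power) (auto simp: field_simps)
  then have "\<exists>M. \<forall>k. M k \<ge> 1 \<and> (2 * (1 + ((real k)\<^sup>2 + D)\<^sup>2) ^ n k * (real k + 2)) * (1 - 1 / (real k + 2)) ^ M k \<le> (1 / 2) ^ k"
    by (intro choice allI)
  then obtain M where M: "\<And>k. M k \<ge> 1"
    "\<And>k. (2 * (1 + ((real k)\<^sup>2 + D)\<^sup>2) ^ n k * (real k + 2)) * (1 - 1 / (real k + 2)) ^ M k \<le> (1 / 2) ^ k"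
    by blast
  interpret P: peak_series m t a x n M D "TYPE('n)"
  proof
    show "2 * (1 + ((real k)\<^sup>2 + D)\<^sup>2) ^ n k * (1 - 1 / (real k + 2)) ^ M k * (real k + 2) \<le> (1 / 2) ^ k" for k
      using M(2)[of k] by (simp only: mult_ac)
  qed (use assms an(1,2) x(1) M(1) D_def in auto)
  let ?\<Psi> = "\<lambda>N y. \<Sum>k<N. a k * peak D (x k) (n k) y"
  have cont\<Psi>: "continuous_on UNIV (?\<Psi> N)" for N by (intro continuous_intros continuous_peak)
  then have [measurable]: "?\<Psi> N \<in> borel_measurable borel" for N by (intro borel_measurable_continuous_onI)
  \<comment> \<open>Some partial sum reaches 1 at each peak, while all are at most 1/2 over
    \<open>E0\<close>; the value 3/4 separates the two. Partial sums are used instead of the limit,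
    so that the set is a union of relatively open sets.\<close>
  define K :: "(complex, 'n) vec set" where "K = {q \<in> theta m t ` torus. \<exists>N. 3 / 4 < ?\<Psi> N (first_coord_sq q)}"
  obtain E0 where E0: "E0 \<in> sets borel" "E0 \<subseteq> {0..D}" "measure \<nu> E0 > 0" "\<And>y N. y \<in> E0 \<Longrightarrow> ?\<Psi> N y \<le> 1 / 2"
    using an(4) by blast
  define E where "E = first_coord_sq -` E0 \<inter> space ?M"
  have "continuous_on UNIV (\<lambda>x :: (real, 'n) vec. first_coord_sq (theta m t (torus_point x)))"
    by (rule continuous_on_compose2[OF continuous_first_coord_sq[of UNIV]])
      (auto intro!: continuous_on_compose2[OF continuous_theta[of UNIV]] continuous_torus_point)
  then have contx: "continuous_on UNIV (\<lambda>x :: (real, 'n) vec. ?\<Psi> N (first_coord_sq (theta m t (torus_point x))))" for N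
    by (rule continuous_on_compose2[OF cont\<Psi>]) auto
  have KR: "K \<in> sets ?R"
  proof -
    have "{q \<in> space ?R. \<exists>N. 3 / 4 < ?\<Psi> N (first_coord_sq q)} \<in> sets ?R" by measurable
    then show ?thesis by (simp add: K_def space_restrict_space)
  qed
  show ?thesis
  proof (rule that[of P.f K E])
    show "P.f \<in> carrier (Hinf (theta m t ` polydisc))" by (rule P.f_in_Hinf)
    show "K \<subseteq> theta m t ` torus" by (auto simp: K_def)
    show "K \<in> sets ?R" by (rule KR)
    have "{x. theta m t (torus_point x) \<in> K} = (\<Union>N. {x. 3 / 4 < ?\<Psi> N (first_coord_sq (theta m t (torus_point x)))})"
      by (auto simp: K_def)
    also have "open \<dots>" by (intro open_UN ballI open_Collect_less[OF continuous_on_const contx])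
    finally show "open {x. theta m t (torus_point x) \<in> K}" .
    show "\<exists>x\<in>U. theta m t (torus_point x) \<in> K" if U: "open U" "U \<noteq> {}" for U
    proof -
      obtain y k where y: "y \<in> U" "first_coord_sq (theta m t (torus_point y)) = x k"
        using peak_set_dense[OF d m U x(3)[unfolded D_def]] by blast
      obtain N where "?\<Psi> N (x k) \<ge> 1" using an(3) by blast
      then have "3 / 4 < ?\<Psi> N (first_coord_sq (theta m t (torus_point y)))" by (simp only: y(2))
      then show ?thesis using y(1) by (auto simp: K_def)
    qed
    show "theta m t (c *s z) \<in> K" if "norm c = 1" "z \<in> torus" "theta m t z \<in> K" for c z
    proof -
      have "c *s z \<in> torus" using that by (simp add: torus_def norm_mult)
      then show ?thesis using that(3) first_coord_sq_scale[OF that(1) d, of m t z] by (auto simp: K_def)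
    qed
    show "E \<in> sets ?M" unfolding E_def using E0(1) by measurable
    have "emeasure ?M E = emeasure \<nu> E0" unfolding E_def \<nu>_def using E0(1) by (simp add: emeasure_distr)
    also have "\<dots> \<noteq> 0" using E0(3) by (metis enn2real_0 less_irrefl measure_def)
    finally show "emeasure ?M E \<noteq> 0" .
    fix h assume h: "h \<in> boundary_fun m t P.f"
    have hm: "h \<in> borel_measurable ?R"
      using h by (simp add: boundary_fun_def ess_bounded_def sets_boundary_measure cong: measurable_cong_sets)
    have lim: "AE q in ?M. ((\<lambda>r. P.f (dilate m t r q)) \<longlongrightarrow> h q) (at_left (1::real))"
      using h by (simp add: boundary_fun_def)
    show "AE q in ?M. q \<in> E \<longrightarrow> norm (h q) \<le> exp (1 / 2)"
      using lim AE_space[of ?M]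
    proof eventually_elim
      case (elim q)
      have "norm (h q) \<le> exp (\<Sum>k. P.c k (first_coord_sq q))"
        using elim by (intro P.limit_norm_f_le) (auto simp: space_boundary_measure)
      also have "\<dots> \<le> exp (1 / 2)" if "q \<in> E"
      proof -
        have "first_coord_sq q \<in> E0" using that by (simp add: E_def)
        then have "(\<Sum>k. P.c k (first_coord_sq q)) \<le> 1 / 2"
          using E0(2,4) by (intro suminf_le_const P.summable_c) auto
        then show ?thesis by simp
      qed
      finally show ?case by blast
    qed
    have Qm: "{q \<in> theta m t ` torus. q \<in> K \<longrightarrow> exp (3 / 4) \<le> norm (h q)} \<in> sets ?R"
    proof -
      have [measurable]: "Measurable.pred ?R (\<lambda>q. q \<in> K)" using KR by (rule pred_sets2[OF _ measurable_ident_sets[OF refl], unfolded])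
      have "{q \<in> space ?R. q \<in> K \<longrightarrow> exp (3 / 4) \<le> norm (h q)} \<in> sets ?R" using hm by measurable
      then show ?thesis by (simp add: space_restrict_space)
    qed
    show "AE q in ?M. q \<in> K \<longrightarrow> exp (3 / 4) \<le> norm (h q)"
      unfolding AE_boundary_measure_slices[OF Qm]
      using boundary_fun_slices[OF h AE_I2[OF TrueI]]
    proof eventually_elim
      case (elim y)
      let ?z = "torus_point y"
      let ?Q = "\<lambda>c. theta m t (c *s ?z) \<in> K \<longrightarrow> exp (3 / 4) \<le> norm (h (theta m t (c *s ?z)))"
      obtain hs where hs: "hs \<in> borel_measurable borel"
        "AE s in (lborel :: real measure). hs s = h (theta m t (cis (2 * pi * s) *s ?z)) \<and>
          ((\<lambda>r. P.f (theta m t ((of_real r * cis (2 * pi * s)) *s ?z))) \<longlongrightarrow> hs s) (at_left (1::real)) \<and> True"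
        using elim by (rule bexE)
      have "AE s in lborel. ((\<lambda>r. P.f (theta m t ((of_real r * cis (2 * pi * s)) *s ?z))) \<longlongrightarrow> hs s) (at_left (1::real))"
        using hs(2) by eventually_elim blast
      from P.slice_limit_norm_eq[OF torus_point_in_torus hs(1) this] hs(2)
      have "AE s in lborel. s \<in> {0..1} \<longrightarrow> ?Q (cis (2 * pi * s))"
      proof eventually_elim
        case (elim s)
        have v: "first_coord_sq (theta m t (cis (2 * pi * s) *s ?z)) = first_coord_sq (theta m t ?z)"
          by (rule first_coord_sq_scale) (use d in auto)
        have "exp (3 / 4) \<le> exp (\<Sum>k. P.c k (first_coord_sq (theta m t ?z)))" if "theta m t (cis (2 * pi * s) *s ?z) \<in> K"
        proof -
          have "\<exists>N. 3 / 4 < ?\<Psi> N (first_coord_sq (theta m t (cis (2 * pi * s) *s ?z)))"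
            using that unfolding K_def mem_Collect_eq by (rule conjunct2)
          then obtain N where "3 / 4 < ?\<Psi> N (first_coord_sq (theta m t (cis (2 * pi * s) *s ?z)))" ..
          then have "3 / 4 < ?\<Psi> N (first_coord_sq (theta m t ?z))" by (simp only: v)
          also have "\<dots> \<le> (\<Sum>k. P.c k (first_coord_sq (theta m t ?z)))"
            by (rule P.sum_c_le_suminf[OF P.v_range]) simp
          finally show ?thesis by simp
        qed
        then show ?case using elim by auto
      qed
      then show "AE s in lborel. ?Q (cis (2 * pi * s))"
      proof (rule AE_unit_interval_periodic[rotated])
        show "Measurable.pred borel (\<lambda>s. ?Q (cis (2 * pi * s)))"
        proof -
          have "theta m t (cis (2 * pi * s) *s ?z) \<in> theta m t ` torus" for s
            by (rule imageI) (simp add: torus_def norm_mult)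
          then show ?thesis
            using measurable_sets[OF measurable_slice[OF torus_point_in_torus[of y]] Qm]
            unfolding pred_def vimage_def by simp
        qed
      qed
    qed
  qed
qed

section \<open>The closed boundary given by an invariant set, and a character outside it\<close>

lemma polydisc_nonempty: "(polydisc :: (complex^'n) set) \<noteq> {}"
  by (auto simp: polydisc_def intro!: exI[of _ 0])

text \<open>The preimage in the parameter space is open and non-empty, hence not a Lebesgue null
  set. This provides a character that is 1 on the indicator of \<open>K\<close>.\<close>

lemma invariant_set_not_null:
  fixes K :: "(complex, 'n::{finite,linorder}) vec set"
  assumes K: "K \<subseteq> theta m t ` torus" "K \<in> sets (restrict_space borel (theta m t ` torus))"
    and openK: "open {x. theta m t (torus_point x) \<in> K}"
    and denseK: "\<And>U. open U \<Longrightarrow> U \<noteq> {} \<Longrightarrow> \<exists>x\<in>U. theta m t (torus_point x) \<in> K"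
  shows "emeasure (boundary_measure m t) K \<noteq> 0"
proof
  assume "emeasure (boundary_measure m t) K = 0"
  then have "AE q in boundary_measure m t. q \<notin> K"
    using K(2) by (intro AE_not_in) (auto simp: null_sets_def sets_boundary_measure)
  moreover have "{q \<in> theta m t ` torus. q \<notin> K} \<in> sets (restrict_space borel (theta m t ` torus))"
  proof -
    have "space (restrict_space borel (theta m t ` torus)) - K \<in> sets (restrict_space borel (theta m t ` torus))"
      using K(2) by auto
    also have "space (restrict_space borel (theta m t ` torus)) - K = {q \<in> theta m t ` torus. q \<notin> K}"
      by (auto simp: space_restrict_space)
    finally show ?thesis .
  qed
  ultimately have "AE x in lborel. theta m t (torus_point x) \<notin> K"
    by (simp only: AE_boundary_measure)
  then have "{x. theta m t (torus_point x) \<in> K} \<in> null_sets lborel"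
    using openK by (subst AE_iff_null_sets) auto
  moreover have "{x. theta m t (torus_point x) \<in> K} \<noteq> {}" using denseK[of UNIV] by auto
  ultimately show False
    using open_not_negligible[OF openK] by (simp add: negligible_iff_null_sets null_sets_completionI)
qed

text \<open>By compactness some character in the set attains the largest modulus \<open>c\<close> at
  the boundary function. If that function exceeded \<open>c\<close> on a non-null part of
  \<open>K\<close>, a character concentrated there would exceed \<open>c\<close> as well. So its
  modulus is at most \<open>c\<close> almost everywhere on \<open>K\<close>, which bounds
  \<open>f\<close> on the domain and with it all characters.\<close>

theorem closed_boundary_of_invariant_set:
  fixes K :: "(complex, 'n::{finite,linorder}) vec set"
  assumes K: "K \<subseteq> theta m t ` torus" "K \<in> sets (restrict_space borel (theta m t ` torus))"
    and openK: "open {x. theta m t (torus_point x) \<in> K}"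
    and denseK: "\<And>U. open U \<Longrightarrow> U \<noteq> {} \<Longrightarrow> \<exists>x\<in>U. theta m t (torus_point x) \<in> K"
    and invK: "\<And>c z. norm c = 1 \<Longrightarrow> z \<in> torus \<Longrightarrow> theta m t z \<in> K \<Longrightarrow> theta m t (c *s z) \<in> K"
  shows "closed_boundary (theta m t ` polydisc) (tau1 m t `
    {\<phi> \<in> characters (Linf (boundary_measure m t)). \<phi> (Linf_class (boundary_measure m t) (indicator K)) = 1})"
proof -
  let ?M = "boundary_measure m t :: ((complex, 'n) vec) measure"
  let ?\<Omega> = "theta m t ` polydisc :: (complex, 'n) vec set"
  let ?X = "maximal_ideal_space (Linf ?M)"
  let ?XK = "{\<phi> \<in> characters (Linf ?M). \<phi> (Linf_class ?M (indicator K)) = 1}"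
  have \<Omega>: "?\<Omega> \<noteq> {}" using polydisc_nonempty by auto
  have KM: "K \<in> sets ?M" using K(2) by (simp add: sets_boundary_measure)
  have indK: "indicator K \<in> ess_bounded ?M"
    using KM by (intro ess_boundedI[of _ _ 1]) (auto simp: indicator_def)
  have indcar: "Linf_class ?M (indicator K) \<in> carrier (Linf ?M)" by (rule Linf_class_in_carrier[OF indK])
  have "closedin ?X {\<phi> \<in> topspace ?X. \<phi> (Linf_class ?M (indicator K)) \<in> {1}}"
    by (rule closedin_continuous_map_preimage[OF continuous_map_evaluation[OF indcar]]) simp
  then have XKcl: "closedin ?X ?XK" by (simp add: topspace_maximal_ideal_space)
  have XKc: "compactin ?X ?XK"
    by (rule closedin_compact_space[OF bounded_characters.compact_maximal_ideal_space[OF bounded_characters_Linf] XKcl])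
  have "compactin (maximal_ideal_space (Hinf ?\<Omega>)) (tau1 m t ` ?XK)"
    by (rule image_compactin[OF XKc continuous_map_tau1])
  then have cl: "closedin (maximal_ideal_space (Hinf ?\<Omega>)) (tau1 m t ` ?XK)"
    by (rule compactin_imp_closedin[OF Hausdorff_maximal_ideal_space])
  have chK: "\<exists>\<phi>\<in>?XK. \<forall>h S. h \<in> ess_bounded ?M \<longrightarrow> closed S \<longrightarrow> (AE q in ?M. q \<in> A \<longrightarrow> h q \<in> S) \<longrightarrow> \<phi> (Linf_class ?M h) \<in> S"
    if A: "A \<in> sets ?M" "A \<subseteq> K" "emeasure ?M A \<noteq> 0" for A
  proof -
    obtain \<phi> where \<phi>: "\<phi> \<in> characters (Linf ?M)"
      "\<And>h S. h \<in> ess_bounded ?M \<Longrightarrow> closed S \<Longrightarrow> (AE q in ?M. q \<in> A \<longrightarrow> h q \<in> S) \<Longrightarrow> \<phi> (Linf_class ?M h) \<in> S"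
      using Linf_character_exists[OF A(1,3)] by blast
    have "\<phi> (Linf_class ?M (indicator K)) \<in> {1}"
      by (rule \<phi>(2)[OF indK]) (use A(2) in \<open>auto intro!: AE_I2\<close>)
    then show ?thesis using \<phi> by (intro bexI[of _ \<phi>]) auto
  qed
  have ne: "?XK \<noteq> {}"
    using chK[OF KM order_refl invariant_set_not_null[OF K openK denseK]] by blast
  have "\<exists>y\<in>tau1 m t ` ?XK. \<forall>x\<in>characters (Hinf ?\<Omega>). norm (x f) \<le> norm (y f)" if f: "f \<in> carrier (Hinf ?\<Omega>)" for f
  proof -
    obtain h where h: "h \<in> boundary_fun m t f" using boundary_fun_nonempty[OF f] by blast
    have hb: "h \<in> ess_bounded ?M" by (rule boundary_fun_ess_bounded[OF h])
    have hm[measurable]: "h \<in> borel_measurable ?M" by (rule ess_bounded_measurable[OF hb])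
    have tau: "tau1 m t \<phi> f = \<phi> (Linf_class ?M h)" for \<phi>
      using f boundary_fun_eq_Linf_class[OF h] by (simp add: tau1_def)
    have "\<exists>y\<in>?XK. \<forall>x\<in>?XK. norm (x (Linf_class ?M h)) \<le> norm (y (Linf_class ?M h))"
      by (rule compactin_attains_sup[OF XKc continuous_map_norm[OF continuous_map_evaluation[OF Linf_class_in_carrier[OF hb]]] ne])
    then obtain y where y: "y \<in> ?XK" "\<And>x. x \<in> ?XK \<Longrightarrow> norm (x (Linf_class ?M h)) \<le> norm (y (Linf_class ?M h))"
      by blast
    define c where "c = norm (y (Linf_class ?M h))"
    \<comment> \<open>The margin is needed because only closed conditions pass to the character, and
      exceeding \<open>c\<close> by a fixed amount is one. Countably many margins then give
      \<open>c\<close> itself.\<close>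
    have "AE q in ?M. q \<in> K \<longrightarrow> norm (h q) < c + 1 / (real n + 1)" for n :: nat
    proof (rule ccontr)
      let ?A = "{q \<in> space ?M. q \<in> K \<and> c + 1 / (real n + 1) \<le> norm (h q)}"
      have Am: "?A \<in> sets ?M"
      proof -
        have "{q \<in> space ?M. c + 1 / (real n + 1) \<le> norm (h q)} \<in> sets ?M" by measurable
        then have "K \<inter> {q \<in> space ?M. c + 1 / (real n + 1) \<le> norm (h q)} \<in> sets ?M" using KM by (rule sets.Int[rotated])
        also have "K \<inter> {q \<in> space ?M. c + 1 / (real n + 1) \<le> norm (h q)} = ?A" by auto
        finally show ?thesis .
      qed
      assume neg: "\<not> (AE q in ?M. q \<in> K \<longrightarrow> norm (h q) < c + 1 / (real n + 1))"
      have "emeasure ?M ?A \<noteq> 0"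
      proof
        assume "emeasure ?M ?A = 0"
        then have "AE q in ?M. q \<notin> ?A" using Am by (intro AE_not_in) (auto simp: null_sets_def)
        then have "AE q in ?M. q \<in> K \<longrightarrow> norm (h q) < c + 1 / (real n + 1)"
          using AE_space[of ?M] by eventually_elim auto
        then show False using neg by blast
      qed
      with Am obtain \<phi> where \<phi>: "\<phi> \<in> ?XK"
        "\<And>h S. h \<in> ess_bounded ?M \<Longrightarrow> closed S \<Longrightarrow> (AE q in ?M. q \<in> ?A \<longrightarrow> h q \<in> S) \<Longrightarrow> \<phi> (Linf_class ?M h) \<in> S"
        using chK[of ?A] by blast
      have "\<phi> (Linf_class ?M h) \<in> {z. c + 1 / (real n + 1) \<le> norm z}"
        by (rule \<phi>(2)[OF hb]) (auto intro!: closed_Collect_le continuous_intros)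
      moreover have "norm (\<phi> (Linf_class ?M h)) \<le> c" unfolding c_def by (rule y(2)[OF \<phi>(1)])
      moreover have "1 / (real n + 1) > 0" by simp
      ultimately show False unfolding mem_Collect_eq by linarith
    qed
    then have "AE q in ?M. \<forall>n::nat. q \<in> K \<longrightarrow> norm (h q) < c + 1 / (real n + 1)"
      by (subst AE_all_countable) blast
    then have "AE q in ?M. q \<in> K \<longrightarrow> norm (h q) \<le> c"
    proof eventually_elim
      case (elim q)
      show ?case
      proof
        assume "q \<in> K"
        show "norm (h q) \<le> c"
        proof (rule field_le_epsilon)
          fix e :: real assume "e > 0"
          then obtain k where "inverse (real (Suc k)) < e" using reals_Archimedean by blast
          moreover have "norm (h q) < c + 1 / (real k + 1)" using elim \<open>q \<in> K\<close> by blast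
          ultimately show "norm (h q) \<le> c + e" by (simp add: inverse_eq_divide add.commute)
        qed
      qed
    qed
    then have "norm (f z) \<le> c" if "z \<in> ?\<Omega>" for z
      using norm_determined_by_invariant_set[OF f h K openK denseK invK _ that] by blast
    then have "norm (x f) \<le> c" if "x \<in> characters (Hinf ?\<Omega>)" for x
      by (rule Hinf_character_le[OF that f])
    then show ?thesis using y(1) by (intro bexI[of _ "tau1 m t y"]) (auto simp: tau c_def)
  qed
  then show ?thesis
    unfolding closed_boundary_iff[OF \<Omega>] norm_boundary_def topspace_maximal_ideal_space using cl by auto
qed

theorem theorem2p5:
  fixes m t :: nat
  assumes "CARD('n::{finite,linorder}) > 1"
    and "m > 0" and "t > 0" and "t dvd m"
  shows "continuous_map
           (maximal_ideal_space (Linf (boundary_measure m t :: ((complex, 'n) vec) measure)))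
           (maximal_ideal_space (Hinf (theta m t ` polydisc)))
           (tau1 m t) \<and>
         silov_boundary (theta m t ` (polydisc :: ((complex, 'n) vec) set)) \<subset>
           tau1 m t ` topspace (maximal_ideal_space (Linf (boundary_measure m t :: ((complex, 'n) vec) measure)))"
proof
  let ?M = "boundary_measure m t :: ((complex, 'n) vec) measure"
  let ?\<Omega> = "theta m t ` polydisc :: (complex, 'n) vec set"
  show "continuous_map (maximal_ideal_space (Linf ?M)) (maximal_ideal_space (Hinf ?\<Omega>)) (tau1 m t)"
    by (rule continuous_map_tau1)
  obtain f :: "(complex, 'n) vec \<Rightarrow> complex" and K E where f: "f \<in> carrier (Hinf ?\<Omega>)"
    and K: "K \<subseteq> theta m t ` torus" "K \<in> sets (restrict_space borel (theta m t ` torus))"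
      "open {x. theta m t (torus_point x) \<in> K}"
      "\<And>U. open U \<Longrightarrow> U \<noteq> {} \<Longrightarrow> \<exists>x\<in>U. theta m t (torus_point x) \<in> K"
      "\<And>c z. norm c = 1 \<Longrightarrow> z \<in> torus \<Longrightarrow> theta m t z \<in> K \<Longrightarrow> theta m t (c *s z) \<in> K"
    and E: "E \<in> sets ?M" "emeasure ?M E \<noteq> 0"
    and hK: "\<And>h. h \<in> boundary_fun m t f \<Longrightarrow> AE q in ?M. q \<in> K \<longrightarrow> exp (3 / 4) \<le> norm (h q)"
    and hE: "\<And>h. h \<in> boundary_fun m t f \<Longrightarrow> AE q in ?M. q \<in> E \<longrightarrow> norm (h q) \<le> exp (1 / 2)"
    using exists_boundary_gap[OF assms] by blast
  obtain h where h: "h \<in> boundary_fun m t f" using boundary_fun_nonempty[OF f] by blast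
  have hb: "h \<in> ess_bounded ?M" by (rule boundary_fun_ess_bounded[OF h])
  have tau: "tau1 m t \<phi> f = \<phi> (Linf_class ?M h)" for \<phi>
    using f boundary_fun_eq_Linf_class[OF h] by (simp add: tau1_def)
  let ?XK = "{\<phi> \<in> characters (Linf ?M). \<phi> (Linf_class ?M (indicator K)) = 1}"
  have "?\<Omega> \<noteq> {}" using polydisc_nonempty by auto
  then have sub: "silov_boundary ?\<Omega> \<subseteq> tau1 m t ` ?XK"
    using closed_boundary_of_invariant_set[OF K] by (rule silov_boundary_subset)
  \<comment> \<open>A character concentrated on \<open>E\<close>, where the boundary function has
    modulus at most \<open>exp (1 / 2)\<close>. On the closed boundary the modulus at
    \<open>f\<close> is at least \<open>exp (3 / 4)\<close>, so the image of this character lies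
    outside it.\<close>
  obtain \<phi> where \<phi>: "\<phi> \<in> characters (Linf ?M)"
    "\<And>h S. h \<in> ess_bounded ?M \<Longrightarrow> closed S \<Longrightarrow> (AE q in ?M. q \<in> E \<longrightarrow> h q \<in> S) \<Longrightarrow> \<phi> (Linf_class ?M h) \<in> S"
    using Linf_character_exists[OF E] by blast
  have "\<phi> (Linf_class ?M h) \<in> cball 0 (exp (1 / 2))"
    by (rule \<phi>(2)[OF hb]) (use hE[OF h] in auto)
  then have small: "norm (tau1 m t \<phi> f) \<le> exp (1 / 2)" by (simp add: tau)
  have large: "exp (3 / 4) \<le> norm (tau1 m t \<psi> f)" if "\<psi> \<in> ?XK" for \<psi>
    unfolding tau using that K(2) by (intro Linf_character_ge[OF _ _ _ hb hK[OF h]]) (auto simp: sets_boundary_measure)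
  have "exp (1 / 2) < exp (3 / 4 :: real)" by simp
  have "tau1 m t \<phi> \<notin> tau1 m t ` ?XK"
  proof
    assume "tau1 m t \<phi> \<in> tau1 m t ` ?XK"
    then obtain \<psi> where "\<psi> \<in> ?XK" "tau1 m t \<phi> = tau1 m t \<psi>" by blast
    have "exp (3 / 4) \<le> norm (tau1 m t \<phi> f)" unfolding \<open>tau1 m t \<phi> = tau1 m t \<psi>\<close> by (rule large) fact
    with small \<open>exp (1 / 2) < exp (3 / 4 :: real)\<close> show False by linarith
  qed
  then show "silov_boundary ?\<Omega> \<subset> tau1 m t ` topspace (maximal_ideal_space (Linf ?M))"
    using sub \<phi>(1) by (auto simp: topspace_maximal_ideal_space)
qed

end
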